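(* Let $\omega\in C^\infty(\mathbb{R})$ be a strictly convex superlinear function for which $\omega(p)\ge\omega(0)=0$ for all $p$. Then there is a rectifiable compact set $S\subset\mathbb{R}^2$ of positive linear measure that is contained in the universal singular set of some Lagrangian $L$ of the form $L(x,y,p)=\omega(p)+F(x,y,p)$, where 1. $F\in C^\infty(\mathbb{R}^3)$; 2. $F\ge0$ and $F(x,y,0)=0$ for all $x,y\in\mathbb{R}$; 3. $p\mapsto F(x,y,p)$ is convex for each fixed $(x,y)$.
   Context: A function $\omega\colon\mathbb{R}\to\mathbb{R}$ is superlinear if $\lim_{|p|\to\infty}\omega(p)/|p|=\infty$. A Lagrangian is a function $L\colon\mathbb{R}^3\to\mathbb{R}$ that is Borel measurable, bounded from below, locally bounded from above, and for which there is a superlinear function $\omega\colon\mathbb{R}\to\mathbb{R}$ with $L(x,y,p)\ge\omega(p)$ for all $(x,y,p)\in\mathbb{R}^3$. $AC[a,b]$ denotes the absolutely continuous real-valued functions on $[a,b]$. For $a<b$ and $u\in AC[a,b]$ put $\mathcal{L}(u;a,b)=\int_a^b L(x,u(x),u'(x))\,dx\in(-\infty,\infty]$ and $\mathcal{L}(a,A;b,B)=\inf\{\mathcal{L}(v;a,b):v\in AC[a,b],\ v(a)=A,\ v(b)=B\}$. A function $u\in AC[a,b]$ is a minimizer for $L$ on $[a,b]$ if $\mathcal{L}(u;a,b)=\mathcal{L}(a,u(a);b,u(b))$. For Lagrangians of the form in the claim (smooth, superlinear, convex in $p$), the universal singular set of $L$ is the set of all $(x_0,y_0)\in\mathbb{R}^2$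 for which there are $a\le x_0\le b$ with $a<b$ and a minimizer $u$ for $L$ on $[a,b]$ such that $u(x_0)=y_0$ and $u$ has infinite derivative ($+\infty$ or $-\infty$; one-sided if $x_0$ is an endpoint) at $x_0$. A set $E\subset\mathbb{R}^2$ is rectifiable if there is a countable collection of Lipschitz curves $\gamma_i\colon\mathbb{R}\to\mathbb{R}^2$ with $\mathcal{H}^1\left(E\setminus\bigcup_{i=1}^\infty\gamma_i(\mathbb{R})\right)=0$. Linear measure is one-dimensional Hausdorff measure $\mathcal{H}^1$. *)

theory Defs
  imports "HOL-Analysis.Analysis"
begin

text \<open>
  In finite-dimensional domains, continuity of every directional derivative of a differentiable
  function is continuity of its partial derivatives, so this is the usual class \<open>C\<^sup>k\<close>.
\<close>
primrec Ck :: "nat \<Rightarrow> ('a::euclidean_space \<Rightarrow> real) \<Rightarrow> bool" where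
  "Ck 0 f \<longleftrightarrow> continuous_on UNIV f"
| "Ck (Suc k) f \<longleftrightarrow>
     (\<forall>z. f differentiable (at z)) \<and> (\<forall>v. Ck k (\<lambda>z. frechet_derivative f (at z) v))"

definition smooth :: "('a::euclidean_space \<Rightarrow> real) \<Rightarrow> bool" where
  "smooth f \<longleftrightarrow> (\<forall>k. Ck k f)"

definition strictly_convex_on :: "'a::real_vector set \<Rightarrow> ('a \<Rightarrow> real) \<Rightarrow> bool" where
  "strictly_convex_on A f \<longleftrightarrow> convex A \<and>
     (\<forall>t. 0 < t \<and> t < 1 \<longrightarrow> (\<forall>x\<in>A. \<forall>y\<in>A. x \<noteq> y \<longrightarrow>
        f ((1 - t) *\<^sub>R x + t *\<^sub>R y) < (1 - t) * f x + t * f y))"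

definition superlinear :: "(real \<Rightarrow> real) \<Rightarrow> bool" where
  "superlinear \<omega> \<longleftrightarrow> filterlim (\<lambda>p. \<omega> p / \<bar>p\<bar>) at_top at_infinity"

definition lagrangian :: "(real \<times> real \<times> real \<Rightarrow> real) \<Rightarrow> bool" where
  "lagrangian L \<longleftrightarrow>
     L \<in> borel_measurable borel \<and>
     bdd_below (range L) \<and>
     (\<forall>z. \<exists>U. open U \<and> z \<in> U \<and> bdd_above (L ` U)) \<and>
     (\<exists>\<omega>. superlinear \<omega> \<and> (\<forall>x y p. L (x, y, p) \<ge> \<omega> p))"

definition AC :: "real \<Rightarrow> real \<Rightarrow> (real \<Rightarrow> real) set" where
  "AC a b = {u. \<forall>\<epsilon>>0. \<exists>\<delta>>0. \<forall>(n::nat) s t.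
     (\<forall>i<n. a \<le> s i \<and> s i \<le> t i \<and> t i \<le> b) \<and>
     disjoint_family_on (\<lambda>i. {s i<..<t i}) {..<n} \<and>
     (\<Sum>i<n. t i - s i) < \<delta> \<longrightarrow>
     (\<Sum>i<n. \<bar>u (t i) - u (s i)\<bar>) < \<epsilon>}"

text \<open>
  \<open>ennreal\<close> truncates negative reals to \<open>0\<close>, so this is the integral of the positive part minus that
  of the negative part; the latter is finite because \<open>L\<close> is bounded from below.  A function in
  \<open>AC a b\<close> is differentiable almost everywhere on \<open>[a, b]\<close>, so the value of \<open>deriv\<close> at other points
  is irrelevant.
\<close>
definition action :: "(real \<times> real \<times> real \<Rightarrow> real) \<Rightarrow> (real \<Rightarrow> real) \<Rightarrow> real \<Rightarrow> real \<Rightarrow> ereal" where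
  "action L u a b =
     enn2ereal (\<integral>\<^sup>+x\<in>{a..b}. ennreal (L (x, u x, deriv u x)) \<partial>lborel)
   - enn2ereal (\<integral>\<^sup>+x\<in>{a..b}. ennreal (- L (x, u x, deriv u x)) \<partial>lborel)"

definition min_action ::
    "(real \<times> real \<times> real \<Rightarrow> real) \<Rightarrow> real \<Rightarrow> real \<Rightarrow> real \<Rightarrow> real \<Rightarrow> ereal" where
  "min_action L a A b B = (INF v\<in>{v \<in> AC a b. v a = A \<and> v b = B}. action L v a b)"

definition minimizer ::
    "(real \<times> real \<times> real \<Rightarrow> real) \<Rightarrow> real \<Rightarrow> real \<Rightarrow> (real \<Rightarrow> real) \<Rightarrow> bool" where
  "minimizer L a b u \<longleftrightarrow> u \<in> AC a b \<and> action L u a b = min_action L a (u a) b (u b)"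

text \<open>Restricting the limit to \<open>[a, b]\<close> makes it one-sided exactly at the endpoints.\<close>
definition has_infinite_derivative :: "real \<Rightarrow> real \<Rightarrow> (real \<Rightarrow> real) \<Rightarrow> real \<Rightarrow> bool" where
  "has_infinite_derivative a b u x0 \<longleftrightarrow>
     filterlim (\<lambda>x. (u x - u x0) / (x - x0)) at_top (at x0 within {a..b}) \<or>
     filterlim (\<lambda>x. (u x - u x0) / (x - x0)) at_bot (at x0 within {a..b})"

definition universal_singular_set ::
    "(real \<times> real \<times> real \<Rightarrow> real) \<Rightarrow> (real \<times> real) set" where
  "universal_singular_set L = {(x0, y0). \<exists>a b u. a < b \<and> a \<le> x0 \<and> x0 \<le> b \<and>
     minimizer L a b u \<and> u x0 = y0 \<and> has_infinite_derivative a b u x0}"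

text \<open>
  One-dimensional Hausdorff (outer) measure.  Covering sets are required to be bounded because
  \<open>diameter\<close> is real-valued and carries no information for unbounded sets.
\<close>
definition linear_premeasure :: "real \<Rightarrow> 'a::metric_space set \<Rightarrow> ennreal" where
  "linear_premeasure \<delta> E =
     (INF A\<in>{A :: nat \<Rightarrow> 'a set. E \<subseteq> (\<Union>i. A i) \<and> (\<forall>i. bounded (A i) \<and> diameter (A i) \<le> \<delta>)}.
        \<Sum>i. ennreal (diameter (A i)))"

definition linear_measure :: "'a::metric_space set \<Rightarrow> ennreal" where
  "linear_measure E = (SUP \<delta>\<in>{0<..}. linear_premeasure \<delta> E)"

definition rectifiable :: "(real \<times> real) set \<Rightarrow> bool" where
  "rectifiable E \<longleftrightarrow> (\<exists>\<gamma> :: nat \<Rightarrow> real \<Rightarrow> real \<times> real.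
     (\<forall>i. \<exists>C. C-lipschitz_on UNIV (\<gamma> i)) \<and> linear_measure (E - (\<Union>i. range (\<gamma> i))) = 0)"

end

theory Submission
  imports Defs "HOL-Complex_Analysis.Great_Picard" "HOL-Real_Asymp.Real_Asymp"
begin

text \<open>
  The singular set is a staircase.  At level \<open>n\<close> it runs along segments of slope \<open>B\<^sub>n\<close>; each segment is
  replaced by many short segments of the larger slope \<open>B\<^bsub>n+1\<^esub>\<close>, lined up along it with horizontal gaps
  between them.  The limit is a monotone compact set, hence contained in a Lipschitz curve, and its
  projection to the \<open>y\<close>-axis keeps positive length.  As \<open>B\<^sub>n\<close> tends to infinity it becomes vertical, but
  much more slowly than the minimizers that start on it.  This matters: if the minimizers crossed it from
  above, the least action from a point of the set to a fixed end point would have infinite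
  derivative along the set at each of its points, and no function has an infinite one-sided derivative on
  a set of positive measure.

  The minimizers are tracks that start at the given point, which is the left end of their interval.  Away from
  the strips around the segments of level \<open>n\<close> they have slope \<open>p\<^sub>n = 2 * B\<^sub>n\<close>, and inside the core of such a
  strip they have slope \<open>p\<^bsub>n+1\<^esub>\<close> or more.  Since they are steeper than the segments they pass all other parts
  of the staircase on the upper left side.  To bend them, each strip contributes to \<open>F\<close> a term
  \<open>\<psi> (x, y) * h\<^sub>n p\<close>, where \<open>h\<^sub>n\<close> is a smooth convex version of \<open>max 0 (p - c\<^sub>n)\<close> with \<open>c\<^sub>n = B\<^sub>n / 2\<close>.  For
  bounded \<open>p\<close> only finitely many levels contribute, which makes \<open>F\<close> smooth although the strips accumulate at
  the staircase.

  Minimality is proved by calibration.  There are potentials \<open>\<Phi>\<^sub>M\<close>, one for each number \<open>M\<close> of levels, with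
  \<open>L (x, y, p) \<ge> \<partial>\<^sub>x \<Phi>\<^sub>M + p * \<partial>\<^sub>y \<Phi>\<^sub>M\<close> everywhere (\<open>excess_bounds\<close>), and with equality along a track as long as
  it is outside the strips of level \<open>M\<close> and higher (\<open>phase_facts\<close>).  In a strip of slope \<open>B\<close> everything depends on
  \<open>Y = y - B * x\<close> only, and once the slope of the tracks is prescribed as a function of \<open>Y\<close>, the coefficient \<open>\<psi>\<close> and
  the derivative of the potential are determined (\<open>tangent_identity\<close>).  In the core the difference between \<open>L\<close> and
  the differential of the potential is bounded below by a Bregman distance of \<open>\<omega>\<close>, independent of the
  point, so that the inequality for the next level involves only \<open>\<omega>\<close> and one strip (\<open>gain_nonneg\<close>).
  The ends of a strip can be cut off at a small cost if the strip is thin compared to the cut-off length.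

  A track solves a differential equation whose right-hand side, the reciprocal slope, is continuous and
  vanishes at the starting point (\<open>Peano_existence\<close>).  The competitors are arbitrary absolutely continuous functions, for which
  the calibration inequality is integrated with \<open>AC_differentiable_ae\<close> and
  \<open>AC_increment_le_nn_integral\<close>.
\<close>

section \<open>Absolutely continuous functions\<close>

definition intervals_in :: "real \<Rightarrow> real \<Rightarrow> (real \<times> real) set \<Rightarrow> bool" where
  "intervals_in a b Q \<longleftrightarrow> finite Q \<and> (\<forall>i\<in>Q. a \<le> fst i \<and> fst i \<le> snd i \<and> snd i \<le> b) \<and>
     pairwise (\<lambda>i j. {fst i<..<snd i} \<inter> {fst j<..<snd j} = {}) Q"

definition AC_modulus :: "real \<Rightarrow> real \<Rightarrow> (real \<Rightarrow> real) \<Rightarrow> real \<Rightarrow> real \<Rightarrow> bool" where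
  "AC_modulus a b u e d \<longleftrightarrow> (\<forall>(n::nat) s t.
     (\<forall>i<n. a \<le> s i \<and> s i \<le> t i \<and> t i \<le> b) \<and> disjoint_family_on (\<lambda>i. {s i<..<t i}) {..<n} \<and>
     (\<Sum>i<n. t i - s i) < d \<longrightarrow> (\<Sum>i<n. \<bar>u (t i) - u (s i)\<bar>) < e)"

lemma AC_iff: "u \<in> AC a b \<longleftrightarrow> (\<forall>e>0. \<exists>d>0. AC_modulus a b u e d)"
  unfolding AC_def AC_modulus_def mem_Collect_eq ..

lemma AC_modulusD:
  assumes "AC_modulus a b u e d" "\<forall>i<n. a \<le> s i \<and> s i \<le> t i \<and> t i \<le> b"
    "disjoint_family_on (\<lambda>i. {s i<..<t i}) {..<n}" "(\<Sum>i<(n::nat). t i - s i) < d"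
  shows "(\<Sum>i<n. \<bar>u (t i) - u (s i)\<bar>) < e"
  using assms(1)[unfolded AC_modulus_def, THEN spec, THEN spec, THEN spec, THEN mp, OF conjI, OF assms(2) conjI, OF assms(3,4)] .

lemma AC_modulusI:
  assumes "\<And>(n::nat) s t. \<forall>i<n. a \<le> s i \<and> s i \<le> t i \<and> t i \<le> b \<Longrightarrow>
    disjoint_family_on (\<lambda>i. {s i<..<t i}) {..<n} \<Longrightarrow> (\<Sum>i<n. t i - s i) < d \<Longrightarrow>
    (\<Sum>i<n. \<bar>u (t i) - u (s i)\<bar>) < e"
  shows "AC_modulus a b u e d"
  unfolding AC_modulus_def by (intro allI impI, elim conjE, rule assms)

lemma AC_modulus_family:
  assumes "AC_modulus a b u e d" and fin: "finite I"
    and st: "\<And>i. i \<in> I \<Longrightarrow> a \<le> s i \<and> s i \<le> t i \<and> t i \<le> b"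
    and dj: "\<And>i j. i \<in> I \<Longrightarrow> j \<in> I \<Longrightarrow> i \<noteq> j \<Longrightarrow> {s i<..<t i} \<inter> {s j<..<t j} = {}"
    and l: "(\<Sum>i\<in>I. t i - s i) < d"
  shows "(\<Sum>i\<in>I. \<bar>u (t i) - u (s i)\<bar>) < e"
proof -
  obtain h where "bij_betw h {0..<card I} I" using ex_bij_betw_nat_finite[OF fin] by blast
  then have h: "bij_betw h {..<card I} I" by (simp add: lessThan_atLeast0)
  have inI: "h i \<in> I" if "i < card I" for i using h that by (auto simp: bij_betw_def)
  have "(\<Sum>i<card I. \<bar>u (t (h i)) - u (s (h i))\<bar>) < e"
  proof (rule AC_modulusD[OF assms(1)])
    show "\<forall>i<card I. a \<le> s (h i) \<and> s (h i) \<le> t (h i) \<and> t (h i) \<le> b"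
      using st inI by auto
    show "disjoint_family_on (\<lambda>i. {s (h i)<..<t (h i)}) {..<card I}"
      unfolding disjoint_family_on_def
    proof (intro ballI impI)
      fix i j assume ij: "i \<in> {..<card I}" "j \<in> {..<card I}" "i \<noteq> j"
      then have "h i \<noteq> h j" using h by (auto simp: bij_betw_def inj_on_def)
      then show "{s (h i)<..<t (h i)} \<inter> {s (h j)<..<t (h j)} = {}"
        using dj inI ij by simp
    qed
    show "(\<Sum>i<card I. t (h i) - s (h i)) < d"
      using l sum.reindex_bij_betw[OF h, of "\<lambda>i. t i - s i"] by simp
  qed
  then show ?thesis using sum.reindex_bij_betw[OF h, of "\<lambda>i. \<bar>u (t i) - u (s i)\<bar>"] by simp
qed

lemma AC_D:
  assumes "u \<in> AC a b" "e > 0"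
  obtains d where "d > 0" "\<And>Q. intervals_in a b Q \<Longrightarrow> (\<Sum>i\<in>Q. snd i - fst i) < d \<Longrightarrow>
     (\<Sum>i\<in>Q. \<bar>u (snd i) - u (fst i)\<bar>) < e"
proof -
  obtain d where d: "d > 0" and *: "AC_modulus a b u e d" using assms by (auto simp: AC_iff)
  show ?thesis
  proof (rule that[OF d])
    fix Q assume Q: "intervals_in a b Q" and l: "(\<Sum>i\<in>Q. snd i - fst i) < d"
    show "(\<Sum>i\<in>Q. \<bar>u (snd i) - u (fst i)\<bar>) < e"
      by (rule AC_modulus_family[OF * _ _ _ l]) (use Q in \<open>auto simp: intervals_in_def pairwise_def\<close>)
  qed
qed

lemma AC_increment:
  assumes "u \<in> AC a b" "e > 0"
  obtains d where "d > 0" "\<And>s t. a \<le> s \<Longrightarrow> s \<le> t \<Longrightarrow> t \<le> b \<Longrightarrow> t - s < d \<Longrightarrow> \<bar>u t - u s\<bar> < e"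
proof -
  obtain d where d: "d > 0" "\<And>Q. intervals_in a b Q \<Longrightarrow> (\<Sum>i\<in>Q. snd i - fst i) < d \<Longrightarrow>
     (\<Sum>i\<in>Q. \<bar>u (snd i) - u (fst i)\<bar>) < e" using AC_D[OF assms] by blast
  show ?thesis
  proof (rule that[OF d(1)])
    fix s t assume "a \<le> s" "s \<le> t" "t \<le> b" "t - s < d"
    then show "\<bar>u t - u s\<bar> < e" using d(2)[of "{(s,t)}"] by (simp add: intervals_in_def)
  qed
qed

lemma AC_imp_continuous_on:
  assumes "u \<in> AC a b" shows "continuous_on {a..b} u"
  unfolding continuous_on_iff
proof (intro ballI allI impI)
  fix x and e :: real assume x: "x \<in> {a..b}" and "e > 0"
  obtain d where d: "d > 0" "\<And>s t. a \<le> s \<Longrightarrow> s \<le> t \<Longrightarrow> t \<le> b \<Longrightarrow> t - s < d \<Longrightarrow> \<bar>u t - u s\<bar> < e"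
    using AC_increment[OF assms \<open>e > 0\<close>] by blast
  show "\<exists>d>0. \<forall>x'\<in>{a..b}. dist x' x < d \<longrightarrow> dist (u x') (u x) < e"
  proof (intro exI[of _ d] conjI ballI impI d(1))
    fix y assume "y \<in> {a..b}" "dist y x < d"
    then show "dist (u y) (u x) < e" using d(2)[of x y] d(2)[of y x] x
      by (cases "x \<le> y") (auto simp: dist_real_def)
  qed
qed

text \<open>
  Every closure property below is an instance of this: the increments of the new function are bounded
  by increments of functions already known to be absolutely continuous.
\<close>
lemma AC_dominated:
  assumes u: "u \<in> AC a b" and v: "v \<in> AC a b" and K: "K \<ge> 0"
    and le: "\<And>s t. a \<le> s \<Longrightarrow> s \<le> t \<Longrightarrow> t \<le> b \<Longrightarrow> \<bar>w t - w s\<bar> \<le> K * (\<bar>u t - u s\<bar> + \<bar>v t - v s\<bar>)"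
  shows "w \<in> AC a b"
  unfolding AC_iff
proof (intro allI impI)
  fix e :: real assume e: "e > 0"
  define e' where "e' = e / (2 * (K + 1))"
  have e': "e' > 0" "K * (2 * e') < e" using e K by (auto simp: e'_def field_simps)
  obtain d1 where d1: "d1 > 0" "AC_modulus a b u e' d1" using u e' by (auto simp: AC_iff)
  obtain d2 where d2: "d2 > 0" "AC_modulus a b v e' d2" using v e' by (auto simp: AC_iff)
  have "AC_modulus a b w e (min d1 d2)"
  proof (rule AC_modulusI)
    fix n :: nat and s t :: "nat \<Rightarrow> real"
    assume A: "\<forall>i<n. a \<le> s i \<and> s i \<le> t i \<and> t i \<le> b" "disjoint_family_on (\<lambda>i. {s i<..<t i}) {..<n}"
      "(\<Sum>i<n. t i - s i) < min d1 d2"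
    have "(\<Sum>i<n. \<bar>w (t i) - w (s i)\<bar>) \<le> (\<Sum>i<n. K * (\<bar>u (t i) - u (s i)\<bar> + \<bar>v (t i) - v (s i)\<bar>))"
      using A(1) le by (intro sum_mono) auto
    also have "\<dots> = K * ((\<Sum>i<n. \<bar>u (t i) - u (s i)\<bar>) + (\<Sum>i<n. \<bar>v (t i) - v (s i)\<bar>))"
  by (simp add: sum.distrib flip: sum_distrib_left)
    also have "\<dots> \<le> K * (e' + e')"
      using AC_modulusD[OF d1(2) A(1,2)] AC_modulusD[OF d2(2) A(1,2)] A(3) K by (intro mult_left_mono) auto
    also have "\<dots> < e" using e' by simp
    finally show "(\<Sum>i<n. \<bar>w (t i) - w (s i)\<bar>) < e" .
  qed
  then show "\<exists>d>0. AC_modulus a b w e d" using d1 d2 by (intro exI[of _ "min d1 d2"]) auto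
qed

lemma AC_ident: "(\<lambda>x. x) \<in> AC a b"
  unfolding AC_iff
proof (intro allI impI)
  fix e :: real assume "e > 0"
  moreover have "AC_modulus a b (\<lambda>x. x) e e"
  proof (rule AC_modulusI)
    fix n :: nat and s t :: "nat \<Rightarrow> real"
    assume A: "\<forall>i<n. a \<le> s i \<and> s i \<le> t i \<and> t i \<le> b" "(\<Sum>i<n. t i - s i) < e"
    have "(\<Sum>i<n. \<bar>t i - s i\<bar>) = (\<Sum>i<n. t i - s i)" using A(1) by (intro sum.cong) auto
    then show "(\<Sum>i<n. \<bar>t i - s i\<bar>) < e" using A(2) by simp
  qed
  ultimately show "\<exists>d>0. AC_modulus a b (\<lambda>x. x) e d" by blast
qed

lemma AC_add: "u \<in> AC a b \<Longrightarrow> v \<in> AC a b \<Longrightarrow> (\<lambda>x. u x + v x) \<in> AC a b"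
  by (rule AC_dominated[of u a b v 1]) auto

lemma AC_cmult: "u \<in> AC a b \<Longrightarrow> (\<lambda>x. k * u x) \<in> AC a b"
  by (rule AC_dominated[of u a b u "\<bar>k\<bar>"])
     (auto simp flip: right_diff_distrib simp: abs_mult intro!: mult_left_mono)

lemma AC_const: "(\<lambda>x. k) \<in> AC a b"
  by (rule AC_dominated[OF AC_ident AC_ident, of 0]) auto

lemma AC_sum: "finite I \<Longrightarrow> (\<And>i. i \<in> I \<Longrightarrow> u i \<in> AC a b) \<Longrightarrow> (\<lambda>x. \<Sum>i\<in>I. u i x) \<in> AC a b"
  by (induction I rule: finite_induct) (auto simp: AC_const intro: AC_add)

lemma AC_bounded:
  assumes "u \<in> AC a b" obtains M where "M \<ge> 0" "\<And>x. x \<in> {a..b} \<Longrightarrow> \<bar>u x\<bar> \<le> M"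
proof -
  have "bounded (u ` {a..b})"
    using compact_continuous_image[OF AC_imp_continuous_on[OF assms]] compact_imp_bounded by blast
  then obtain M where "M > 0" "\<forall>y\<in>u ` {a..b}. norm y \<le> M" using bounded_pos by blast
  then show ?thesis using that[of M] by auto
qed

lemma AC_mult:
  assumes u: "u \<in> AC a b" and v: "v \<in> AC a b" shows "(\<lambda>x. u x * v x) \<in> AC a b"
proof -
  obtain M1 where M1: "M1 \<ge> 0" "\<And>x. x \<in> {a..b} \<Longrightarrow> \<bar>u x\<bar> \<le> M1" using AC_bounded[OF u] by blast
  obtain M2 where M2: "M2 \<ge> 0" "\<And>x. x \<in> {a..b} \<Longrightarrow> \<bar>v x\<bar> \<le> M2" using AC_bounded[OF v] by blast
  show ?thesis
  proof (rule AC_dominated[OF u v, of "M1 + M2"])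
    fix s t assume st: "a \<le> s" "s \<le> t" "t \<le> b"
    have "u t * v t - u s * v s = u t * (v t - v s) + v s * (u t - u s)" by algebra
    then have "\<bar>u t * v t - u s * v s\<bar> \<le> \<bar>u t\<bar> * \<bar>v t - v s\<bar> + \<bar>v s\<bar> * \<bar>u t - u s\<bar>"
      by (simp add: abs_mult[symmetric])
    also have "\<dots> \<le> (M1 + M2) * \<bar>v t - v s\<bar> + (M1 + M2) * \<bar>u t - u s\<bar>"
      using M1(1) M1(2)[of t] M2(1) M2(2)[of s] st by (intro add_mono mult_right_mono) auto
    finally show "\<bar>u t * v t - u s * v s\<bar> \<le> (M1 + M2) * (\<bar>u t - u s\<bar> + \<bar>v t - v s\<bar>)"
      by (simp add: algebra_simps)
  qed (use M1 M2 in auto)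
qed

text \<open>
  A function with continuous derivative is Lipschitz on the bounded range of \<open>u\<close>.
\<close>
lemma AC_compose:
  fixes f f' :: "real \<Rightarrow> real"
  assumes u: "u \<in> AC a b" and f: "\<And>x. (f has_real_derivative f' x) (at x)"
    and c: "continuous_on UNIV f'"
  shows "(\<lambda>x. f (u x)) \<in> AC a b"
proof -
  obtain M where M: "M \<ge> 0" "\<And>x. x \<in> {a..b} \<Longrightarrow> \<bar>u x\<bar> \<le> M" using AC_bounded[OF u] by blast
  have "bounded (f' ` {-M..M})"
    using compact_continuous_image[of "{-M..M}" f'] continuous_on_subset[OF c]
      compact_imp_bounded by blast
  then obtain K where K: "K > 0" "\<And>y. \<bar>y\<bar> \<le> M \<Longrightarrow> \<bar>f' y\<bar> \<le> K"
    unfolding bounded_pos by (auto simp: abs_le_iff)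
  have lip: "\<bar>f y - f x\<bar> \<le> K * \<bar>y - x\<bar>" if "\<bar>x\<bar> \<le> M" "\<bar>y\<bar> \<le> M" for x y
  proof -
    have "(f has_field_derivative f' z) (at z within {-M..M})" for z
      using f by (rule has_field_derivative_at_within)
    moreover have "norm (f' z) \<le> K" if "z \<in> {-M..M}" for z using K that by (simp add: abs_le_iff)
    ultimately have "norm (f y - f x) \<le> K * norm (y - x)"
      by (rule field_differentiable_bound[OF convex_real_interval(5)]) (use that in \<open>auto simp: abs_le_iff\<close>)
    then show ?thesis by simp
  qed
  show ?thesis
  proof (rule AC_dominated[OF u u, of K])
    fix s t assume "a \<le> s" "s \<le> t" "t \<le> b"
    then show "\<bar>f (u t) - f (u s)\<bar> \<le> K * (\<bar>u t - u s\<bar> + \<bar>u t - u s\<bar>)"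
      using lip[of "u s" "u t"] M(2)[of s] M(2)[of t] K(1)
      by (smt (verit) atLeastAtMost_iff mult_left_mono)
  qed (use K in auto)
qed

text \<open>
  Increments have no sign, so two families of intervals cannot be compared by monotonicity.  Instead one
  passes to the complementary intervals, over which the increments make up the difference.
\<close>
lemma gaps_exist:
  fixes w :: "real \<Rightarrow> real"
  assumes "finite G" "s \<le> t" "\<And>i. i \<in> G \<Longrightarrow> s \<le> fst i \<and> fst i < snd i \<and> snd i \<le> t"
    "pairwise (\<lambda>i j. {fst i..snd i} \<inter> {fst j..snd j} = {}) G"
  shows "\<exists>Q. intervals_in s t Q \<and>
    (\<Sum>i\<in>Q. snd i - fst i) = (t - s) - (\<Sum>i\<in>G. snd i - fst i) \<and>
    (\<Sum>i\<in>Q. w (snd i) - w (fst i)) = (w t - w s) - (\<Sum>i\<in>G. w (snd i) - w (fst i))"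
  using assms
proof (induction "card G" arbitrary: G s t rule: less_induct)
  case less
  show ?case
  proof (cases "G = {}")
    case True
    then show ?thesis using less.prems by (intro exI[of _ "{(s,t)}"]) (auto simp: intervals_in_def)
  next
    case False
    then obtain i where i: "i \<in> G" by blast
    define p q where "p = fst i" and "q = snd i"
    have pq: "s \<le> p" "p < q" "q \<le> t" using less.prems(3)[OF i] by (auto simp: p_def q_def)
    define G1 where "G1 = {j\<in>G. snd j < p}"
    define G2 where "G2 = {j\<in>G. q < fst j}"
    have split: "j \<in> G1 \<or> j \<in> G2" if "j \<in> G" "j \<noteq> i" for j
    proof -
      have "{fst i..snd i} \<inter> {fst j..snd j} = {}" using less.prems(4) i that by (auto simp: pairwise_def)
      then have "\<not> (max p (fst j) \<le> min q (snd j))" by (auto simp: p_def q_def)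
      then show ?thesis using less.prems(3)[OF that(1)] that pq by (auto simp: G1_def G2_def max_def min_def split: if_splits)
    qed
    have G: "G = insert i (G1 \<union> G2)" using split i by (auto simp: G1_def G2_def)
    have ni: "i \<notin> G1 \<union> G2" using pq by (auto simp: G1_def G2_def p_def q_def)
    have fin: "finite G1" "finite G2" using less.prems(1) by (auto simp: G1_def G2_def)
    have dj: "G1 \<inter> G2 = {}" using less.prems(3) pq by (fastforce simp: G1_def G2_def)
    have c: "card G1 < card G" "card G2 < card G"
      using i ni less.prems(1) by (auto intro!: psubset_card_mono simp: G1_def G2_def)
    have sG: "(\<Sum>j\<in>G. f j) = f i + (\<Sum>j\<in>G1. f j) + (\<Sum>j\<in>G2. f j)" for f :: "real \<times> real \<Rightarrow> real"
      using G ni fin dj by (simp add: sum.union_disjoint)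
    have pw1: "pairwise (\<lambda>i j. {fst i..snd i} \<inter> {fst j..snd j} = {}) G1"
      by (rule pairwise_subset[OF less.prems(4)]) (auto simp: G1_def)
    have pw2: "pairwise (\<lambda>i j. {fst i..snd i} \<inter> {fst j..snd j} = {}) G2"
      by (rule pairwise_subset[OF less.prems(4)]) (auto simp: G2_def)
    have "\<exists>Q. intervals_in s p Q \<and>
      (\<Sum>i\<in>Q. snd i - fst i) = (p - s) - (\<Sum>i\<in>G1. snd i - fst i) \<and>
      (\<Sum>i\<in>Q. w (snd i) - w (fst i)) = (w p - w s) - (\<Sum>i\<in>G1. w (snd i) - w (fst i))"
      by (rule less.hyps[OF c(1) fin(1) pq(1) _ pw1])
        (use less.prems(3) in \<open>auto simp: G1_def intro: less_imp_le\<close>)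
    then obtain Q1 where Q1: "intervals_in s p Q1"
      "(\<Sum>i\<in>Q1. snd i - fst i) = (p - s) - (\<Sum>i\<in>G1. snd i - fst i)"
      "(\<Sum>i\<in>Q1. w (snd i) - w (fst i)) = (w p - w s) - (\<Sum>i\<in>G1. w (snd i) - w (fst i))" by blast
    have "\<exists>Q. intervals_in q t Q \<and>
      (\<Sum>i\<in>Q. snd i - fst i) = (t - q) - (\<Sum>i\<in>G2. snd i - fst i) \<and>
      (\<Sum>i\<in>Q. w (snd i) - w (fst i)) = (w t - w q) - (\<Sum>i\<in>G2. w (snd i) - w (fst i))"
      by (rule less.hyps[OF c(2) fin(2) pq(3) _ pw2])
        (use less.prems(3) in \<open>auto simp: G2_def intro: less_imp_le\<close>)
    then obtain Q2 where Q2: "intervals_in q t Q2"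
      "(\<Sum>i\<in>Q2. snd i - fst i) = (t - q) - (\<Sum>i\<in>G2. snd i - fst i)"
      "(\<Sum>i\<in>Q2. w (snd i) - w (fst i)) = (w t - w q) - (\<Sum>i\<in>G2. w (snd i) - w (fst i))" by blast
    have dQ: "Q1 \<inter> Q2 = {}" using Q1(1) Q2(1) pq unfolding intervals_in_def by fastforce
    have fQ: "finite Q1" "finite Q2" using Q1 Q2 by (auto simp: intervals_in_def)
    have cross: "{fst j<..<snd j} \<inter> {fst k<..<snd k} = {}" if "j \<in> Q1" "k \<in> Q2" for j k
    proof -
      have "snd j \<le> p" "q \<le> fst k" using that Q1 Q2 by (auto simp: intervals_in_def)
      then show ?thesis using pq by auto
    qed
    have cross': "{fst k<..<snd k} \<inter> {fst j<..<snd j} = {}" if "j \<in> Q1" "k \<in> Q2" for j k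
      using cross[OF that] by blast
    have "intervals_in s t (Q1 \<union> Q2)"
    proof -
      have b1: "a \<le> fst j \<and> fst j \<le> snd j \<and> snd j \<le> b" if "intervals_in a b Q" "j \<in> Q" for a b Q j
        using that by (auto simp: intervals_in_def)
      have bd: "s \<le> fst j \<and> fst j \<le> snd j \<and> snd j \<le> t" if "j \<in> Q1 \<union> Q2" for j
        using that b1[OF Q1(1), of j] b1[OF Q2(1), of j] pq by auto
      have "pairwise (\<lambda>i j. {fst i<..<snd i} \<inter> {fst j<..<snd j} = {}) (Q1 \<union> Q2)"
        unfolding pairwise_def
      proof (intro ballI impI)
        fix j k assume "j \<in> Q1 \<union> Q2" "k \<in> Q1 \<union> Q2" "j \<noteq> k"
        then show "{fst j<..<snd j} \<inter> {fst k<..<snd k} = {}"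
          using cross[of j k] cross'[of k j] Q1(1) Q2(1)
          unfolding intervals_in_def pairwise_def by blast
      qed
      then show ?thesis using bd fQ unfolding intervals_in_def by blast
    qed
    then show ?thesis using Q1 Q2 fQ dQ sG
      by (intro exI[of _ "Q1 \<union> Q2"]) (auto simp: sum.union_disjoint p_def q_def)
  qed
qed

text \<open>
  Vitali's covering theorem for closed intervals.  The disjoint family that it provides covers almost all
  of \<open>E\<close>, so finitely many of its members already have total length greater than \<open>measure lebesgue E - e\<close>.
\<close>
lemma Vitali_intervals:
  fixes E :: "real set"
  assumes E: "E \<in> lmeasurable" and e: "e > 0"
    and fine: "\<And>x d. x \<in> E \<Longrightarrow> d > 0 \<Longrightarrow> \<exists>s t. s < x \<and> x < t \<and> t - s < d \<and> P (s,t)"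
  obtains F where "finite F" "\<And>i. i \<in> F \<Longrightarrow> fst i < snd i \<and> P i"
    "pairwise (\<lambda>i j. {fst i..snd i} \<inter> {fst j..snd j} = {}) F"
    "measure lebesgue E - e < (\<Sum>i\<in>F. snd i - fst i)"
proof -
  define K where "K = {i :: real \<times> real. fst i < snd i \<and> P i}"
  define a :: "real \<times> real \<Rightarrow> real" where "a = (\<lambda>i. (fst i + snd i) / 2)"
  define r :: "real \<times> real \<Rightarrow> real" where "r = (\<lambda>i. (snd i - fst i) / 2)"
  have cb: "cball (a i) (r i) = {fst i..snd i}" for i
    by (auto simp: a_def r_def cball_eq_atLeastAtMost add_divide_distrib diff_divide_distrib)
  have "\<exists>C. countable C \<and> C \<subseteq> K \<and>
     pairwise (\<lambda>i j. disjnt (cball (a i) (r i)) (cball (a j) (r j))) C \<and>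
     negligible(E - (\<Union>i \<in> C. cball (a i) (r i)))"
  proof (rule Vitali_covering_theorem_cballs[of K r E a])
    show "0 < r i" if "i \<in> K" for i using that by (auto simp: K_def r_def)
    fix x d :: real assume "x \<in> E" "0 < d"
    then obtain s t where "s < x" "x < t" "t - s < d" "P (s,t)" using fine by blast
    then show "\<exists>i. i \<in> K \<and> x \<in> cball (a i) (r i) \<and> r i < d"
      by (intro exI[of _ "(s,t)"]) (auto simp: K_def cb, auto simp: r_def)
  qed blast
  then obtain C where C: "countable C" "C \<subseteq> K"
     "pairwise (\<lambda>i j. disjnt {fst i..snd i} {fst j..snd j}) C"
     "negligible(E - (\<Union>i \<in> C. {fst i..snd i}))" unfolding cb by blast
  have len: "measure lebesgue (\<Union>i\<in>F. {fst i..snd i}) \<le> (\<Sum>i\<in>F. snd i - fst i)" if "F \<subseteq> C" "finite F" for F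
  proof -
    have "measure lebesgue (\<Union>i\<in>F. {fst i..snd i}) \<le> (\<Sum>i\<in>F. measure lebesgue {fst i..snd i})"
      by (rule measure_UNION_le[OF that(2)]) auto
    also have "\<dots> = (\<Sum>i\<in>F. snd i - fst i)"
      using that C(2) by (intro sum.cong) (auto simp: K_def less_imp_le)
    finally show ?thesis .
  qed
  have "\<exists>F\<subseteq>C. finite F \<and> measure lebesgue E - e < (\<Sum>i\<in>F. snd i - fst i)"
  proof (rule ccontr)
    assume "\<not> ?thesis"
    then have le: "(\<Sum>i\<in>F. snd i - fst i) \<le> measure lebesgue E - e" if "F \<subseteq> C" "finite F" for F
      using that by force
    have bd: "measure lebesgue (\<Union>i\<in>F. {fst i..snd i}) \<le> measure lebesgue E - e" if "F \<subseteq> C" "finite F" for F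
      using len[OF that] le[OF that] by linarith
    have m: "(\<Union>i\<in>C. {fst i..snd i}) \<in> lmeasurable"
      by (rule fmeasurable_UN_bound[OF C(1) _ bd]) auto
    have "measure lebesgue (\<Union>i\<in>C. {fst i..snd i}) \<le> measure lebesgue E - e"
      by (rule measure_UN_bound[OF C(1) _ bd]) auto
    moreover have "measure lebesgue E \<le> measure lebesgue ((\<Union>i\<in>C. {fst i..snd i}) \<union> (E - (\<Union>i\<in>C. {fst i..snd i})))"
      using m E C(4) by (intro measure_mono_fmeasurable) (auto dest: negligible_imp_measurable fmeasurableD)
    moreover have "\<dots> \<le> measure lebesgue (\<Union>i\<in>C. {fst i..snd i}) + measure lebesgue (E - (\<Union>i\<in>C. {fst i..snd i}))"
      using m C(4) by (intro measure_Un_le) (auto dest: negligible_imp_measurable fmeasurableD)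
    ultimately show False using e negligible_imp_measure0[OF C(4)] by simp
  qed
  then obtain F where F: "F \<subseteq> C" "finite F" "measure lebesgue E - e < (\<Sum>i\<in>F. snd i - fst i)" by blast
  show ?thesis
  proof (rule that[OF F(2)])
    show "fst i < snd i \<and> P i" if "i \<in> F" for i using that F C by (auto simp: K_def)
    show "pairwise (\<lambda>i j. {fst i..snd i} \<inter> {fst j..snd j} = {}) F"
      using pairwise_subset[OF C(3) F(1)] by (simp add: disjnt_def)
  qed (use F in auto)
qed

section \<open>Differentiability almost everywhere\<close>

lemma lmeasurable_outer_open:
  fixes E :: "'a::euclidean_space set"
  assumes E: "E \<in> lmeasurable" and e: "e > 0"
  obtains U where "open U" "E \<subseteq> U" "U \<in> lmeasurable" "measure lebesgue U < measure lebesgue E + e"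
proof -
  obtain U where U: "open U" "E \<subseteq> U" "U - E \<in> lmeasurable" "emeasure lebesgue (U - E) < ennreal e"
    using sets_lebesgue_outer_open[OF fmeasurableD[OF E] e] by blast
  have UE: "U = E \<union> (U - E)" using U(2) by blast
  have Um: "U \<in> lmeasurable" using fmeasurable.Un[OF E U(3)] UE by simp
  have "measure lebesgue (U - E) < e"
    using U(3,4) e by (simp add: emeasure_eq_measure2 ennreal_less_iff)
  moreover have "measure lebesgue U = measure lebesgue E + measure lebesgue (U - E)"
    using measure_Un3[OF E U(3)] UE by simp
  ultimately show ?thesis using that[OF U(1,2) Um] by linarith
qed

text \<open>
  The points that lie in arbitrarily short intervals of mean slope greater than \<open>c\<close>.  Requiring them to
  be interior points of these intervals makes the set a countable intersection of open sets; for a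
  continuous function one-sided difference quotients are limits of such mean slopes.
\<close>
definition steep :: "(real \<Rightarrow> real) \<Rightarrow> real \<Rightarrow> real \<Rightarrow> real \<Rightarrow> real set" where
  "steep v a b c = {x. \<forall>d>0. \<exists>s t. a < s \<and> s < x \<and> x < t \<and> t < b \<and> t - s < d \<and> c * (t - s) < v t - v s}"

lemma steep_subset: "steep v a b c \<subseteq> {a<..<b}"
proof
  fix x assume "x \<in> steep v a b c"
  then obtain s t where "a < s \<and> s < x \<and> x < t \<and> t < b"
    unfolding steep_def mem_Collect_eq using zero_less_one by blast
  then show "x \<in> {a<..<b}" by auto
qed

lemma steep_lmeasurable: "steep v a b c \<in> lmeasurable"
proof -
  let ?O = "\<lambda>n. \<Union>i\<in>{i. a < fst i \<and> snd i < b \<and> snd i - fst i < inverse (real (Suc n)) \<and>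
                     c * (snd i - fst i) < v (snd i) - v (fst i)}. {fst i<..<snd i}"
  have eq: "steep v a b c = (\<Inter>n. ?O n)"
  proof (intro equalityI subsetI)
    fix x assume x: "x \<in> steep v a b c"
    show "x \<in> (\<Inter>n. ?O n)"
    proof
      fix n
      have "inverse (real (Suc n)) > 0" by simp
      then obtain s t where "a < s \<and> s < x \<and> x < t \<and> t < b \<and> t - s < inverse (real (Suc n)) \<and> c * (t - s) < v t - v s"
        using x unfolding steep_def by blast
      then show "x \<in> ?O n" by (intro UN_I[of "(s,t)"]) auto
    qed
  next
    fix x assume x: "x \<in> (\<Inter>n. ?O n)"
    show "x \<in> steep v a b c" unfolding steep_def mem_Collect_eq
    proof (intro allI impI)
      fix d :: real assume "d > 0"
      then obtain n where n: "inverse (real (Suc n)) < d" using reals_Archimedean by blast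
      obtain i where "a < fst i \<and> snd i < b \<and> snd i - fst i < inverse (real (Suc n)) \<and>
         c * (snd i - fst i) < v (snd i) - v (fst i)" "x \<in> {fst i<..<snd i}" using x by blast
      then show "\<exists>s t. a < s \<and> s < x \<and> x < t \<and> t < b \<and> t - s < d \<and> c * (t - s) < v t - v s"
        using n by (intro exI[of _ "fst i"] exI[of _ "snd i"]) auto
    qed
  qed
  have "?O n \<in> sets borel" for n :: nat
    by (intro borel_open open_UN ballI open_greaterThanLessThan)
  then have "(\<Inter>n. ?O n) \<in> sets borel" by (intro sets.countable_INT image_subsetI UNIV_not_empty)
  then have "steep v a b c \<in> sets borel" by (simp only: eq)
  then have "steep v a b c \<in> sets lebesgue" by simp
  moreover have "bounded (steep v a b c)" using bounded_subset[OF _ steep_subset] by auto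
  ultimately show ?thesis by (rule bounded_set_imp_lmeasurable[rotated])
qed

text \<open>
  Suppose that the set has measure \<open>m > 0\<close>.  Cover it, inside an open set of measure less than \<open>m + e\<close>,
  by finitely many disjoint intervals on which \<open>w\<close> has slope above \<open>c\<close>, and then, inside these, by
  intervals on which \<open>w\<close> has slope below \<open>- c\<close>.  Both families have total length close to \<open>m\<close>, so the
  gaps between them are short and, by absolute continuity, carry a small increment.  But this
  increment has to make up for a rise of almost \<open>c * m\<close> over the first family and a fall over the
  second.
\<close>
lemma AC_oscillation_null:
  assumes w: "w \<in> AC a b" and c: "c > 0"
  shows "negligible (steep w a b c \<inter> steep (\<lambda>x. - w x) a b c)"
proof -
  define E where "E = steep w a b c \<inter> steep (\<lambda>x. - w x) a b c"
  have Em: "E \<in> lmeasurable" unfolding E_def by (intro fmeasurable.Int steep_lmeasurable)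
  define m where "m = measure lebesgue E"
  have "m = 0"
  proof (rule ccontr)
    assume "m \<noteq> 0"
    then have m: "m > 0" unfolding m_def using measure_nonneg[of lebesgue E] by linarith
    then have "c * m / 2 > 0" using c by simp
    then obtain d where d: "d > 0" "\<And>Q. intervals_in a b Q \<Longrightarrow> (\<Sum>i\<in>Q. snd i - fst i) < d \<Longrightarrow>
     (\<Sum>i\<in>Q. \<bar>w (snd i) - w (fst i)\<bar>) < c * m / 2" using AC_D[OF w] by blast
    (* The three covering errors add up to less than 4 e, which has to stay below d. *)
    define e where "e = min (m/8) (d/4)"
    have e: "e > 0" "e \<le> m/8" "4*e \<le> d" using m d(1) by (auto simp: e_def)
    obtain U where U: "open U" "E \<subseteq> U" "U \<in> lmeasurable" "measure lebesgue U < m + e"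
      using lmeasurable_outer_open[OF Em e(1)] unfolding m_def by blast
    have "\<exists>F. finite F \<and> (\<forall>i\<in>F. fst i < snd i \<and> (a < fst i \<and> snd i < b \<and> {fst i..snd i} \<subseteq> U \<and>
          c * (snd i - fst i) < w (snd i) - w (fst i))) \<and>
        pairwise (\<lambda>i j. {fst i..snd i} \<inter> {fst j..snd j} = {}) F \<and> m - e < (\<Sum>i\<in>F. snd i - fst i)"
    proof (rule Vitali_intervals[OF Em e(1), where P = "\<lambda>i. a < fst i \<and> snd i < b \<and> {fst i..snd i} \<subseteq> U \<and>
          c * (snd i - fst i) < w (snd i) - w (fst i)"])
      fix x d :: real assume x: "x \<in> E" "d > 0"
      then obtain r where r: "r > 0" "ball x r \<subseteq> U" using U openE by (metis subsetD)
      have "min d r > 0" using x r by simp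
      then obtain s t where st: "a < s \<and> s < x \<and> x < t \<and> t < b \<and> t - s < min d r \<and> c * (t - s) < w t - w s"
        using x(1) unfolding E_def steep_def by blast
      then have "{s..t} \<subseteq> ball x r" by (auto simp: dist_real_def)
      then show "\<exists>s t. s < x \<and> x < t \<and> t - s < d \<and> a < fst (s, t) \<and> snd (s, t) < b \<and>
        {fst (s,t)..snd (s,t)} \<subseteq> U \<and> c * (snd (s, t) - fst (s, t)) < w (snd (s, t)) - w (fst (s, t))"
        using st r by (intro exI[of _ s] exI[of _ t]) auto
    qed (unfold m_def, blast)
    then obtain F where F: "finite F" "\<And>i. i \<in> F \<Longrightarrow> fst i < snd i" "\<And>i. i \<in> F \<Longrightarrow> a < fst i"
       "\<And>i. i \<in> F \<Longrightarrow> snd i < b" "\<And>i. i \<in> F \<Longrightarrow> {fst i..snd i} \<subseteq> U"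
       "\<And>i. i \<in> F \<Longrightarrow> c * (snd i - fst i) < w (snd i) - w (fst i)"
       "pairwise (\<lambda>i j. {fst i..snd i} \<inter> {fst j..snd j} = {}) F" "m - e < (\<Sum>i\<in>F. snd i - fst i)" by blast
    define V where "V = (\<Union>i\<in>F. {fst i<..<snd i})"
    have Vm: "V \<in> lmeasurable" unfolding V_def using F(1) by (intro fmeasurable.finite_UN) auto
    have "measure lebesgue V = (\<Sum>i\<in>F. measure lebesgue {fst i<..<snd i})" unfolding V_def
    proof (rule measure_UNION'[OF F(1)])
      show "\<And>i. i \<in> F \<Longrightarrow> {fst i<..<snd i} \<in> lmeasurable" by auto
      show "pairwise (\<lambda>i j. disjnt {fst i<..<snd i} {fst j<..<snd j}) F"
        using F(7) unfolding pairwise_def disjnt_def by fastforce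
    qed
    also have "\<dots> = (\<Sum>i\<in>F. snd i - fst i)" using F(2) by (intro sum.cong) (auto simp: less_imp_le)
    finally have mV: "measure lebesgue V = (\<Sum>i\<in>F. snd i - fst i)" .
    have VU: "V \<subseteq> U" unfolding V_def using F(5) by fastforce
    have FU: "(\<Sum>i\<in>F. snd i - fst i) < m + e"
      using measure_mono_fmeasurable[OF VU fmeasurableD[OF Vm] U(3)] U(4) mV by linarith
    have "measure lebesgue (E \<union> V) \<le> measure lebesgue U"
      using VU U Em Vm by (intro measure_mono_fmeasurable) (auto dest: fmeasurableD)
    then have mEV: "measure lebesgue (E \<inter> V) > m - 2 * e"
      using measure_Un3[OF Em Vm] F(8) U(4) mV unfolding m_def by linarith
    have EVm: "E \<inter> V \<in> lmeasurable" using Em Vm by blast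
    have "\<exists>G. finite G \<and> (\<forall>i\<in>G. fst i < snd i \<and> ((\<exists>j\<in>F. fst j < fst i \<and> snd i < snd j) \<and>
          c * (snd i - fst i) < - w (snd i) - - w (fst i))) \<and>
        pairwise (\<lambda>i j. {fst i..snd i} \<inter> {fst j..snd j} = {}) G \<and>
        measure lebesgue (E \<inter> V) - e < (\<Sum>i\<in>G. snd i - fst i)"
    proof (rule Vitali_intervals[OF EVm e(1), where P = "\<lambda>i. (\<exists>j\<in>F. fst j < fst i \<and> snd i < snd j) \<and>
          c * (snd i - fst i) < - w (snd i) - - w (fst i)"])
      fix x d :: real assume x: "x \<in> E \<inter> V" "d > 0"
      then obtain j where j: "j \<in> F" "fst j < x" "x < snd j" by (auto simp: V_def)
      have "min d (min (x - fst j) (snd j - x)) > 0" using x j by simp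
      then obtain s t where st: "a < s \<and> s < x \<and> x < t \<and> t < b \<and> t - s < min d (min (x - fst j) (snd j - x)) \<and>
         c * (t - s) < - w t - - w s"
        using x(1) unfolding E_def steep_def by blast
      then show "\<exists>s t. s < x \<and> x < t \<and> t - s < d \<and> (\<exists>j\<in>F. fst j < fst (s, t) \<and> snd (s, t) < snd j) \<and>
        c * (snd (s, t) - fst (s, t)) < - w (snd (s, t)) - - w (fst (s, t))"
        using j by (intro exI[of _ s] exI[of _ t] conjI bexI[of _ j]) auto
    qed blast
    then obtain G where G: "finite G" "\<And>i. i \<in> G \<Longrightarrow> fst i < snd i"
       "\<And>i. i \<in> G \<Longrightarrow> \<exists>j\<in>F. fst j < fst i \<and> snd i < snd j"
       "\<And>i. i \<in> G \<Longrightarrow> c * (snd i - fst i) < - w (snd i) - - w (fst i)"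
       "pairwise (\<lambda>i j. {fst i..snd i} \<inter> {fst j..snd j} = {}) G"
       "measure lebesgue (E \<inter> V) - e < (\<Sum>i\<in>G. snd i - fst i)" by blast
    define Gj where "Gj = (\<lambda>j. {i\<in>G. fst j < fst i \<and> snd i < snd j})"
    have GU: "G = (\<Union>j\<in>F. Gj j)" using G(3) by (auto simp: Gj_def)
    have Gdisj: "Gj j \<inter> Gj k = {}" if "j \<in> F" "k \<in> F" "j \<noteq> k" for j k
    proof -
      have "{fst j..snd j} \<inter> {fst k..snd k} = {}" using F(7) that by (auto simp: pairwise_def)
      then show ?thesis using G(2) unfolding Gj_def by fastforce
    qed
    have sumG: "(\<Sum>i\<in>G. f i) = (\<Sum>j\<in>F. \<Sum>i\<in>Gj j. f i)" for f :: "real \<times> real \<Rightarrow> real"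
      unfolding GU using F(1) G(1) Gdisj by (intro sum.UNION_disjoint) (auto simp: Gj_def)
    have "\<exists>Q. \<forall>j\<in>F. intervals_in (fst j) (snd j) (Q j) \<and>
      (\<Sum>i\<in>Q j. snd i - fst i) = (snd j - fst j) - (\<Sum>i\<in>Gj j. snd i - fst i) \<and>
      (\<Sum>i\<in>Q j. w (snd i) - w (fst i)) = (w (snd j) - w (fst j)) - (\<Sum>i\<in>Gj j. w (snd i) - w (fst i))"
    proof (intro bchoice ballI gaps_exist)
      fix j assume j: "j \<in> F"
      show "finite (Gj j)" using G(1) by (simp add: Gj_def)
      show "fst j \<le> snd j" using F(2)[OF j] by simp
      show "fst j \<le> fst i \<and> fst i < snd i \<and> snd i \<le> snd j" if "i \<in> Gj j" for i
        using that G(2) by (auto simp: Gj_def)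
      show "pairwise (\<lambda>i j. {fst i..snd i} \<inter> {fst j..snd j} = {}) (Gj j)"
        by (rule pairwise_subset[OF G(5)]) (auto simp: Gj_def)
    qed
    then obtain Q where Q: "\<And>j. j \<in> F \<Longrightarrow> intervals_in (fst j) (snd j) (Q j)"
      "\<And>j. j \<in> F \<Longrightarrow> (\<Sum>i\<in>Q j. snd i - fst i) = (snd j - fst j) - (\<Sum>i\<in>Gj j. snd i - fst i)"
      "\<And>j. j \<in> F \<Longrightarrow> (\<Sum>i\<in>Q j. w (snd i) - w (fst i)) = (w (snd j) - w (fst j)) - (\<Sum>i\<in>Gj j. w (snd i) - w (fst i))"
      by blast
    have Qb: "fst j \<le> fst i \<and> fst i \<le> snd i \<and> snd i \<le> snd j" if "j \<in> F" "i \<in> Q j" for i j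
      using Q(1)[OF that(1)] that by (auto simp: intervals_in_def)
    have Qfin: "finite (Q j)" if "j \<in> F" for j using Q(1)[OF that] by (auto simp: intervals_in_def)
    have sep: "snd j < fst k \<or> snd k < fst j" if "j \<in> F" "k \<in> F" "j \<noteq> k" for j k
    proof -
      have "{fst j..snd j} \<inter> {fst k..snd k} = {}" using F(7) that by (auto simp: pairwise_def)
      then have "\<not> (max (fst j) (fst k) \<le> min (snd j) (snd k))" by auto
      then show ?thesis using F(2)[OF that(1)] F(2)[OF that(2)] by linarith
    qed
    have Qdisj: "Q j \<inter> Q k = {}" if "j \<in> F" "k \<in> F" "j \<noteq> k" for j k
      using sep[OF that] Qb[OF that(1)] Qb[OF that(2)] by fastforce
    define R where "R = (\<Union>j\<in>F. Q j)"
    have sumR: "(\<Sum>i\<in>R. f i) = (\<Sum>j\<in>F. \<Sum>i\<in>Q j. f i)" for f :: "real \<times> real \<Rightarrow> real"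
      unfolding R_def using F(1) Qfin Qdisj by (intro sum.UNION_disjoint) auto
    have R: "intervals_in a b R" unfolding intervals_in_def
    proof (intro conjI ballI)
      show "finite R" using F(1) Qfin by (auto simp: R_def)
      fix i assume "i \<in> R"
      then obtain j where j: "j \<in> F" "i \<in> Q j" by (auto simp: R_def)
      show "a \<le> fst i" "fst i \<le> snd i" "snd i \<le> b" using Qb[OF j] F(3)[OF j(1)] F(4)[OF j(1)] by auto
    next
      show "pairwise (\<lambda>i j. {fst i<..<snd i} \<inter> {fst j<..<snd j} = {}) R"
        unfolding pairwise_def
      proof (intro ballI impI)
        fix i i' assume "i \<in> R" "i' \<in> R" and ne: "i \<noteq> i'"
        then obtain j j' where j: "j \<in> F" "i \<in> Q j" and j': "j' \<in> F" "i' \<in> Q j'" by (auto simp: R_def)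
        show "{fst i<..<snd i} \<inter> {fst i'<..<snd i'} = {}"
        proof (cases "j = j'")
          case True
          then show ?thesis using Q(1)[OF j(1)] j j' ne unfolding intervals_in_def pairwise_def by blast
        next
          case False
          then show ?thesis using sep[OF j(1) j'(1)] Qb[OF j] Qb[OF j'] by auto
        qed
      qed
    qed
    have "(\<Sum>i\<in>R. snd i - fst i) = (\<Sum>i\<in>F. snd i - fst i) - (\<Sum>i\<in>G. snd i - fst i)"
      unfolding sumR sumG using Q(2) by (simp flip: sum_subtractf)
    then have "(\<Sum>i\<in>R. snd i - fst i) < d" using FU G(6) mEV e by linarith
    then have small: "(\<Sum>i\<in>R. \<bar>w (snd i) - w (fst i)\<bar>) < c * m / 2" by (rule d(2)[OF R])
    have eq: "(\<Sum>i\<in>R. w (snd i) - w (fst i)) =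
        (\<Sum>i\<in>F. w (snd i) - w (fst i)) - (\<Sum>i\<in>G. w (snd i) - w (fst i))"
      unfolding sumR sumG using Q(3) by (simp flip: sum_subtractf)
    have 1: "c * (\<Sum>i\<in>F. snd i - fst i) \<le> (\<Sum>i\<in>F. w (snd i) - w (fst i))"
      unfolding sum_distrib_left using F(6) by (intro sum_mono) (auto simp: less_imp_le)
    have 2: "(\<Sum>i\<in>G. c * (snd i - fst i)) \<le> (\<Sum>i\<in>G. - (w (snd i) - w (fst i)))"
      using G(4) by (intro sum_mono) (fastforce intro: less_imp_le)
    have 3: "(\<Sum>i\<in>G. snd i - fst i) \<ge> 0" using G(2) by (intro sum_nonneg) (auto simp: less_imp_le)
    have "0 \<le> (\<Sum>i\<in>G. c * (snd i - fst i))"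
      unfolding sum_distrib_left[symmetric] using 3 c by (intro mult_nonneg_nonneg) auto
    then have "(\<Sum>i\<in>G. w (snd i) - w (fst i)) \<le> 0"
      using 2 unfolding sum_negf by linarith
    moreover have "c * (m - e) \<le> c * (\<Sum>i\<in>F. snd i - fst i)" using F(8) c by simp
    moreover have "c * (m - e) \<ge> c * (m / 2)" using e c m by (intro mult_left_mono) auto
    moreover have "(\<Sum>i\<in>R. w (snd i) - w (fst i)) \<le> (\<Sum>i\<in>R. \<bar>w (snd i) - w (fst i)\<bar>)"
      by (intro sum_mono) auto
    ultimately show False using small eq 1 by simp
  qed
  then have "measure lebesgue E = 0" by (simp add: m_def)
  then show ?thesis using Em unfolding E_def by (simp add: negligible_iff_measure)
qed


text \<open>
  On an interval shorter than the \<open>\<delta>\<close> that belongs to \<open>\<epsilon> = 1\<close>, disjoint intervals of slope at least \<open>n\<close>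
  have total length at most \<open>1 / n\<close>.
\<close>
lemma AC_unbounded_slope_null:
  assumes v: "v \<in> AC a b"
  shows "negligible (\<Inter>n::nat. steep v a b (real n))"
proof -
  define E where "E = (\<Inter>n::nat. steep v a b (real n))"
  have Em: "E \<in> sets lebesgue" unfolding E_def
    using steep_lmeasurable by (intro sets.countable_INT) (auto dest: fmeasurableD)
  obtain d where d: "d > 0" "\<And>Q. intervals_in a b Q \<Longrightarrow> (\<Sum>i\<in>Q. snd i - fst i) < d \<Longrightarrow>
     (\<Sum>i\<in>Q. \<bar>v (snd i) - v (fst i)\<bar>) < 1" using AC_D[OF v zero_less_one] by blast
  have piece: "negligible (E \<inter> {q<..<r})" if "r - q < d" for q r :: real
  proof -
    have m: "E \<inter> {q<..<r} \<in> lmeasurable"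
      by (rule fmeasurable_Int_fmeasurable[of "{q<..<r}" _ E, simplified Int_commute]) (use Em in auto)
    define m where "m = measure lebesgue (E \<inter> {q<..<r})"
    have "m = 0"
    proof (rule ccontr)
      assume "m \<noteq> 0"
      then have mp: "m > 0" unfolding m_def
        using measure_nonneg[of lebesgue "E \<inter> {q<..<r}"] by linarith
      obtain n :: nat where n: "real n > 2 / m" using reals_Archimedean2 by blast
      have "\<exists>F. finite F \<and> (\<forall>i\<in>F. fst i < snd i \<and> (a < fst i \<and> snd i < b \<and> {fst i..snd i} \<subseteq> {q<..<r} \<and>
          real n * (snd i - fst i) < v (snd i) - v (fst i))) \<and>
        pairwise (\<lambda>i j. {fst i..snd i} \<inter> {fst j..snd j} = {}) F \<and> m - m/2 < (\<Sum>i\<in>F. snd i - fst i)"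
      proof (rule Vitali_intervals[OF m, of "m/2" "\<lambda>i. a < fst i \<and> snd i < b \<and> {fst i..snd i} \<subseteq> {q<..<r} \<and>
          real n * (snd i - fst i) < v (snd i) - v (fst i)"])
        fix x e :: real assume x: "x \<in> E \<inter> {q<..<r}" "e > 0"
        then have "min e (min (x - q) (r - x)) > 0" by auto
        moreover have "x \<in> steep v a b (real n)" using x by (auto simp: E_def)
        ultimately obtain s t where "a < s \<and> s < x \<and> x < t \<and> t < b \<and> t - s < min e (min (x - q) (r - x)) \<and>
           real n * (t - s) < v t - v s" unfolding steep_def by blast
        then show "\<exists>s t. s < x \<and> x < t \<and> t - s < e \<and> a < fst (s, t) \<and> snd (s, t) < b \<and>
            {fst (s, t)..snd (s, t)} \<subseteq> {q<..<r} \<and>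
            real n * (snd (s, t) - fst (s, t)) < v (snd (s, t)) - v (fst (s, t))"
          by (intro exI[of _ s] exI[of _ t]) auto
      next
        show "m / 2 > 0" using mp by simp
      qed (unfold m_def, blast)
      then obtain F where F: "finite F" "\<And>i. i \<in> F \<Longrightarrow> fst i < snd i" "\<And>i. i \<in> F \<Longrightarrow> a < fst i"
       "\<And>i. i \<in> F \<Longrightarrow> snd i < b" "\<And>i. i \<in> F \<Longrightarrow> {fst i..snd i} \<subseteq> {q<..<r}"
       "\<And>i. i \<in> F \<Longrightarrow> real n * (snd i - fst i) < v (snd i) - v (fst i)"
       "pairwise (\<lambda>i j. {fst i..snd i} \<inter> {fst j..snd j} = {}) F" "m - m/2 < (\<Sum>i\<in>F. snd i - fst i)" by blast
      have "(\<Sum>i\<in>F. snd i - fst i) = (\<Sum>i\<in>F. measure lebesgue {fst i..snd i})"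
        using F(2) by (intro sum.cong) (auto simp: less_imp_le)
      also have "\<dots> = measure lebesgue (\<Union>i\<in>F. {fst i..snd i})"
        using F(7) by (intro measure_UNION'[OF F(1), symmetric]) (auto simp: disjnt_def pairwise_def)
      also have "\<dots> \<le> measure lebesgue {q<..<r}"
        using F(1,5) by (intro measure_mono_fmeasurable) (auto intro!: fmeasurableD fmeasurable.finite_UN)
      also have "\<dots> < d" using that d by (cases "q \<le> r") auto
      finally have len: "(\<Sum>i\<in>F. snd i - fst i) < d" .
      have "intervals_in a b F" unfolding intervals_in_def
      proof (intro conjI ballI F(1))
        show "pairwise (\<lambda>i j. {fst i<..<snd i} \<inter> {fst j<..<snd j} = {}) F"
          using F(7) unfolding pairwise_def by fastforce
      qed (use F(2-4) in \<open>auto simp: less_imp_le\<close>)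
      from d(2)[OF this len] have s1: "(\<Sum>i\<in>F. \<bar>v (snd i) - v (fst i)\<bar>) < 1" .
      have "real n * (\<Sum>i\<in>F. snd i - fst i) \<le> (\<Sum>i\<in>F. \<bar>v (snd i) - v (fst i)\<bar>)"
        unfolding sum_distrib_left by (intro sum_mono order.trans[OF less_imp_le[OF F(6)]]) auto
      moreover have "1 < real n * (m/2)" using n mp by (simp add: field_simps)
      moreover have "real n * (m/2) \<le> real n * (\<Sum>i\<in>F. snd i - fst i)"
        using F(8) by (intro mult_left_mono) auto
      ultimately show False using s1 by linarith
    qed
    then show ?thesis using m unfolding m_def by (simp add: negligible_iff_measure)
  qed
  have "E \<subseteq> (\<Union>q\<in>\<rat>. E \<inter> {q - d/3<..<q + d/3})"
  proof
    fix x assume x: "x \<in> E"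
    obtain q where "q \<in> \<rat>" "x - d/3 < q" "q < x + d/3"
      using Rats_dense_in_real[of "x - d/3" "x + d/3"] d(1) by auto
    then show "x \<in> (\<Union>q\<in>\<rat>. E \<inter> {q - d/3<..<q + d/3})" using x by (auto intro!: bexI[of _ q])
  qed
  moreover have "negligible (\<Union>q\<in>\<rat>. E \<inter> {q - d/3<..<q + d/3})"
    using d(1) by (intro negligible_countable_Union) (auto simp: countable_rat intro!: piece)
  ultimately show ?thesis unfolding E_def by (rule negligible_subset[rotated])
qed

lemma steep_antimono:
  assumes "c \<le> c'" shows "steep v a b c' \<subseteq> steep v a b c"
proof
  fix x assume x: "x \<in> steep v a b c'"
  show "x \<in> steep v a b c" unfolding steep_def mem_Collect_eq
  proof (intro allI impI)
    fix d :: real assume "d > 0"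
    then obtain s t where st: "a < s \<and> s < x \<and> x < t \<and> t < b \<and> t - s < d \<and> c' * (t - s) < v t - v s"
      using x unfolding steep_def by blast
    then have "c * (t - s) \<le> c' * (t - s)" using assms by (intro mult_right_mono) auto
    with st have "c * (t - s) < v t - v s" by linarith
    with st show "\<exists>s t. a < s \<and> s < x \<and> x < t \<and> t < b \<and> t - s < d \<and> c * (t - s) < v t - v s"
      by blast
  qed
qed

text \<open>
  Subtracting a line of the mean slope \<open>(r + s) / 2\<close> turns slopes above \<open>s\<close> and below \<open>r\<close> into slopes of
  opposite sign.
\<close>
lemma slope_crossing_null:
  assumes v: "v \<in> AC a b" and rs: "r < s"
  shows "negligible (steep v a b s \<inter> steep (\<lambda>x. - v x) a b (- r))"
proof -
  define m where "m = (r + s)/2"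
  define w where "w = (\<lambda>x. v x + (- m) * x)"
  have w: "w \<in> AC a b" unfolding w_def by (intro AC_add AC_cmult AC_ident v)
  have wd: "w t - w q = (v t - v q) - m * (t - q)" for t q
    unfolding w_def by (simp add: algebra_simps)
  have "(s - r)/2 + m = s" "(s - r)/2 - m = - r" by (simp_all add: m_def field_simps)
  then have half: "(s - r)/2 * (t - q) + m * (t - q) = s * (t - q)"
    "(s - r)/2 * (t - q) - m * (t - q) = - r * (t - q)" for t q
    by (simp_all only: distrib_right[symmetric] left_diff_distrib[symmetric])
  have 1: "steep v a b s = steep w a b ((s - r)/2)"
  proof -
    have "s * (t - q) < v t - v q \<longleftrightarrow> (s - r)/2 * (t - q) < w t - w q" for t q
      using wd[of t q] half[of t q] by linarith
    then show ?thesis unfolding steep_def by simp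
  qed
  have 2: "steep (\<lambda>x. - v x) a b (- r) = steep (\<lambda>x. - w x) a b ((s - r)/2)"
  proof -
    have "- r * (t - q) < - v t - - v q \<longleftrightarrow> (s - r)/2 * (t - q) < - w t - - w q" for t q
      using wd[of t q] half[of t q] by linarith
    then show ?thesis unfolding steep_def by simp
  qed
  show ?thesis unfolding 1 2 by (rule AC_oscillation_null[OF w]) (use rs in simp)
qed

lemma slope_le_if_not_steep:
  assumes c: "continuous_on {a..b} v" and x: "a < x" "x < b" and ns: "x \<notin> steep v a b k"
  shows "\<exists>d>0. \<forall>y. y \<noteq> x \<and> \<bar>y - x\<bar> < d \<longrightarrow> (v y - v x) / (y - x) \<le> k"
proof -
  obtain d where d: "d > 0" "\<And>s t. a < s \<Longrightarrow> s < x \<Longrightarrow> x < t \<Longrightarrow> t < b \<Longrightarrow> t - s < d \<Longrightarrow> v t - v s \<le> k * (t - s)"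
    using ns unfolding steep_def by (auto simp: not_less) (metis linorder_not_less)
  have cont: "(v \<longlongrightarrow> v x) (at x)"
    using c x by (metis atLeastAtMost_iff at_within_Icc_at continuous_on less_imp_le)
  define e where "e = min (d/2) (min (x - a) (b - x))"
  have e: "e > 0" "e \<le> d/2" "e \<le> x - a" "e \<le> b - x" using d x unfolding e_def by linarith+
  have "(v y - v x) / (y - x) \<le> k" if y: "y \<noteq> x" "\<bar>y - x\<bar> < e" for y
  proof (cases "x < y")
    case True
    have "((\<lambda>s. k * (y - s) - (v y - v s)) \<longlongrightarrow> k * (y - x) - (v y - v x)) (at_left x)"
      by (intro tendsto_intros filterlim_at_split[THEN iffD1, THEN conjunct1, OF cont])
    moreover have "eventually (\<lambda>s. 0 \<le> k * (y - s) - (v y - v s)) (at_left x)"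
    proof -
      have "eventually (\<lambda>s. s \<in> {x - e<..<x}) (at_left x)" by (rule eventually_at_left_real) (use e in simp)
      then show ?thesis
      proof eventually_elim
        case (elim s)
        then show ?case using d(2)[of s y] y e True by auto
      qed
    qed
    ultimately have "0 \<le> k * (y - x) - (v y - v x)" by (rule tendsto_lowerbound) simp
    then show ?thesis using True by (simp add: field_simps)
  next
    case False
    then have yx: "y < x" using y by simp
    have "((\<lambda>t. k * (t - y) - (v t - v y)) \<longlongrightarrow> k * (x - y) - (v x - v y)) (at_right x)"
      by (intro tendsto_intros filterlim_at_split[THEN iffD1, THEN conjunct2, OF cont])
    moreover have "eventually (\<lambda>t. 0 \<le> k * (t - y) - (v t - v y)) (at_right x)"
    proof -
      have "eventually (\<lambda>t. t \<in> {x<..<x + e}) (at_right x)" by (rule eventually_at_right_real) (use e in simp)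
      then show ?thesis
      proof eventually_elim
        case (elim t)
        then show ?case using d(2)[of y t] y e yx by auto
      qed
    qed
    ultimately have "0 \<le> k * (x - y) - (v x - v y)" by (rule tendsto_lowerbound) simp
    then show ?thesis using yx by (simp add: field_simps)
  qed
  then show ?thesis using e(1) by blast
qed

text \<open>
  Outside the exceptional sets, slopes above \<open>s\<close> on arbitrarily short intervals exclude slopes below any
  \<open>r < s\<close>, so the supremum of the slopes that keep recurring is the derivative.
\<close>
theorem AC_differentiable_ae:
  assumes v: "v \<in> AC a b"
  obtains N where "negligible N" "\<And>x. a < x \<Longrightarrow> x < b \<Longrightarrow> x \<notin> N \<Longrightarrow> v differentiable (at x)"
proof -
  have v': "(\<lambda>x. - v x) \<in> AC a b" using AC_cmult[OF v, of "-1"] by simp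
  define P where "P = {rs. fst rs \<in> \<rat> \<and> snd rs \<in> \<rat> \<and> fst rs < (snd rs :: real)}"
  define N where "N = (\<Union>rs\<in>P. steep v a b (snd rs) \<inter> steep (\<lambda>x. - v x) a b (- fst rs)) \<union>
     ((\<Inter>n::nat. steep v a b (real n)) \<union> (\<Inter>n::nat. steep (\<lambda>x. - v x) a b (real n)))"
  have "countable (\<rat> \<times> \<rat> :: (real \<times> real) set)" by (intro countable_SIGMA countable_rat)
  then have "countable P" by (rule countable_subset[rotated]) (auto simp: P_def)
  then have N: "negligible N" unfolding N_def
    by (intro negligible_Un AC_unbounded_slope_null v v' negligible_countable_Union)
       (auto simp: P_def intro!: slope_crossing_null v)
  show ?thesis
  proof (rule that[OF N])
    fix x assume x: "a < x" "x < b" "x \<notin> N"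
    note bd = slope_le_if_not_steep[OF AC_imp_continuous_on[OF v] x(1,2)]
    note bd' = slope_le_if_not_steep[OF AC_imp_continuous_on[OF v'] x(1,2)]
    define Q where "Q = (\<lambda>y. (v y - v x) / (y - x))"
    have Q': "(- v y - - v x) / (y - x) = - Q y" for y
      unfolding Q_def by (metis minus_diff_commute minus_diff_minus minus_divide_left)
    have upper: "\<exists>d>0. \<forall>y. y \<noteq> x \<and> \<bar>y - x\<bar> < d \<longrightarrow> Q y \<le> k" if "x \<notin> steep v a b k" for k
      using bd[OF that] unfolding Q_def .
    have lower: "\<exists>d>0. \<forall>y. y \<noteq> x \<and> \<bar>y - x\<bar> < d \<longrightarrow> k \<le> Q y" if "x \<notin> steep (\<lambda>x. - v x) a b (- k)" for k
      using bd'[OF that] unfolding Q' by simp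
    obtain n1 n2 :: nat where n: "x \<notin> steep v a b (real n1)" "x \<notin> steep (\<lambda>x. - v x) a b (real n2)"
      using x(3) by (auto simp: N_def)
    define T where "T = {q. x \<in> steep v a b q}"
    have Tb: "q \<le> real n1" if "q \<in> T" for q
      using that n(1) steep_antimono[of "real n1" q v a b] by (force simp: T_def)
    have "- real n2 - 1 \<in> T"
    proof (rule ccontr)
      assume "- real n2 - 1 \<notin> T"
      then obtain d1 where d1: "d1 > 0" "\<forall>y. y \<noteq> x \<and> \<bar>y - x\<bar> < d1 \<longrightarrow> Q y \<le> - real n2 - 1"
        using upper unfolding T_def by blast
      obtain d2 where d2: "d2 > 0" "\<forall>y. y \<noteq> x \<and> \<bar>y - x\<bar> < d2 \<longrightarrow> - real n2 \<le> Q y"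
        using lower[of "- real n2"] n(2) by auto
      have "Q (x + min d1 d2 / 2) \<le> - real n2 - 1" "- real n2 \<le> Q (x + min d1 d2 / 2)"
        using d1(1) d2(1) by (auto intro!: d1(2)[rule_format] d2(2)[rule_format])
      then show False by simp
    qed
    then have Tne: "T \<noteq> {}" by blast
    have Tbdd: "bdd_above T" using Tb by (meson bdd_aboveI)
    define D where "D = Sup T"
    have lim: "(Q \<longlongrightarrow> D) (at x)"
    proof (rule LIM_I)
      fix e :: real assume e: "e > 0"
      have "D + e/2 \<notin> T"
        using cSup_upper[OF _ Tbdd, of "D + e/2"] e unfolding D_def by linarith
      then obtain d1 where d1: "d1 > 0" "\<forall>y. y \<noteq> x \<and> \<bar>y - x\<bar> < d1 \<longrightarrow> Q y \<le> D + e/2"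
        using upper unfolding T_def by blast
      obtain s where s: "s \<in> \<rat>" "D - e/4 < s" "s < D" using Rats_dense_in_real[of "D - e/4" D] e by auto
      obtain r where r: "r \<in> \<rat>" "D - e/2 < r" "r < s" using Rats_dense_in_real[of "D - e/2" s] s e by auto
      obtain q where q: "q \<in> T" "s < q" using less_cSupD[OF Tne] s(3) unfolding D_def by blast
      have "x \<in> steep v a b s" using q steep_antimono[of s q v a b] by (auto simp: T_def)
      moreover have "x \<notin> steep v a b s \<inter> steep (\<lambda>x. - v x) a b (- r)"
        using x(3) s r unfolding N_def P_def by force
      ultimately obtain d2 where d2: "d2 > 0" "\<forall>y. y \<noteq> x \<and> \<bar>y - x\<bar> < d2 \<longrightarrow> r \<le> Q y"
        using lower by blast
      show "\<exists>d>0. \<forall>y. y \<noteq> x \<and> norm (y - x) < d \<longrightarrow> norm (Q y - D) < e"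
      proof (intro exI[of _ "min d1 d2"] conjI allI impI)
        fix y assume "y \<noteq> x \<and> norm (y - x) < min d1 d2"
        then have "Q y \<le> D + e/2" "r \<le> Q y" using d1 d2 by auto
        then show "norm (Q y - D) < e" using r e by (auto simp: abs_less_iff)
      qed (use d1 d2 in auto)
    qed
    then have "(v has_field_derivative D) (at x)"
      unfolding has_field_derivative_iff Q_def .
    then show "v differentiable (at x)" by (rule differentiableI[OF has_field_derivative_imp_has_derivative])
  qed
qed

text \<open>
  Subintervals with a tag outside \<open>N\<close> are treated as for differentiable functions.  Those with a tag in
  \<open>N\<close> lie in an open set of small measure, and absolute continuity makes their increments small.
\<close>
lemma AC_has_integral_derivative:
  assumes g: "g \<in> AC a b" and ab: "a < b" and N: "negligible N"
    and d: "\<And>x. x \<in> {a..b} - N \<Longrightarrow> (g has_real_derivative g' x) (at x within {a..b})"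
  shows "((\<lambda>x. if x \<in> N then 0 else g' x) has_integral (g b - g a)) {a..b}"
  unfolding has_integral_factor_content_real
proof (intro allI impI)
  fix e :: real assume e: "e > 0"
  define e' where "e' = e * (b - a) / 2"
  have "e' > 0" using e ab by (simp add: e'_def)
  then obtain dl where dl: "dl > 0" "AC_modulus a b g e' dl" using g by (auto simp: AC_iff)
  obtain U where U: "open U" "N \<subseteq> U" "U \<in> lmeasurable" "measure lebesgue U < dl"
    using lmeasurable_outer_open[OF negligible_imp_measurable[OF N] dl(1)] negligible_imp_measure0[OF N] by auto
  have "\<exists>r>0. (x \<in> N \<longrightarrow> ball x r \<subseteq> U) \<and> (x \<in> {a..b} - N \<longrightarrow>
     (\<forall>y\<in>{a..b}. \<bar>y - x\<bar> < r \<longrightarrow> \<bar>g y - g x - g' x * (y - x)\<bar> \<le> e/2 * \<bar>y - x\<bar>))" for x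
  proof (cases "x \<in> N")
    case True
    then obtain r where "r > 0" "ball x r \<subseteq> U" using U openE by (metis subsetD)
    then show ?thesis using True by blast
  next
    case False
    show ?thesis
    proof (cases "x \<in> {a..b}")
      case True
      then have "(g has_derivative (*) (g' x)) (at x within {a..b})"
        using d False by (auto simp: has_field_derivative_def)
      then obtain r where "r > 0" "\<forall>y\<in>{a..b}. norm (y - x) < r \<longrightarrow> norm (g y - g x - g' x * (y - x)) \<le> e/2 * norm (y - x)"
        unfolding has_derivative_within_alt using e by (meson half_gt_zero)
      then show ?thesis using False by auto
    qed (use False in \<open>auto intro: exI[of _ 1]\<close>)
  qed
  then obtain r where r: "\<And>x. r x > 0" "\<And>x. x \<in> N \<Longrightarrow> ball x (r x) \<subseteq> U"
    "\<And>x y. x \<in> {a..b} - N \<Longrightarrow> y \<in> {a..b} \<Longrightarrow> \<bar>y - x\<bar> < r x \<Longrightarrow> \<bar>g y - g x - g' x * (y - x)\<bar> \<le> e/2 * \<bar>y - x\<bar>"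
    by metis
  show "\<exists>\<gamma>. gauge \<gamma> \<and> (\<forall>p. p tagged_division_of {a..b} \<and> \<gamma> fine p \<longrightarrow>
      norm ((\<Sum>(x, k)\<in>p. measure lborel k *\<^sub>R (if x \<in> N then 0 else g' x)) - (g b - g a)) \<le> e * measure lborel {a..b})"
  proof (intro exI[of _ "\<lambda>x. ball x (r x)"] conjI allI impI)
    show "gauge (\<lambda>x. ball x (r x))" using r(1) by (rule gauge_ball_dependent[rule_format])
    fix p assume p': "p tagged_division_of {a..b} \<and> (\<lambda>x. ball x (r x)) fine p"
    then have p: "p tagged_division_of {a..b}" and fn: "(\<lambda>x. ball x (r x)) fine p" by auto
    have fin: "finite p" using p by auto
    have K: "\<exists>s t. snd q = {s..t} \<and> s \<le> fst q \<and> fst q \<le> t \<and> a \<le> s \<and> t \<le> b \<and> snd q \<subseteq> ball (fst q) (r (fst q))" if "q \<in> p" for q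
    proof -
      obtain x K where q: "q = (x, K)" by (cases q)
      then have xK: "x \<in> K" "K \<subseteq> {a..b}" "\<exists>s t. K = cbox s t" "K \<subseteq> ball x (r x)"
        using tagged_division_ofD(2-4)[OF p] fn that unfolding fine_def by blast+
      then obtain s t where "K = {s..t}" by (auto simp: cbox_interval)
      then show ?thesis using xK q by auto
    qed
    define S T where "S = (\<lambda>q :: real \<times> real set. Inf (snd q))" and "T = (\<lambda>q :: real \<times> real set. Sup (snd q))"
    have ST: "snd q = {S q..T q}" "S q \<le> fst q" "fst q \<le> T q" "a \<le> S q" "T q \<le> b" "{S q..T q} \<subseteq> ball (fst q) (r (fst q))"
      if "q \<in> p" for q using K[OF that] unfolding S_def T_def by auto
    define pN where "pN = {q\<in>p. fst q \<in> N}"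
    define pD where "pD = {q\<in>p. fst q \<notin> N}"
    have split: "(\<Sum>q\<in>p. f q) = (\<Sum>q\<in>pN. f q) + (\<Sum>q\<in>pD. f q)" for f :: "real \<times> real set \<Rightarrow> real"
    proof -
      have "p = pN \<union> pD" "pN \<inter> pD = {}" "finite pN" "finite pD" using fin by (auto simp: pN_def pD_def)
      then show ?thesis using sum.union_disjoint[of pN pD f] by metis
    qed
    have dj: "{S q<..<T q} \<inter> {S q'<..<T q'} = {}" if "q \<in> p" "q' \<in> p" "q \<noteq> q'" for q q'
    proof -
      have "interior (snd q) \<inter> interior (snd q') = {}"
        using tagged_division_ofD(5)[OF p, of "fst q" "snd q" "fst q'" "snd q'"] that by (auto simp: prod_eq_iff)
      then show ?thesis using ST(1)[OF that(1)] ST(1)[OF that(2)] by (simp add: interior_atLeastAtMost_real)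
    qed
    have lenN: "(\<Sum>q\<in>pN. T q - S q) < dl"
    proof -
      have "(\<Sum>q\<in>pN. T q - S q) = (\<Sum>q\<in>pN. measure lebesgue {S q<..<T q})"
      proof (rule sum.cong[OF refl])
        fix q assume "q \<in> pN"
        then show "T q - S q = measure lebesgue {S q<..<T q}" using ST(2,3)[of q] by (simp add: pN_def)
      qed
      also have "\<dots> = measure lebesgue (\<Union>q\<in>pN. {S q<..<T q})"
        using fin dj by (intro measure_UNION'[symmetric]) (auto simp: disjnt_def pairwise_def pN_def)
      also have "\<dots> \<le> measure lebesgue U"
      proof (rule measure_mono_fmeasurable)
        show "(\<Union>q\<in>pN. {S q<..<T q}) \<subseteq> U"
        proof
          fix z assume "z \<in> (\<Union>q\<in>pN. {S q<..<T q})"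
          then obtain q where q: "q \<in> p" "fst q \<in> N" "z \<in> {S q..T q}" by (auto simp: pN_def)
          then show "z \<in> U" using ST(6)[OF q(1)] r(2)[OF q(2)] by blast
        qed
        show "(\<Union>q\<in>pN. {S q<..<T q}) \<in> sets lebesgue"
          using fin by (intro sets.finite_UN) (auto simp: pN_def)
      qed (use U in auto)
      finally show ?thesis using U by simp
    qed
    have N1: "(\<Sum>q\<in>pN. \<bar>g (T q) - g (S q)\<bar>) < e'"
    proof (rule AC_modulus_family[OF dl(2) _ _ _ lenN])
      show "finite pN" using fin by (simp add: pN_def)
      show "a \<le> S q \<and> S q \<le> T q \<and> T q \<le> b" if "q \<in> pN" for q
        using ST(2-5)[of q] that by (simp add: pN_def)
      show "{S q<..<T q} \<inter> {S q'<..<T q'} = {}" if "q \<in> pN" "q' \<in> pN" "q \<noteq> q'" for q q'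
        using dj[of q q'] that by (simp add: pN_def)
    qed
    have "\<bar>(T q - S q) * g' (fst q) - (g (T q) - g (S q))\<bar> \<le> e/2 * (T q - S q)" if "q \<in> pD" for q
    proof -
      have q: "q \<in> p" "fst q \<notin> N" using that by (auto simp: pD_def)
      have "S q \<in> {S q..T q}" "T q \<in> {S q..T q}" using ST(2,3)[OF q(1)] by auto
      then have "S q \<in> ball (fst q) (r (fst q))" "T q \<in> ball (fst q) (r (fst q))"
        using ST(6)[OF q(1)] by blast+
      then have "\<bar>g (S q) - g (fst q) - g' (fst q) * (S q - fst q)\<bar> \<le> e/2 * \<bar>S q - fst q\<bar>"
        "\<bar>g (T q) - g (fst q) - g' (fst q) * (T q - fst q)\<bar> \<le> e/2 * \<bar>T q - fst q\<bar>"
        using r(3)[of "fst q" "S q"] r(3)[of "fst q" "T q"] q ST[OF q(1)] by (auto simp: dist_real_def abs_minus_commute)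
      moreover have "(T q - S q) * g' (fst q) - (g (T q) - g (S q)) =
        (g (S q) - g (fst q) - g' (fst q) * (S q - fst q)) - (g (T q) - g (fst q) - g' (fst q) * (T q - fst q))"
        by algebra
      moreover have "e/2 * (T q - S q) = e/2 * \<bar>S q - fst q\<bar> + e/2 * \<bar>T q - fst q\<bar>"
        using ST(2,3)[OF q(1)] by (simp flip: distrib_left)
      ultimately show ?thesis by linarith
    qed
    then have D1: "(\<Sum>q\<in>pD. \<bar>(T q - S q) * g' (fst q) - (g (T q) - g (S q))\<bar>) \<le> (\<Sum>q\<in>pD. e/2 * (T q - S q))"
      by (rule sum_mono)
    have tot: "(\<Sum>q\<in>p. f (T q) - f (S q)) = f b - f a" for f :: "real \<Rightarrow> real"
      using additive_tagged_division_1[OF less_imp_le[OF ab] p, of f] by (simp add: S_def T_def case_prod_beta)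
    have "(\<Sum>q\<in>pD. T q - S q) \<le> (\<Sum>q\<in>p. T q - S q)"
    proof (rule sum_mono2[OF fin])
      show "0 \<le> T q - S q" if "q \<in> p - pD" for q using ST(2,3)[of q] that by auto
    qed (auto simp: pD_def)
    then have D2: "(\<Sum>q\<in>pD. e/2 * (T q - S q)) \<le> e/2 * (b - a)"
      unfolding sum_distrib_left[symmetric] using tot[of "\<lambda>x. x"] e by (intro mult_left_mono) auto
    have "(\<Sum>(x, k)\<in>p. measure lborel k *\<^sub>R (if x \<in> N then 0 else g' x)) - (g b - g a) =
       (\<Sum>q\<in>p. (T q - S q) * (if fst q \<in> N then 0 else g' (fst q)) - (g (T q) - g (S q)))"
      unfolding tot[of g, symmetric] sum_subtractf[symmetric] case_prod_beta
    proof (rule sum.cong[OF refl])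
      fix q assume "q \<in> p"
      then have "measure lborel (snd q) = T q - S q" using ST[of q] by auto
      then show "measure lborel (snd q) *\<^sub>R (if fst q \<in> N then 0 else g' (fst q)) - (g (T q) - g (S q)) =
        (T q - S q) * (if fst q \<in> N then 0 else g' (fst q)) - (g (T q) - g (S q))" by simp
    qed
    also have "\<dots> = (\<Sum>q\<in>pN. - (g (T q) - g (S q))) + (\<Sum>q\<in>pD. (T q - S q) * g' (fst q) - (g (T q) - g (S q)))"
      unfolding split by (intro arg_cong2[where f = "(+)"] sum.cong) (auto simp: pN_def pD_def)
    finally have eq: "(\<Sum>(x, k)\<in>p. measure lborel k *\<^sub>R (if x \<in> N then 0 else g' x)) - (g b - g a) =
      (\<Sum>q\<in>pN. - (g (T q) - g (S q))) + (\<Sum>q\<in>pD. (T q - S q) * g' (fst q) - (g (T q) - g (S q)))" .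
    have "\<bar>(\<Sum>q\<in>pN. - (g (T q) - g (S q))) + (\<Sum>q\<in>pD. (T q - S q) * g' (fst q) - (g (T q) - g (S q)))\<bar>
      \<le> (\<Sum>q\<in>pN. \<bar>g (T q) - g (S q)\<bar>) + (\<Sum>q\<in>pD. \<bar>(T q - S q) * g' (fst q) - (g (T q) - g (S q))\<bar>)"
    proof -
      have "\<bar>\<Sum>q\<in>pN. - (g (T q) - g (S q))\<bar> \<le> (\<Sum>q\<in>pN. \<bar>- (g (T q) - g (S q))\<bar>)"
        by (rule sum_abs)
      moreover have "\<bar>\<Sum>q\<in>pD. (T q - S q) * g' (fst q) - (g (T q) - g (S q))\<bar> \<le>
        (\<Sum>q\<in>pD. \<bar>(T q - S q) * g' (fst q) - (g (T q) - g (S q))\<bar>)" by (rule sum_abs)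
      ultimately show ?thesis unfolding abs_minus_cancel by linarith
    qed
    also have "\<dots> \<le> e' + e/2 * (b - a)" using N1 D1 D2 by linarith
    also have "\<dots> = e * measure lborel {a..b}" using ab by (simp add: e'_def)
    finally show "norm ((\<Sum>(x, k)\<in>p. measure lborel k *\<^sub>R (if x \<in> N then 0 else g' x)) - (g b - g a)) \<le> e * measure lborel {a..b}"
      unfolding eq real_norm_def .
  qed
qed

text \<open>
  The derivative, set to zero on the exceptional set, is Henstock-Kurzweil integrable and hence measurable.
  Its integral is at most that of the positive part of its almost everywhere upper bound \<open>f\<close>.
\<close>
theorem AC_increment_le_nn_integral:
  assumes g: "g \<in> AC a b" and ab: "a < b" and N: "negligible N"
    and d: "\<And>x. a < x \<Longrightarrow> x < b \<Longrightarrow> x \<notin> N \<Longrightarrow> (g has_real_derivative g' x) (at x) \<and> g' x \<le> f x"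
  shows "ennreal (g b - g a) \<le> (\<integral>\<^sup>+x\<in>{a..b}. ennreal (f x) \<partial>lborel)"
proof -
  define N' where "N' = N \<union> {a, b}"
  have N': "negligible N'" using N by (auto simp: N'_def)
  define h where "h = (\<lambda>x. if x \<in> N' then 0 else g' x)"
  have h: "(h has_integral (g b - g a)) {a..b}" unfolding h_def
    by (rule AC_has_integral_derivative[OF g ab N']) (use d in \<open>auto simp: N'_def intro: has_field_derivative_at_within\<close>)
  define k where "k = (\<lambda>x. if x \<in> {a..b} then max 0 (h x) else 0)"
  have "h \<in> borel_measurable (lebesgue_on {a..b})"
    using h by (intro integrable_imp_measurable) (auto simp: integrable_on_def)
  then have "(\<lambda>x. max 0 (h x)) \<in> borel_measurable (lebesgue_on {a..b})" by measurable
  then have km: "k \<in> borel_measurable lebesgue" unfolding k_def by (rule borel_measurable_if_I) auto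
  define M where "M = (\<integral>\<^sup>+x. ennreal (k x) \<partial>lebesgue)"
  have "ennreal (g b - g a) \<le> M"
  proof (cases "M = \<infinity>")
    case False
    then have ki: "integrable lebesgue k"
      using km by (intro integrableI_bounded) (auto simp: M_def k_def less_top)
    have "(k has_integral (integral\<^sup>L lebesgue k)) UNIV" by (rule has_integral_integral_lebesgue[OF ki])
    then have "((\<lambda>x. max 0 (h x)) has_integral (integral\<^sup>L lebesgue k)) {a..b}"
      unfolding k_def has_integral_restrict_UNIV .
    then have "g b - g a \<le> integral\<^sup>L lebesgue k" by (rule has_integral_le[OF h]) auto
    moreover have "M = ennreal (integral\<^sup>L lebesgue k)"
      unfolding M_def by (rule nn_integral_eq_integral[OF ki]) (auto simp: k_def)
    ultimately show ?thesis by (simp add: ennreal_leI)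
  qed simp
  also have "M = (\<integral>\<^sup>+x. ennreal (k x) \<partial>lborel)" unfolding M_def by (rule nn_integral_completion)
  also have "\<dots> \<le> (\<integral>\<^sup>+x\<in>{a..b}. ennreal (f x) \<partial>lborel)"
  proof (rule nn_integral_mono_AE)
    have "AE x in lebesgue. x \<notin> N'" using N' by (simp add: negligible_iff_null_sets AE_not_in)
    then have "AE x in lborel. x \<notin> N'" by (simp add: AE_completion_iff)
    then show "AE x in lborel. ennreal (k x) \<le> ennreal (f x) * indicator {a..b} x"
    proof eventually_elim
      case (elim x)
      show ?case
      proof (cases "x \<in> {a..b}")
        case True
        then have "h x \<le> f x" using d[of x] elim by (auto simp: h_def N'_def)
        then have "ennreal (max 0 (h x)) \<le> ennreal (f x)" by (auto simp: max_def ennreal_leI)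
        then show ?thesis using True by (simp add: k_def)
      qed (simp only: k_def if_False ennreal_0 zero_le)
    qed
  qed
  finally show ?thesis .
qed

section \<open>Smooth functions and cut-offs\<close>

lemma Ck_SucI:
  assumes "\<And>z. (f has_derivative D z) (at z)" "\<And>v. Ck k (\<lambda>z. D z v)"
  shows "Ck (Suc k) f"
proof -
  have "frechet_derivative f (at z) = D z" for z
    using frechet_derivative_at[OF assms(1)] by simp
  then show ?thesis using assms by (auto simp: differentiable_def)
qed

lemma Ck_SucD:
  assumes "Ck (Suc k) f"
  shows "(f has_derivative frechet_derivative f (at z)) (at z)" "Ck k (\<lambda>z. frechet_derivative f (at z) v)"
  using assms by (auto simp: frechet_derivative_works)

lemma Ck_Suc_imp_Ck: "Ck (Suc k) f \<Longrightarrow> Ck k f"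
proof (induction k arbitrary: f)
  case 0
  then show ?case
    by (auto simp: continuous_on_eq_continuous_at differentiable_imp_continuous_within)
next
  case (Suc k)
  then show ?case by (metis Ck.simps(2))
qed

lemma Ck_const: "Ck k (\<lambda>z. c)"
proof (induction k arbitrary: c)
  case (Suc k)
  show ?case by (rule Ck_SucI[of _ "\<lambda>z v. 0"]) (auto intro: Suc)
qed simp

lemma Ck_bounded_linear:
  assumes "bounded_linear f" shows "Ck k f"
proof (cases k)
  case 0
  then show ?thesis using assms by (simp add: linear_continuous_on)
next
  case (Suc m)
  show ?thesis unfolding Suc
    by (rule Ck_SucI[of _ "\<lambda>z. f"]) (auto intro: Ck_const bounded_linear_imp_has_derivative assms)
qed

lemma Ck_add: "Ck k f \<Longrightarrow> Ck k g \<Longrightarrow> Ck k (\<lambda>z. f z + g z)"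
proof (induction k arbitrary: f g)
  case (Suc k)
  show ?case
    by (rule Ck_SucI[OF has_derivative_add[OF Ck_SucD(1)[OF Suc.prems(1)] Ck_SucD(1)[OF Suc.prems(2)]]])
       (rule Suc.IH[OF Ck_SucD(2)[OF Suc.prems(1)] Ck_SucD(2)[OF Suc.prems(2)]])
qed (simp add: continuous_on_add)

lemma Ck_mult: "Ck k f \<Longrightarrow> Ck k g \<Longrightarrow> Ck k (\<lambda>z. f z * g z :: real)"
proof (induction k arbitrary: f g)
  case (Suc k)
  show ?case
    by (rule Ck_SucI[OF has_derivative_mult[OF Ck_SucD(1)[OF Suc.prems(1)] Ck_SucD(1)[OF Suc.prems(2)]]],
        rule Ck_add[OF Suc.IH[OF Ck_Suc_imp_Ck[OF Suc.prems(1)] Ck_SucD(2)[OF Suc.prems(2)]]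
          Suc.IH[OF Ck_SucD(2)[OF Suc.prems(1)] Ck_Suc_imp_Ck[OF Suc.prems(2)]]])
qed (simp add: continuous_on_mult)

lemma Ck_sum: "finite I \<Longrightarrow> (\<And>i. i \<in> I \<Longrightarrow> Ck k (f i)) \<Longrightarrow> Ck k (\<lambda>z. \<Sum>i\<in>I. f i z)"
  by (induction I rule: finite_induct) (auto intro: Ck_const Ck_add)

lemma frechet_derivative_real:
  fixes g :: "real \<Rightarrow> real"
  assumes "g differentiable (at x)"
  shows "frechet_derivative g (at x) v = v * frechet_derivative g (at x) 1"
  using linear_frechet_derivative[OF assms] linear_scale[of _ v 1] by force

lemma Ck_compose:
  fixes g :: "real \<Rightarrow> real" and f :: "'a::euclidean_space \<Rightarrow> real"
  shows "Ck k g \<Longrightarrow> Ck k f \<Longrightarrow> Ck k (\<lambda>z. g (f z))"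
proof (induction k arbitrary: f g)
  case 0
  then show ?case using continuous_on_compose2[of UNIV g UNIV f] by simp
next
  case (Suc k)
  show ?case
  proof (rule Ck_SucI)
    fix z
    have "((g \<circ> f) has_derivative (frechet_derivative g (at (f z)) \<circ> frechet_derivative f (at z))) (at z)"
      by (rule diff_chain_at[OF Ck_SucD(1)[OF Suc.prems(2)] Ck_SucD(1)[OF Suc.prems(1)]])
    moreover have "(frechet_derivative g (at (f z)) \<circ> frechet_derivative f (at z)) =
      (\<lambda>v. frechet_derivative f (at z) v * frechet_derivative g (at (f z)) 1)"
    proof
      fix v
      have dg: "g differentiable (at (f z))" using Suc.prems(1) by simp
      show "(frechet_derivative g (at (f z)) \<circ> frechet_derivative f (at z)) v =
        frechet_derivative f (at z) v * frechet_derivative g (at (f z)) 1"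
        unfolding o_apply by (rule frechet_derivative_real[OF dg])
    qed
    ultimately show "((\<lambda>z. g (f z)) has_derivative
      (\<lambda>v. frechet_derivative f (at z) v * frechet_derivative g (at (f z)) 1)) (at z)"
      by (simp add: o_def)
  next
    fix v
    show "Ck k (\<lambda>z. frechet_derivative f (at z) v * frechet_derivative g (at (f z)) 1)"
      by (rule Ck_mult[OF Ck_SucD(2)[OF Suc.prems(2)]
            Suc.IH[OF Ck_SucD(2)[OF Suc.prems(1)] Ck_Suc_imp_Ck[OF Suc.prems(2)]]])
  qed
qed

lemma Ck_local:
  assumes "\<And>z. \<exists>U g. open U \<and> z \<in> U \<and> Ck k g \<and> (\<forall>w\<in>U. f w = g w)"
  shows "Ck k f"
  using assms
proof (induction k arbitrary: f)
  case 0
  have "isCont f z" for z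
  proof -
    obtain U g where U: "open U" "z \<in> U" "Ck 0 g" "\<forall>w\<in>U. f w = g w" using 0 by blast
    then have "isCont g z" by (simp add: continuous_on_eq_continuous_at)
    moreover have "eventually (\<lambda>w. f w = g w) (nhds z)" using U by (auto simp: eventually_nhds)
    ultimately show ?thesis by (simp add: isCont_cong)
  qed
  then show ?case by (simp add: continuous_at_imp_continuous_on)
next
  case (Suc k)
  have D: "(f has_derivative frechet_derivative g (at w)) (at w)"
    if "open U" "w \<in> U" "Ck (Suc k) g" "\<forall>w\<in>U. f w = g w" for U g w
    by (rule has_derivative_transform_within_open[OF Ck_SucD(1)[OF that(3)] that(1,2)]) (use that in auto)
  have diff: "f differentiable (at z)" for z
    using Suc.prems[of z] D unfolding differentiable_def by blast
  have "Ck k (\<lambda>z. frechet_derivative f (at z) v)" for v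
  proof (rule Suc.IH)
    fix z
    obtain U g where U: "open U" "z \<in> U" "Ck (Suc k) g" "\<forall>w\<in>U. f w = g w" using Suc.prems by blast
    have "frechet_derivative f (at w) v = frechet_derivative g (at w) v" if "w \<in> U" for w
      using frechet_derivative_at[OF D[OF U(1) that U(3,4)]] by simp
    then show "\<exists>U g. open U \<and> z \<in> U \<and> Ck k g \<and> (\<forall>w\<in>U. frechet_derivative f (at w) v = g w)"
      using U Ck_SucD(2)[OF U(3)] by blast
  qed
  then show ?case using diff by simp
qed

lemma Ck_real_SucI:
  assumes "\<And>x. (f has_real_derivative f' x) (at x)" "Ck k f'"
  shows "Ck (Suc k) f"
proof (rule Ck_SucI[of _ "\<lambda>x v. f' x * v"])
  show "(f has_derivative (*) (f' z)) (at z)" for z using assms(1)[of z] by (simp add: has_field_derivative_def)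
qed (intro Ck_mult Ck_const assms)

lemma smooth_real_derivative:
  fixes f :: "real \<Rightarrow> real"
  assumes "smooth f"
  obtains f' where "smooth f'" "\<And>x. (f has_real_derivative f' x) (at x)"
proof
  have S: "Ck (Suc k) f" for k using assms by (simp add: smooth_def del: Ck.simps)
  show "smooth (\<lambda>x. frechet_derivative f (at x) 1)" unfolding smooth_def by (intro allI Ck_SucD(2)[OF S])
  show "(f has_real_derivative frechet_derivative f (at x) 1) (at x)" for x
  proof -
    have d: "f differentiable (at x)" using S[of 0] by simp
    have "frechet_derivative f (at x) = (*) (frechet_derivative f (at x) 1)"
      by (rule ext, subst frechet_derivative_real[OF d]) simp
    then show ?thesis using d unfolding has_field_derivative_def frechet_derivative_works by simp
  qed
qed

lemma smooth_real_antiderivative: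
  fixes f f' :: "real \<Rightarrow> real"
  assumes "smooth f'" "\<And>x. (f has_real_derivative f' x) (at x)"
  shows "smooth f"
  unfolding smooth_def
proof
  fix k show "Ck k f"
    using Ck_Suc_imp_Ck[OF Ck_real_SucI[OF assms(2), of k]] assms(1) by (simp add: smooth_def del: Ck.simps)
qed

lemma smooth_continuous: "smooth f \<Longrightarrow> continuous_on UNIV f"
  unfolding smooth_def by (metis Ck.simps(1))

lemma smooth_const: "smooth (\<lambda>z. c)" by (simp add: smooth_def Ck_const)
lemma smooth_bounded_linear: "bounded_linear f \<Longrightarrow> smooth f" by (simp add: smooth_def Ck_bounded_linear)
lemma smooth_add: "smooth f \<Longrightarrow> smooth g \<Longrightarrow> smooth (\<lambda>z. f z + g z)" by (simp add: smooth_def Ck_add)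
lemma smooth_mult: "smooth f \<Longrightarrow> smooth g \<Longrightarrow> smooth (\<lambda>z. f z * g z)" by (simp add: smooth_def Ck_mult)
lemma smooth_diff: "smooth f \<Longrightarrow> smooth g \<Longrightarrow> smooth (\<lambda>z. f z - g z)"
  using smooth_add[of f "\<lambda>z. (-1) * g z"] smooth_mult[OF smooth_const, of g "-1"] by simp
lemma smooth_divide_const: "smooth f \<Longrightarrow> smooth (\<lambda>z. f z / c)"
  using smooth_mult[OF smooth_const[of "inverse c"], of f] by (simp add: field_simps)
lemma smooth_sum: "finite I \<Longrightarrow> (\<And>i. i \<in> I \<Longrightarrow> smooth (f i)) \<Longrightarrow> smooth (\<lambda>z. \<Sum>i\<in>I. f i z)"
  by (simp add: smooth_def Ck_sum)
lemma smooth_compose: "smooth (g :: real \<Rightarrow> real) \<Longrightarrow> smooth f \<Longrightarrow> smooth (\<lambda>z. g (f z))"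
  by (simp add: smooth_def Ck_compose)
lemma smooth_local:
  assumes "\<And>z. \<exists>U g. open U \<and> z \<in> U \<and> smooth g \<and> (\<forall>w\<in>U. f w = g w)" shows "smooth f"
  unfolding smooth_def using assms by (intro allI Ck_local) (meson smooth_def)
lemma smooth_ident: "smooth (\<lambda>x::real. x)" by (intro smooth_bounded_linear bounded_linear_ident)
lemmas smooth_intros = smooth_const smooth_add smooth_mult smooth_diff smooth_divide_const smooth_ident

text \<open>
  A family that contains the standard smooth function \<open>exp (- 1 / x)\<close> and whose span is closed under
  differentiation.
\<close>
definition flat :: "nat \<Rightarrow> real \<Rightarrow> real" where
  "flat m x = (if x \<le> 0 then 0 else exp (- inverse x) * inverse x ^ m)"

lemma flat_has_derivative:
  "(flat m has_real_derivative (flat (m + 2) x - real m * flat (m + 1) x)) (at x)"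
proof -
  consider "x < 0" | "x > 0" | "x = 0" by linarith
  then show ?thesis
  proof cases
    case 1
    have "((\<lambda>x. 0) has_real_derivative 0) (at x)" by simp
    then have "(flat m has_real_derivative 0) (at x)"
      by (rule DERIV_cong_ev[OF refl _ refl, THEN iffD1, rotated])
         (use 1 in \<open>auto simp: flat_def eventually_nhds intro!: exI[of _ "{..<0}"]\<close>)
    then show ?thesis using 1 by (simp add: flat_def)
  next
    case 2
    have "((\<lambda>x. exp (- inverse x) * inverse x ^ m) has_real_derivative
       (flat (m + 2) x - real m * flat (m + 1) x)) (at x)"
    proof -
      have "((\<lambda>x. inverse x ^ m) has_real_derivative - real m * inverse x ^ (m + 1)) (at x)"
      proof (cases m)
        case (Suc n)
        show ?thesis unfolding Suc
          using DERIV_power[OF DERIV_inverse[of x], of "Suc n" UNIV] 2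
          by (simp add: power2_eq_square algebra_simps)
      qed simp
      moreover have "((\<lambda>x. exp (- inverse x)) has_real_derivative exp (- inverse x) * inverse x ^ 2) (at x)"
        using 2 by (auto intro!: derivative_eq_intros simp: power2_eq_square)
      ultimately have "((\<lambda>x. exp (- inverse x) * inverse x ^ m) has_real_derivative
        exp (- inverse x) * (- real m * inverse x ^ (m + 1)) + exp (- inverse x) * inverse x ^ 2 * inverse x ^ m) (at x)"
        by (rule DERIV_mult'[rotated])
      moreover have "exp (- inverse x) * (- real m * inverse x ^ (m + 1)) + exp (- inverse x) * inverse x ^ 2 * inverse x ^ m
          = flat (m + 2) x - real m * flat (m + 1) x"
        using 2 by (simp add: flat_def power2_eq_square)
      ultimately show ?thesis by simp
    qed
    then show ?thesis
      by (rule DERIV_cong_ev[OF refl _ refl, THEN iffD1, rotated])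
         (use 2 in \<open>auto simp: flat_def eventually_nhds intro!: exI[of _ "{0<..}"]\<close>)
  next
    case 3
    have "((\<lambda>y. inverse y ^ (m + 1) / exp (inverse y)) \<longlongrightarrow> 0) (at_right (0::real))"
      by (rule filterlim_compose[OF tendsto_power_div_exp_0 filterlim_inverse_at_top_right])
    then have "((\<lambda>y. (flat m y - flat m 0) / (y - 0)) \<longlongrightarrow> 0) (at_right 0)"
      by (rule Lim_transform_eventually)
         (auto simp: flat_def exp_minus field_simps eventually_at_filter)
    moreover have "((\<lambda>y. (flat m y - flat m 0) / (y - 0)) \<longlongrightarrow> 0) (at_left 0)"
      by (rule Lim_transform_eventually[OF tendsto_const])
         (auto simp: flat_def eventually_at_filter)
    ultimately show ?thesis unfolding has_field_derivative_iff 3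
      by (simp add: filterlim_split_at flat_def)
  qed
qed

lemma smooth_flat: "smooth (flat m)"
proof -
  have "Ck k (flat m)" for k
  proof (induction k arbitrary: m)
    case 0
    show ?case using DERIV_isCont[OF flat_has_derivative] by (simp add: continuous_at_imp_continuous_on)
  next
    case (Suc k)
    have "Ck k (\<lambda>x. flat (m + 2) x + (- real m) * flat (m + 1) x)"
      by (intro Ck_add Ck_mult Ck_const Suc)
    then show ?case by (intro Ck_real_SucI[OF flat_has_derivative]) simp
  qed
  then show ?thesis by (simp add: smooth_def)
qed

lemma antiderivative_exists:
  fixes g :: "real \<Rightarrow> real"
  assumes "continuous_on UNIV g"
  obtains G where "\<And>x. (G has_real_derivative g x) (at x)"
proof -
  have "\<exists>F. \<forall>x. -\<infinity> < ereal x \<longrightarrow> ereal x < \<infinity> \<longrightarrow> (F has_vector_derivative g x) (at x)"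
    by (rule einterval_antiderivative) (use assms in \<open>auto simp: continuous_on_eq_continuous_at\<close>)
  then show ?thesis using that by (auto simp: has_real_derivative_iff_has_vector_derivative)
qed

lemma eq_of_derivative_zero_on:
  fixes f f' :: "real \<Rightarrow> real"
  assumes "\<And>x. (f has_real_derivative f' x) (at x)" "x \<le> y" "\<And>t. x < t \<Longrightarrow> t < y \<Longrightarrow> f' t = 0"
  shows "f x = f y"
proof (cases "x = y")
  case False
  then obtain z where "x < z" "z < y" "f y - f x = (y - x) * f' z"
    using MVT2[of x y f f'] assms by auto
  then show ?thesis using assms(3) by simp
qed simp

text \<open>
  The step is a normalised antiderivative of \<open>flat 0 t * flat 0 (1 - t)\<close>.
\<close>
lemma smooth_step_exists:
  obtains S S' :: "real \<Rightarrow> real" and K where "smooth S" "\<And>t. (S has_real_derivative S' t) (at t)" "smooth S'"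
    "\<And>t. 0 \<le> S' t" "\<And>t. S' t \<le> K" "\<And>t. t \<le> 0 \<Longrightarrow> S t = 0" "\<And>t. t \<ge> 1 \<Longrightarrow> S t = 1"
    "\<And>t. t \<le> 0 \<or> t \<ge> 1 \<Longrightarrow> S' t = 0"
proof -
  define g where "g = (\<lambda>t. flat 0 t * flat 0 (1 - t))"
  have g: "smooth g" unfolding g_def
    by (intro smooth_mult smooth_flat smooth_compose[OF smooth_flat] smooth_diff smooth_const smooth_ident)
  have g0: "g t = 0" if "t \<le> 0 \<or> t \<ge> 1" for t using that by (auto simp: g_def flat_def)
  have gp: "g t \<ge> 0" for t by (simp add: g_def flat_def)
  have gpp: "g t > 0" if "0 < t" "t < 1" for t using that by (simp add: g_def flat_def)
  obtain G where G: "\<And>x. (G has_real_derivative g x) (at x)"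
    using antiderivative_exists[OF smooth_continuous[OF g]] by blast
  have Gs: "smooth G" by (rule smooth_real_antiderivative[OF g G])
  obtain z where "0 < z" "z < 1" "G 1 - G 0 = (1 - 0) * g z" using MVT2[of 0 1 G g] G by auto
  then have pos: "G 1 - G 0 > 0" using gpp by simp
  have "bounded (g ` {0..1})"
    using compact_continuous_image[of "{0..1}" g] continuous_on_subset[OF smooth_continuous[OF g]]
      compact_imp_bounded by blast
  then obtain M where M: "\<And>t. t \<in> {0..1} \<Longrightarrow> \<bar>g t\<bar> \<le> M" "M > 0" unfolding bounded_pos by force
  have M': "g t \<le> M" for t
    using M(1)[of t] g0[of t] M(2) by (cases "t \<in> {0..1}") auto
  define S where "S = (\<lambda>t. (G t - G 0) / (G 1 - G 0))"
  define S' where "S' = (\<lambda>t. g t / (G 1 - G 0))"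
  show ?thesis
  proof (rule that[of S S' "M / (G 1 - G 0)"])
    show "smooth S" unfolding S_def by (intro smooth_intros Gs)
    show "smooth S'" unfolding S'_def by (intro smooth_intros g)
    show "(S has_real_derivative S' t) (at t)" for t unfolding S_def S'_def
      using DERIV_cdivide[OF DERIV_diff[OF G[of t] DERIV_const[of "G 0"]], of "G 1 - G 0"] by simp
    show "0 \<le> S' t" "S' t \<le> M / (G 1 - G 0)" for t using gp M' pos by (auto simp: S'_def divide_right_mono)
    show "S' t = 0" if "t \<le> 0 \<or> t \<ge> 1" for t using g0[OF that] by (simp add: S'_def)
    show "S t = 0" if "t \<le> 0" for t
      using eq_of_derivative_zero_on[of G g t 0] G g0 that by (simp add: S_def)
    show "S t = 1" if "t \<ge> 1" for t
      using eq_of_derivative_zero_on[of G g 1 t] G g0 that pos by (simp add: S_def)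
  qed
qed

lemma DERIV_nonneg_mono:
  fixes f f' :: "real \<Rightarrow> real"
  assumes "\<And>x. (f has_real_derivative f' x) (at x)" "\<And>x. 0 \<le> f' x" "x \<le> y"
  shows "f x \<le> f y"
  using DERIV_nonneg_imp_nondecreasing[of x y f] assms by blast

text \<open>
  A smooth version of \<open>max 0 t\<close>: an antiderivative of a smooth step.  The offset \<open>k\<close> is the area that the
  step leaves below \<open>1\<close> on the unit interval.
\<close>
lemma smooth_ramp_exists:
  obtains h :: "real \<Rightarrow> real" and k where "smooth h" "convex_on UNIV h" "0 \<le> k" "k \<le> 1"
    "\<And>t. t \<le> 0 \<Longrightarrow> h t = 0" "\<And>t. t \<ge> 1 \<Longrightarrow> h t = t - k" "\<And>t. 0 \<le> h t" "\<And>t. t - k \<le> h t"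
proof -
  obtain S S' :: "real \<Rightarrow> real" and K where S: "smooth S" "\<And>t. (S has_real_derivative S' t) (at t)"
    "\<And>t. 0 \<le> S' t" "\<And>t. t \<le> 0 \<Longrightarrow> S t = 0" "\<And>t. t \<ge> 1 \<Longrightarrow> S t = 1"
    using smooth_step_exists by metis
  have mono: "S x \<le> S y" if "x \<le> y" for x y using DERIV_nonneg_mono[OF S(2,3) that] .
  have S01: "0 \<le> S t" "S t \<le> 1" for t
    using mono[of "min t 0" t] mono[of t "max t 1"] S(4)[of "min t 0"] S(5)[of "max t 1"] by auto
  obtain G where G: "\<And>x. (G has_real_derivative S x) (at x)"
    using antiderivative_exists[OF smooth_continuous[OF S(1)]] by blast
  define h where "h = (\<lambda>t. G t - G 0)"
  have h: "(h has_real_derivative S x) (at x)" for x unfolding h_def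
    using DERIV_diff[OF G[of x] DERIV_const[of "G 0"]] by simp
  define k where "k = 1 - h 1"
  have h0: "h t = 0" if "t \<le> 0" for t
    using eq_of_derivative_zero_on[of h S t 0] h S(4) that by (simp add: h_def)
  have k: "h t - t = h 1 - 1" if "t \<ge> 1" for t
  proof -
    have "((\<lambda>t. h t - t) has_real_derivative S x - 1) (at x)" for x
      by (intro DERIV_diff h DERIV_ident)
    from eq_of_derivative_zero_on[OF this that] show ?thesis using S(5) by simp
  qed
  have le: "h x - x \<ge> h y - y" if "x \<le> y" for x y
  proof -
    have "((\<lambda>t. t - h t) has_real_derivative 1 - S x) (at x)" for x
      by (intro DERIV_diff h DERIV_ident)
    from DERIV_nonneg_mono[OF this _ that] show ?thesis using S01 by simp
  qed
  have hm: "h x \<le> h y" if "x \<le> y" for x y using DERIV_nonneg_mono[OF h S01(1) that] .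
  show ?thesis
  proof (rule that[of h k])
    show "smooth h" by (rule smooth_real_antiderivative[OF S(1) h])
    show "convex_on UNIV h"
      by (rule convex_on_realI[of UNIV h S]) (auto intro: h mono)
    show "0 \<le> k" "k \<le> 1" using le[of 0 1] h0[of 0] hm[of 0 1] by (auto simp: k_def)
    show "h t = 0" if "t \<le> 0" for t using h0[OF that] .
    show "h t = t - k" if "t \<ge> 1" for t using k[OF that] by (simp add: k_def)
    show "0 \<le> h t" for t using hm[of 0 t] h0[of 0] h0[of t] by (cases "t \<le> 0") auto
    show "t - k \<le> h t" for t using k[of t] le[of t 1] by (cases "t \<le> 1") (auto simp: k_def)
  qed
qed

section \<open>A single strip\<close>

definition bregman :: "(real \<Rightarrow> real) \<Rightarrow> (real \<Rightarrow> real) \<Rightarrow> real \<Rightarrow> real \<Rightarrow> real" where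
  "bregman w w' q s = w s - w q - w' q * (s - q)"

text \<open>
  A smooth step from \<open>0\<close> to \<open>1\<close> on the unit interval, from which all cut-off functions are built.
\<close>
locale smooth_step =
  fixes S S' :: "real \<Rightarrow> real" and K :: real
  assumes S_smooth: "smooth S" and S'_smooth: "smooth S'"
    and S_deriv: "\<And>t. (S has_real_derivative S' t) (at t)"
    and S'_nonneg: "\<And>t. 0 \<le> S' t" and S'_le: "\<And>t. S' t \<le> K"
    and S_0: "\<And>t. t \<le> 0 \<Longrightarrow> S t = 0" and S_1: "\<And>t. t \<ge> 1 \<Longrightarrow> S t = 1"
    and S'_0: "\<And>t. t \<le> 0 \<or> t \<ge> 1 \<Longrightarrow> S' t = 0"
begin

lemma S_mono: "x \<le> y \<Longrightarrow> S x \<le> S y"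
  using DERIV_nonneg_mono[OF S_deriv S'_nonneg] .

lemma S_nonneg: "0 \<le> S t" using S_mono[of "min t 0" t] S_0[of "min t 0"] by auto
lemma S_le_1: "S t \<le> 1" using S_mono[of t "max t 1"] S_1[of "max t 1"] by auto

end

locale energy =
  fixes w w' :: "real \<Rightarrow> real"
  assumes w_deriv: "\<And>q. (w has_real_derivative w' q) (at q)"
    and w_smooth: "smooth w" and w'_smooth: "smooth w'"
    and w'_strict: "\<And>q q'. q < q' \<Longrightarrow> w' q < w' q'"
    and w_0: "w 0 = 0" and w_nonneg: "\<And>s. 0 \<le> w s"
begin

abbreviation D where "D \<equiv> bregman w w'"

lemma w'_mono: "q \<le> q' \<Longrightarrow> w' q \<le> w' q'"
  using w'_strict[of q q'] by (cases "q = q'") auto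

lemma D_pos: "s \<noteq> q \<Longrightarrow> 0 < D q s"
proof (cases "s < q")
  case True
  then obtain z where "s < z" "z < q" "w q - w s = (q - s) * w' z"
    using MVT2[of s q w w'] w_deriv by auto
  then show ?thesis using w'_strict[of z q] True mult_strict_left_mono[of "w' z" "w' q" "q - s"]
    by (simp add: bregman_def algebra_simps)
next
  case False
  assume "s \<noteq> q"
  with False have "q < s" by simp
  then obtain z where "q < z" "z < s" "w s - w q = (s - q) * w' z"
    using MVT2[of q s w w'] w_deriv by auto
  then show ?thesis using w'_strict[of q z] \<open>q < s\<close> mult_strict_left_mono[of "w' q" "w' z" "s - q"]
    by (simp add: bregman_def algebra_simps)
qed

lemma D_nonneg: "0 \<le> D q s"
  using D_pos[of s q] by (cases "s = q") (auto simp: bregman_def)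

lemma D_self: "D q q = 0" by (simp add: bregman_def)

lemma w'_0: "w' 0 = 0"
  by (rule DERIV_local_min[OF w_deriv zero_less_one]) (simp add: w_0 w_nonneg)

lemma w'_nonneg: "0 \<le> q \<Longrightarrow> 0 \<le> w' q" using w'_mono[of 0 q] w'_0 by simp

text \<open>
  Minus the value at \<open>B\<close> of the tangent to \<open>w\<close> at \<open>q\<close>.
\<close>
definition E where "E B q = (q - B) * w' q - w q"

lemma E_mono:
  assumes "B \<le> q" "q \<le> q'" shows "E B q \<le> E B q'"
proof -
  have "E B q' - E B q = D q' q + (q - B) * (w' q' - w' q)"
    unfolding E_def bregman_def by algebra
  moreover have "0 \<le> (q - B) * (w' q' - w' q)" using assms w'_mono[of q q'] by simp
  ultimately show ?thesis using D_nonneg[of q' q] by linarith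
qed

text \<open>
  To the left of \<open>B\<close> the distance to the tangent at \<open>q\<close> is at least linear.  This absorbs the errors that
  arise where a strip is cut off.
\<close>
lemma D_coercive:
  assumes "0 < B" "B < q"
  shows "\<exists>m>0. \<forall>s\<le>B. m * (\<bar>s\<bar> + B) \<le> D q s"
proof -
  (* The first bound serves s near B, where the left-hand side is at most 2 m B; the second the growth in B - s. *)
  define m where "m = min (D q B / (2 * B)) (w' q - w' B)"
  have m: "m > 0" "m * (2 * B) \<le> D q B" "m \<le> w' q - w' B"
    using assms D_pos[of B q] w'_strict[of B q] by (auto simp: m_def min_mult_distrib_right min_le_iff_disj)
  have "m * (\<bar>s\<bar> + B) \<le> D q s" if "s \<le> B" for s
  proof -
    have "D q s = D q B + D B s + (w' q - w' B) * (B - s)"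
      unfolding bregman_def by algebra
    moreover have "m * (B - s) \<le> (w' q - w' B) * (B - s)" using m that by (intro mult_right_mono) auto
    ultimately have "D q s \<ge> m * (2 * B) + m * (B - s)" using D_nonneg[of B s] m by linarith
    moreover have "m * (\<bar>s\<bar> + B) \<le> m * (2 * B + (B - s))"
      using m(1) assms that by (intro mult_left_mono) auto
    moreover have "m * (2 * B + (B - s)) = m * (2 * B) + m * (B - s)" by (rule distrib_left)
    ultimately show ?thesis by linarith
  qed
  then show ?thesis using m(1) by blast
qed

end

text \<open>
  A strip around a segment that starts at the origin, has slope \<open>B\<close> and height \<open>l\<close>; write
  \<open>Y = y - B * x\<close>.  The tracks have slope \<open>p\<close> outside the strip and \<open>p'\<close> in its core \<open>\<bar>Y\<bar> \<le> r\<close>.  The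
  function \<open>h\<close> is a smooth version of \<open>max 0 (s - c)\<close>.  The strip is cut off over a height \<open>t\<close> at its ends,
  and the last assumption makes it so thin compared to \<open>t\<close> that the cut-off costs little.
\<close>
locale level = smooth_step S S' K + energy w w'
  for S S' :: "real \<Rightarrow> real" and K and w w' :: "real \<Rightarrow> real" +
  fixes h :: "real \<Rightarrow> real" and B c p p' l t r m :: real
  assumes h_nonneg: "\<And>s. 0 \<le> h s" and h_ge: "\<And>s. s - c \<le> h s"
    and h_eq: "\<And>s. c + 1 \<le> s \<Longrightarrow> h s = s - c"
    and B: "0 < B" "2 * c \<le> B" "0 \<le> c" and p: "2 * B \<le> p" "c + 1 \<le> p" "p \<le> p'"
    and pos: "0 < l" "0 < t" "0 < r" "10 * r \<le> t"
    and m: "0 < m" "\<And>s. s \<le> B \<Longrightarrow> m * (\<bar>s\<bar> + B) \<le> D p s"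
    and small: "8 * r * ((E B p' - E B p) / (B - c) + w' p' - w' p) * K \<le> t * min m 1"
begin

lemma cB: "c < B" using B by linarith

text \<open>
  The slope field \<open>slope\<close> bends the tracks between \<open>p\<close> and \<open>p'\<close>.  The other two functions of \<open>Y\<close> are forced by
  it: if \<open>psi0 * (s - c)\<close> is added to \<open>w\<close>, then the line through the point of the tangent at \<open>p\<close> over
  \<open>s = B\<close> whose slope is larger by \<open>xi\<close> touches the sum at \<open>slope\<close>.  All these lines pass through the same
  point, so \<open>xi\<close> can be the derivative of a potential that depends on \<open>Y\<close> only.
  
  That potential is \<open>A\<close>; it vanishes above the strip, where the tracks leave, and is cut off by \<open>W\<close> below
  the strip and by \<open>Z\<close> at both ends.  Where \<open>Z\<close> decreases, the additional bump \<open>V * U\<close> in \<open>psi\<close> pays for the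
  loss.  Finally \<open>grad x y s\<close> is the derivative of the potential in direction \<open>(1, s)\<close>, and \<open>gain\<close> is what the
  strip adds to the difference of Lagrangian and differential of the potential.
\<close>
definition bump where "bump Y = S (2 - Y / r) * S (2 + Y / r)"
definition slope where "slope Y = p + (p' - p) * bump Y"
definition psi0 where "psi0 Y = (E B (slope Y) - E B p) / (B - c)"
definition xi where "xi Y = psi0 Y + w' (slope Y) - w' p"
definition Psi where "Psi = (E B p' - E B p) / (B - c)"
definition Xi where "Xi = Psi + w' p' - w' p"
definition A where "A = (SOME A. (\<forall>Y. (A has_real_derivative xi Y) (at Y)) \<and> A (2 * r) = 0)"
definition W where "W Y = S (1 + (Y + 2 * r) / t)"
definition W' where "W' Y = S' (1 + (Y + 2 * r) / t) / t"
definition Z where "Z y = S (1 + y / t) - S ((y - l - 2 * t) / t)"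
definition Z' where "Z' y = (S' (1 + y / t) - S' ((y - l - 2 * t) / t)) / t"
definition U where "U y = S ((y - l - 3 * t / 2) * 2 / t) * S ((l + 7 * t / 2 - y) * 2 / t)"
definition V where "V Y = S (3 - Y / r) * S ((Y + 2 * r + 2 * t) / t)"
definition delta where "delta x y = A (y - B * x) * W (y - B * x) * Z y"
definition psi where "psi x y = Z y * psi0 (y - B * x) + V (y - B * x) * U y"
definition grad where "grad x y s =
  (xi (y - B * x) * W (y - B * x) + A (y - B * x) * W' (y - B * x)) * Z y * (s - B) +
  A (y - B * x) * W (y - B * x) * Z' y * s"
definition gain where "gain x y s = psi x y * h s - grad x y s"

lemma bump_01: "0 \<le> bump Y" "bump Y \<le> 1"
  unfolding bump_def using S_nonneg S_le_1 by (auto intro: mult_le_one)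
lemma bump_1: "\<bar>Y\<bar> \<le> r \<Longrightarrow> bump Y = 1"
  unfolding bump_def using pos by (subst (1 2) S_1) (auto simp: field_simps abs_le_iff)
lemma bump_0: "\<bar>Y\<bar> \<ge> 2 * r \<Longrightarrow> bump Y = 0"
  unfolding bump_def using pos S_0[of "2 - Y / r"] S_0[of "2 + Y / r"]
  by (cases "Y \<ge> 0") (auto simp: field_simps)

lemma slope_bounds: "p \<le> slope Y" "slope Y \<le> p'"
  unfolding slope_def using bump_01[of Y] p mult_left_le[of "bump Y" "p' - p"] by auto

lemma E_slope: "E B p \<le> E B (slope Y)" "E B (slope Y) \<le> E B p'"
  using E_mono[of B p "slope Y"] E_mono[of B "slope Y" p'] slope_bounds[of Y] p B by auto

lemma psi0_bounds: "0 \<le> psi0 Y" "psi0 Y \<le> Psi"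
  unfolding psi0_def Psi_def using E_slope[of Y] cB by (auto simp: divide_right_mono)

lemma xi_bounds: "0 \<le> xi Y" "xi Y \<le> Xi"
  unfolding xi_def Xi_def using psi0_bounds[of Y] slope_bounds[of Y] w'_mono[of p "slope Y"] w'_mono[of "slope Y" p']
  by auto

lemma Xi_nonneg: "0 \<le> Xi" using xi_bounds[of 0] by linarith
lemma Psi_nonneg: "0 \<le> Psi" using psi0_bounds[of 0] by linarith

lemma off_bump: "\<bar>Y\<bar> \<ge> 2 * r \<Longrightarrow> slope Y = p" "\<bar>Y\<bar> \<ge> 2 * r \<Longrightarrow> psi0 Y = 0" "\<bar>Y\<bar> \<ge> 2 * r \<Longrightarrow> xi Y = 0"
  by (auto simp: slope_def psi0_def xi_def bump_0)

lemma on_bump: "\<bar>Y\<bar> \<le> r \<Longrightarrow> slope Y = p'" "\<bar>Y\<bar> \<le> r \<Longrightarrow> psi0 Y = Psi" "\<bar>Y\<bar> \<le> r \<Longrightarrow> xi Y = Xi"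
  by (auto simp: slope_def psi0_def xi_def bump_1 Psi_def Xi_def)

lemma smooth_bump: "smooth bump"
  unfolding bump_def[abs_def] by (intro smooth_intros smooth_compose[OF S_smooth])
lemma smooth_slope: "smooth slope" unfolding slope_def[abs_def] by (intro smooth_intros smooth_bump)
lemma smooth_E: "smooth (E b)" unfolding E_def[abs_def] by (intro smooth_intros w_smooth w'_smooth)
lemma smooth_psi0: "smooth psi0"
  unfolding psi0_def[abs_def] by (intro smooth_intros smooth_compose[OF smooth_E] smooth_slope)
lemma smooth_xi: "smooth xi"
  unfolding xi_def[abs_def] by (intro smooth_intros smooth_psi0 smooth_compose[OF w'_smooth] smooth_slope)

lemma A_deriv: "(A has_real_derivative xi Y) (at Y)" and A_2r: "A (2 * r) = 0"
proof -
  obtain G where G: "\<And>x. (G has_real_derivative xi x) (at x)"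
    using antiderivative_exists[OF smooth_continuous[OF smooth_xi]] by blast
  have "\<exists>A. (\<forall>Y. (A has_real_derivative xi Y) (at Y)) \<and> A (2 * r) = 0"
    by (rule exI[of _ "\<lambda>Y. G Y - G (2 * r)"]) (auto intro!: derivative_eq_intros G)
  from someI_ex[OF this] show "(A has_real_derivative xi Y) (at Y)" "A (2 * r) = 0"
    unfolding A_def by auto
qed

lemma A_mono: "x \<le> y \<Longrightarrow> A x \<le> A y" by (rule DERIV_nonneg_mono[OF A_deriv xi_bounds(1)])

lemma A_0: "Y \<ge> 2 * r \<Longrightarrow> A Y = 0"
  using eq_of_derivative_zero_on[of A xi "2 * r" Y] A_deriv A_2r off_bump(3) pos by auto

lemma A_nonpos: "A Y \<le> 0"
  using A_mono[of Y "2 * r"] A_2r A_0[of Y] by (cases "Y \<le> 2 * r") auto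

lemma A_ge: "- (4 * r * Xi) \<le> A Y"
proof -
  obtain z where "A (2 * r) - A (- 2 * r) = (2 * r - (- 2 * r)) * xi z"
    using MVT2[of "- 2 * r" "2 * r" A xi] A_deriv pos by auto
  then have "- A (- 2 * r) = 4 * r * xi z" using A_2r by simp
  also have "\<dots> \<le> 4 * r * Xi" using xi_bounds[of z] pos by simp
  finally have *: "- (4 * r * Xi) \<le> A (- 2 * r)" by simp
  show ?thesis
  proof (cases "- 2 * r \<le> Y")
    case True
    then show ?thesis using A_mono[of "- 2 * r" Y] * by simp
  next
    case False
    then have "A Y = A (- 2 * r)"
      by (intro eq_of_derivative_zero_on[OF A_deriv]) (auto intro!: off_bump(3))
    then show ?thesis using * by simp
  qed
qed

lemma W_facts: "0 \<le> W Y" "W Y \<le> 1" "0 \<le> W' Y" "W' Y \<le> K / t"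
  "Y \<ge> - 2 * r \<Longrightarrow> W Y = 1" "Y \<ge> - 2 * r \<Longrightarrow> W' Y = 0"
  "Y \<le> - 2 * r - t \<Longrightarrow> W Y = 0" "Y \<le> - 2 * r - t \<Longrightarrow> W' Y = 0"
proof -
  show "0 \<le> W Y" "W Y \<le> 1" "0 \<le> W' Y" "W' Y \<le> K / t"
    unfolding W_def W'_def using S_nonneg S_le_1 S'_nonneg S'_le pos by (auto simp: divide_right_mono)
  show "W Y = 1" "W' Y = 0" if "Y \<ge> - 2 * r"
    using that pos S_1[of "1 + (Y + 2 * r) / t"] S'_0[of "1 + (Y + 2 * r) / t"] by (auto simp: W_def W'_def)
  show "W Y = 0" "W' Y = 0" if "Y \<le> - 2 * r - t"
  proof -
    have "1 + (Y + 2 * r) / t \<le> 0" using that pos by (simp add: field_simps)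
    then show "W Y = 0" "W' Y = 0" using S_0 S'_0 by (auto simp: W_def W'_def)
  qed
qed

lemma Z_facts: "0 \<le> Z y" "Z y \<le> 1" "\<bar>Z' y\<bar> \<le> K / t"
  "0 \<le> y \<Longrightarrow> y \<le> l + 2 * t \<Longrightarrow> Z y = 1" "0 \<le> y \<Longrightarrow> y \<le> l + 2 * t \<Longrightarrow> Z' y = 0"
  "y \<le> - t \<or> y \<ge> l + 3 * t \<Longrightarrow> Z y = 0" "y \<le> - t \<or> y \<ge> l + 3 * t \<Longrightarrow> Z' y = 0"
  "Z' y < 0 \<Longrightarrow> l + 2 * t \<le> y \<and> y \<le> l + 3 * t"
proof -
  have le: "(y - l - 2 * t) / t \<le> 1 + y / t" using pos by (simp add: field_simps)
  show "0 \<le> Z y" using S_mono[OF le] by (simp add: Z_def)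
  show "Z y \<le> 1" unfolding Z_def using S_le_1[of "1 + y / t"] S_nonneg[of "(y - l - 2 * t) / t"] by linarith
  have "\<bar>S' (1 + y / t) - S' ((y - l - 2 * t) / t)\<bar> \<le> K"
    using S'_nonneg[of "1 + y / t"] S'_nonneg[of "(y - l - 2 * t) / t"] S'_le[of "1 + y / t"] S'_le[of "(y - l - 2 * t) / t"]
    by linarith
  then show "\<bar>Z' y\<bar> \<le> K / t" unfolding Z'_def using pos by (simp add: divide_right_mono)
  show "Z y = 1" "Z' y = 0" if "0 \<le> y" "y \<le> l + 2 * t"
  proof -
    have "1 + y / t \<ge> 1" "(y - l - 2 * t) / t \<le> 0" using that pos by (auto simp: field_simps)
    then show "Z y = 1" "Z' y = 0" using S_0 S_1 S'_0 by (auto simp: Z_def Z'_def)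
  qed
  show "Z y = 0" "Z' y = 0" if "y \<le> - t \<or> y \<ge> l + 3 * t"
  proof -
    from that have "(1 + y / t \<le> 0 \<and> (y - l - 2 * t) / t \<le> 0) \<or> (1 + y / t \<ge> 1 \<and> (y - l - 2 * t) / t \<ge> 1)"
      using pos by (auto simp: field_simps)
    then show "Z y = 0" "Z' y = 0" using S_0 S_1 S'_0 by (auto simp: Z_def Z'_def)
  qed
  assume "Z' y < 0"
  then have "S' ((y - l - 2 * t) / t) \<noteq> 0" using S'_nonneg[of "1 + y / t"] pos by (auto simp: Z'_def divide_less_0_iff)
  then have "\<not> ((y - l - 2 * t) / t \<le> 0 \<or> (y - l - 2 * t) / t \<ge> 1)" using S'_0 by blast
  then show "l + 2 * t \<le> y \<and> y \<le> l + 3 * t" using pos by (auto simp: field_simps)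
qed

lemma U_facts: "0 \<le> U y" "l + 2 * t \<le> y \<Longrightarrow> y \<le> l + 3 * t \<Longrightarrow> U y = 1"
  "y \<le> l + 3 * t / 2 \<or> y \<ge> l + 4 * t \<Longrightarrow> U y = 0"
proof -
  show "0 \<le> U y" by (simp add: U_def S_nonneg)
  show "U y = 1" if "l + 2 * t \<le> y" "y \<le> l + 3 * t"
    using that pos S_1[of "(y - l - 3 * t / 2) * 2 / t"] S_1[of "(l + 7 * t / 2 - y) * 2 / t"]
    by (simp add: U_def field_simps)
  show "U y = 0" if "y \<le> l + 3 * t / 2 \<or> y \<ge> l + 4 * t"
  proof -
    have "(y - l - 3 * t / 2) * 2 / t \<le> 0 \<or> (l + 7 * t / 2 - y) * 2 / t \<le> 0"
      using that pos by (auto simp: divide_le_0_iff)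
    then show ?thesis using S_0 by (auto simp: U_def)
  qed
qed

lemma V_facts: "0 \<le> V Y" "- 2 * r - t \<le> Y \<Longrightarrow> Y \<le> 2 * r \<Longrightarrow> V Y = 1"
  "Y \<ge> 3 * r \<or> Y \<le> - 2 * r - 2 * t \<Longrightarrow> V Y = 0"
proof -
  show "0 \<le> V Y" by (simp add: V_def S_nonneg)
  show "V Y = 1" if "- 2 * r - t \<le> Y" "Y \<le> 2 * r"
    using that pos S_1[of "3 - Y / r"] S_1[of "(Y + 2 * r + 2 * t) / t"]
    by (simp add: V_def field_simps)
  show "V Y = 0" if "Y \<ge> 3 * r \<or> Y \<le> - 2 * r - 2 * t"
  proof -
    have "3 - Y / r \<le> 0 \<or> (Y + 2 * r + 2 * t) / t \<le> 0"
      using that pos by (auto simp: field_simps)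
    then show ?thesis using S_0 by (auto simp: V_def)
  qed
qed

lemma psi_nonneg: "0 \<le> psi x y"
  unfolding psi_def using Z_facts(1) psi0_bounds(1) V_facts(1) U_facts(1) by simp

text \<open>
  Both sides are the distance of a function from a line that touches it, once at \<open>p\<close> before and once at
  \<open>slope Y\<close> after adding \<open>psi0 Y * (s - c)\<close> and \<open>xi Y * (s - B)\<close>.
\<close>
lemma tangent_identity: "D p s + psi0 Y * (s - c) - xi Y * (s - B) = D (slope Y) s"
proof -
  have "psi0 Y * (B - c) = E B (slope Y) - E B p" using cB by (simp add: psi0_def)
  then have *: "psi0 Y * c = psi0 Y * B - (E B (slope Y) - E B p)" by (simp add: algebra_simps)
  have "D p s + psi0 Y * (s - c) - xi Y * (s - B) = D p s - psi0 Y * c + psi0 Y * B - (w' (slope Y) - w' p) * (s - B)"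
    unfolding xi_def by (simp add: algebra_simps)
  then show ?thesis unfolding * E_def bregman_def by (simp add: algebra_simps)
qed

lemma tangent_identity': "D p s + Psi * (s - c) - Xi * (s - B) = D p' s"
  using tangent_identity[of s 0] on_bump[of 0] pos by simp

lemma small': "4 * r * Xi * (K / t) \<le> m / 2" "4 * r * Xi * (K / t) \<le> 1 / 2"
proof -
  have s: "8 * r * Xi * K \<le> t * min m 1"
    using small by (simp add: Xi_def Psi_def add_diff_eq)
  have "t * min m 1 \<le> t * m" "t * min m 1 \<le> t * 1" using pos by (auto intro: mult_left_mono)
  then have "8 * r * Xi * K \<le> t * m" "8 * r * Xi * K \<le> t" using s by auto
  then show "4 * r * Xi * (K / t) \<le> m / 2" "4 * r * Xi * (K / t) \<le> 1 / 2"
    using pos by (auto simp: field_simps)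
qed

lemma A_times_bound:
  assumes "\<bar>g\<bar> \<le> K / t" shows "\<bar>A Y * g\<bar> \<le> m / 2" "\<bar>A Y * g\<bar> \<le> 1 / 2"
proof -
  have "\<bar>A Y\<bar> \<le> 4 * r * Xi" using A_ge[of Y] A_nonpos[of Y] by simp
  then have "\<bar>A Y\<bar> * \<bar>g\<bar> \<le> 4 * r * Xi * (K / t)"
    using assms by (intro mult_mono) auto
  then show "\<bar>A Y * g\<bar> \<le> m / 2" "\<bar>A Y * g\<bar> \<le> 1 / 2" using small' by (auto simp: abs_mult)
qed

text \<open>
  Without cut-offs this is \<open>tangent_identity\<close> and \<open>h_ge\<close>; multiplication by \<open>Z\<close> preserves the
  inequality because it also holds for \<open>psi = 0\<close>.  The derivatives of the cut-offs contribute terms of relative size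
  \<open>r / t\<close>.  For \<open>s \<le> B\<close> they are absorbed by \<open>D p s\<close>.  For \<open>s > B\<close> the term with \<open>W'\<close> has the right sign, and
  so has the term with \<open>Z'\<close> at the lower end; at the upper end \<open>V * U\<close> dominates it.
\<close>
theorem gain_nonneg: "0 \<le> D p s + gain x y s"
proof -
  define Y where "Y = y - B * x"
  have g: "grad x y s = xi Y * W Y * Z y * (s - B) + A Y * W' Y * Z y * (s - B) + A Y * W Y * Z' y * s"
    unfolding grad_def Y_def by (simp add: algebra_simps)
  have aW': "\<bar>A Y * (W' Y * Z y)\<bar> \<le> m / 2"
  proof (rule A_times_bound)
    have "W' Y * Z y \<le> K / t * 1" using W_facts(3,4) Z_facts(1,2) by (intro mult_mono) (auto intro: order.trans)
    then show "\<bar>W' Y * Z y\<bar> \<le> K / t" using W_facts(3) Z_facts(1) by simp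
  qed
  have wz: "\<bar>W Y * Z' y\<bar> \<le> K / t"
  proof -
    have "\<bar>W Y\<bar> * \<bar>Z' y\<bar> \<le> 1 * (K / t)" using W_facts(1,2)[of Y] Z_facts(3)[of y] by (intro mult_mono) auto
    then show ?thesis by (simp add: abs_mult)
  qed
  note aZ = A_times_bound(1)[OF wz, of Y] and aZ1 = A_times_bound(2)[OF wz, of Y]
  show ?thesis
  proof (cases "s \<le> B")
    case True
    have "xi Y * W Y * Z y * (s - B) \<le> 0"
      using True xi_bounds(1)[of Y] W_facts(1)[of Y] Z_facts(1)[of y] by (intro mult_nonneg_nonpos) auto
    moreover have "A Y * W' Y * Z y * (s - B) \<le> m / 2 * (\<bar>s\<bar> + B)"
    proof -
      have "A Y * W' Y * Z y * (s - B) \<le> \<bar>A Y * (W' Y * Z y)\<bar> * \<bar>s - B\<bar>"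
        by (metis abs_ge_self abs_mult mult.assoc)
      also have "\<dots> \<le> m / 2 * (\<bar>s\<bar> + B)" using aW' B m by (intro mult_mono) auto
      finally show ?thesis .
    qed
    moreover have "A Y * W Y * Z' y * s \<le> m / 2 * (\<bar>s\<bar> + B)"
    proof -
      have "A Y * W Y * Z' y * s \<le> \<bar>A Y * (W Y * Z' y)\<bar> * \<bar>s\<bar>"
        by (metis abs_ge_self abs_mult mult.assoc)
      also have "\<dots> \<le> m / 2 * (\<bar>s\<bar> + B)" using aZ B m by (intro mult_mono) auto
      finally show ?thesis .
    qed
    moreover have "m / 2 * (\<bar>s\<bar> + B) + m / 2 * (\<bar>s\<bar> + B) \<le> D p s" using m(2)[OF True] by simp
    moreover have "0 \<le> psi x y * h s" using psi_nonneg h_nonneg by simp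
    ultimately show ?thesis unfolding gain_def g by linarith
  next
    case False
    then have s: "B < s" by simp
    have "A Y * W' Y * Z y * (s - B) \<le> 0"
      using s A_nonpos[of Y] W_facts(3)[of Y] Z_facts(1)[of y] by (intro mult_nonpos_nonneg mult_nonneg_nonneg) auto
    moreover have "xi Y * W Y * Z y * (s - B) \<le> D p s + Z y * psi0 Y * h s"
    proof -
      have "xi Y * W Y * (Z y * (s - B)) \<le> xi Y * 1 * (Z y * (s - B))"
        using xi_bounds(1)[of Y] W_facts(2)[of Y] Z_facts(1)[of y] s by (intro mult_right_mono mult_left_mono) auto
      then have "xi Y * W Y * Z y * (s - B) \<le> Z y * (xi Y * (s - B))" by (simp add: algebra_simps)
      also have "\<dots> \<le> Z y * (D p s + psi0 Y * h s)"
      proof (rule mult_left_mono)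
        have "psi0 Y * (s - c) \<le> psi0 Y * h s" using psi0_bounds(1) h_ge by (rule mult_left_mono[rotated])
        then show "xi Y * (s - B) \<le> D p s + psi0 Y * h s"
          using tangent_identity[of s Y] D_nonneg[of "slope Y" s] by linarith
      qed (rule Z_facts(1))
      also have "\<dots> = Z y * D p s + Z y * psi0 Y * h s" by (simp add: algebra_simps)
      also have "Z y * D p s \<le> 1 * D p s" using Z_facts(2) D_nonneg by (rule mult_right_mono)
      finally show ?thesis by simp
    qed
    moreover have "A Y * W Y * Z' y * s \<le> V Y * U y * h s"
    proof (cases "A Y * W Y * Z' y \<le> 0")
      case True
      then have "A Y * W Y * Z' y * s \<le> 0" by (rule mult_nonpos_nonneg) (use s B in linarith)
      moreover have "0 \<le> V Y * U y * h s" using V_facts(1) U_facts(1) h_nonneg by simp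
      ultimately show ?thesis by linarith
    next
      case False
      have "A Y * W Y \<le> 0" using A_nonpos W_facts(1) by (rule mult_nonpos_nonneg)
      then have Zn: "Z' y < 0" using False by (metis mult_nonpos_nonneg not_less)
      have "A Y \<noteq> 0" "W Y \<noteq> 0" using False by auto
      then have "Y < 2 * r" "- 2 * r - t < Y" using A_0[of Y] W_facts(7)[of Y] by force+
      then have "V Y = 1" using V_facts(2) by simp
      moreover have "U y = 1" using Z_facts(8)[OF Zn] U_facts(2) by simp
      moreover have "A Y * W Y * Z' y * s \<le> 1 / 2 * s"
        by (rule mult_right_mono) (use aZ1 s B in \<open>auto simp: mult.assoc\<close>)
      moreover have "1 / 2 * s \<le> s - c" using s B by simp
      ultimately show ?thesis using h_ge[of s] by simp
    qed
    ultimately show ?thesis unfolding gain_def g psi_def Y_def[symmetric] distrib_right by linarith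
  qed
qed

lemma grad_core:
  assumes "0 \<le> y" "y \<le> l + 2 * t" "- 2 * r \<le> y - B * x"
  shows "grad x y s = xi (y - B * x) * (s - B)"
  unfolding grad_def using Z_facts(4,5)[of y] W_facts(5,6)[of "y - B * x"] assms by simp

lemma psi_core:
  assumes "0 \<le> y" "y \<le> l + 3 * t / 2"
  shows "psi x y = psi0 (y - B * x)"
  unfolding psi_def using Z_facts(4)[of y] U_facts(3)[of y] assms pos by simp

lemma inner_grad:
  assumes "0 \<le> y" "y \<le> l + t" "\<bar>y - B * x\<bar> \<le> r"
  shows "grad x y s = Xi * (s - B)"
  using grad_core[of y x s] on_bump(3)[of "y - B * x"] assms pos by auto

text \<open>
  In the core the difference of Lagrangian and differential of the potential does not depend on the
  point and is at least the Bregman distance at \<open>p'\<close>: a thinner strip placed there meets the same situation as this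
  strip did, with \<open>p'\<close> in place of \<open>p\<close>.
\<close>
lemma inner_gain:
  assumes "0 \<le> y" "y \<le> l + t" "\<bar>y - B * x\<bar> \<le> r"
  shows "D p' s \<le> D p s + gain x y s" "c + 1 \<le> s \<Longrightarrow> D p s + gain x y s = D p' s"
proof -
  have g: "gain x y s = Psi * h s - Xi * (s - B)"
    unfolding gain_def inner_grad[OF assms] using psi_core[of y x] on_bump(2)[of "y - B * x"] assms pos by simp
  have "Psi * (s - c) \<le> Psi * h s" using Psi_nonneg h_ge by (rule mult_left_mono[rotated])
  then show "D p' s \<le> D p s + gain x y s" using tangent_identity'[of s] g by linarith
  show "D p s + gain x y s = D p' s" if "c + 1 \<le> s"
    using tangent_identity'[of s] g[unfolded h_eq[OF that]] by linarith
qed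

text \<open>
  The tracks run where the line touches, which turns the calibration inequality into an equality.
\<close>
lemma transition_gain:
  assumes "0 \<le> y" "y \<le> l + 3 * t / 2" "- r \<le> y - B * x" "s = slope (y - B * x)"
  shows "D p s + gain x y s = 0"
proof -
  have "c + 1 \<le> s" using assms slope_bounds p by (meson order_trans)
  then have "gain x y s = psi0 (y - B * x) * (s - c) - xi (y - B * x) * (s - B)"
    unfolding gain_def using psi_core[of y x] grad_core[of y x s] h_eq[of s] assms pos by auto
  then show ?thesis using tangent_identity[of s "y - B * x"] D_self[of s] assms(4) by simp
qed

definition outside where "outside x y \<longleftrightarrow> y \<le> - t \<or> l + 4 * t \<le> y \<or> 3 * r \<le> y - B * x \<or> y - B * x \<le> - 2 * r - 2 * t"

lemma outside_zero:
  assumes "outside x y"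
  shows "psi x y = 0" "grad x y s = 0" "gain x y s = 0" "delta x y = 0"
proof -
  consider "y \<le> - t" | "l + 4 * t \<le> y" | "3 * r \<le> y - B * x" | "y - B * x \<le> - 2 * r - 2 * t"
    using assms unfolding outside_def by blast
  then have "psi x y = 0 \<and> grad x y s = 0 \<and> delta x y = 0"
  proof cases
    case 1
    then show ?thesis using Z_facts(6,7)[of y] U_facts(3)[of y] pos by (simp add: psi_def grad_def delta_def)
  next
    case 2
    then show ?thesis using Z_facts(6,7)[of y] U_facts(3)[of y] pos by (simp add: psi_def grad_def delta_def)
  next
    case 3
    then show ?thesis
      using off_bump[of "y - B * x"] V_facts(3)[of "y - B * x"] A_0[of "y - B * x"] pos
      by (simp add: psi_def grad_def delta_def)
  next
    case 4
    then show ?thesis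
      using off_bump[of "y - B * x"] V_facts(3)[of "y - B * x"] W_facts(7,8)[of "y - B * x"] pos
      by (simp add: psi_def grad_def delta_def)
  qed
  then show "psi x y = 0" "grad x y s = 0" "gain x y s = 0" "delta x y = 0" by (auto simp: gain_def)
qed

lemma inner_delta_increment:
  assumes "0 \<le> y" "y \<le> l + t" "\<bar>y - B * x\<bar> \<le> r" "0 \<le> y'" "y' \<le> l + t" "\<bar>y' - B * x'\<bar> \<le> r"
  shows "delta x' y' - delta x y = Xi * ((y' - y) - B * (x' - x))"
proof -
  have "A Y' - A Y = Xi * (Y' - Y)" if "\<bar>Y\<bar> \<le> r" "\<bar>Y'\<bar> \<le> r" "Y \<le> Y'" for Y Y'
  proof (cases "Y = Y'")
    case False
    with that have "Y < Y'" by simp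
    then obtain z where "Y < z" "z < Y'" "A Y' - A Y = (Y' - Y) * xi z"
      using MVT2[of Y Y' A xi] A_deriv by auto
    then show ?thesis using on_bump(3)[of z] that by simp
  qed simp
  then have inc: "A Y' - A Y = Xi * (Y' - Y)" if "\<bar>Y\<bar> \<le> r" "\<bar>Y'\<bar> \<le> r" for Y Y'
    using that by (cases "Y \<le> Y'") (force simp: algebra_simps)+
  have "delta x y = A (y - B * x)" "delta x' y' = A (y' - B * x')"
    using Z_facts(4)[of y] Z_facts(4)[of y'] W_facts(5)[of "y - B * x"] W_facts(5)[of "y' - B * x'"] assms pos
    by (auto simp: delta_def)
  moreover have "Xi * ((y' - B * x') - (y - B * x)) = Xi * ((y' - y) - B * (x' - x))"
    by (simp add: algebra_simps)
  ultimately show ?thesis using inc[OF assms(3,6)] by simp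
qed

lemma smooth_psi:
  fixes f g :: "'a::euclidean_space \<Rightarrow> real"
  assumes "smooth f" "smooth g" shows "smooth (\<lambda>z. psi (f z) (g z))"
  unfolding psi_def Z_def U_def V_def
  by (intro smooth_intros smooth_compose[OF S_smooth] smooth_compose[OF smooth_psi0] assms)

lemma W_deriv: "(W has_real_derivative W' Y) (at Y)"
proof -
  have "((\<lambda>Y. 1 + (Y + 2 * r) / t) has_real_derivative 1 / t) (at Y)"
    using pos by (auto intro!: derivative_eq_intros)
  from DERIV_chain2[OF S_deriv this] show ?thesis by (simp add: W_def[abs_def] W'_def)
qed

lemma Z_deriv: "(Z has_real_derivative Z' y) (at y)"
proof -
  have 1: "((\<lambda>y. 1 + y / t) has_real_derivative 1 / t) (at y)"
    using pos by (auto intro!: derivative_eq_intros)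
  have 2: "((\<lambda>y. (y - l - 2 * t) / t) has_real_derivative 1 / t) (at y)"
    using pos by (auto intro!: derivative_eq_intros)
  from DERIV_diff[OF DERIV_chain2[OF S_deriv 1] DERIV_chain2[OF S_deriv 2]]
  show ?thesis by (simp add: Z_def[abs_def] Z'_def diff_divide_distrib)
qed

text \<open>
  The potential is a product of functions of \<open>Y\<close> and of \<open>y\<close>, so one-variable chain rules suffice along a
  graph.
\<close>
lemma delta_along:
  assumes "(v has_real_derivative s) (at x)"
  shows "((\<lambda>x. delta (x - a) (v x - b)) has_real_derivative grad (x - a) (v x - b) s) (at x)"
proof -
  have Y: "((\<lambda>x. v x - b - B * (x - a)) has_real_derivative s - B) (at x)"
    using assms by (auto intro!: derivative_eq_intros)
  have y: "((\<lambda>x. v x - b) has_real_derivative s) (at x)"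
    using assms by (auto intro!: derivative_eq_intros)
  show ?thesis unfolding delta_def grad_def
    by (rule DERIV_cong[OF DERIV_mult[OF DERIV_mult[OF DERIV_chain2[OF A_deriv Y] DERIV_chain2[OF W_deriv Y]]
          DERIV_chain2[OF Z_deriv y]]]) (simp add: algebra_simps)
qed

lemma delta_AC:
  assumes "v \<in> AC x0 x1"
  shows "(\<lambda>x. delta (x - a) (v x - b)) \<in> AC x0 x1"
proof -
  have y: "(\<lambda>x. v x + (- b)) \<in> AC x0 x1" by (intro AC_add assms AC_const)
  have Y: "(\<lambda>x. v x + (- b) + (- B) * (x + (- a))) \<in> AC x0 x1"
    by (intro AC_add AC_cmult assms AC_const AC_ident)
  have c: "continuous_on UNIV W'" "continuous_on UNIV Z'"
    unfolding W'_def[abs_def] Z'_def[abs_def]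
    by (intro smooth_continuous smooth_intros smooth_compose[OF S'_smooth])+
  have "(\<lambda>x. A (v x + (- b) + (- B) * (x + (- a))) * W (v x + (- b) + (- B) * (x + (- a))) * Z (v x + (- b))) \<in> AC x0 x1"
    by (intro AC_mult AC_compose[OF Y A_deriv] AC_compose[OF Y W_deriv] AC_compose[OF y Z_deriv]
        c smooth_continuous[OF smooth_xi])
  then show ?thesis by (simp add: delta_def algebra_simps)
qed

end

section \<open>The staircase\<close>

text \<open>
  At level \<open>n\<close> the segments have slope \<open>Bs n\<close>, and the tracks have slope \<open>ps n\<close> outside the strips, steep
  enough to leave the staircase behind them.  The terms of level \<open>n\<close> in \<open>F\<close> vanish for slopes below
  \<open>cs n - 1\<close>; as \<open>cs n\<close> tends to infinity, \<open>F\<close> is smooth in spite of the accumulation of strips.  The relative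
  cut-off heights \<open>eps n\<close> are summable, which keeps the total length positive.
\<close>
definition Bs :: "nat \<Rightarrow> real" where "Bs n = 4 ^ (n + 1)"
definition ps :: "nat \<Rightarrow> real" where "ps n = 2 * Bs n"
definition cs :: "nat \<Rightarrow> real" where "cs n = Bs n / 2"
definition eps :: "nat \<Rightarrow> real" where "eps n = 1 / (5 * 2 ^ (n + 1))"

lemma Bs_facts: "4 \<le> Bs n" "Bs (Suc n) = 4 * Bs n"
proof -
  show "4 \<le> Bs n" unfolding Bs_def using one_le_power[of "4::real" n] by simp
qed (simp add: Bs_def)

lemma eps_facts: "0 < eps n" "eps n \<le> 1 / 10"
  using one_le_power[of "2::real" n] by (auto simp: eps_def field_simps)

text \<open>
  The free parameters: \<open>kap n\<close> is the half-width of the core of a strip of level \<open>n\<close> relative to its height, and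
  \<open>N n\<close> is the number of strips of level \<open>n + 1\<close> inside it.
\<close>
locale construction = smooth_step S S' K + energy w w'
  for S S' :: "real \<Rightarrow> real" and K and w w' :: "real \<Rightarrow> real" +
  fixes h :: "real \<Rightarrow> real" and k0 :: real and ms kap :: "nat \<Rightarrow> real" and N :: "nat \<Rightarrow> nat"
  assumes h_smooth: "smooth h" and h_convex: "convex_on UNIV h"
    and k0: "0 \<le> k0" "k0 \<le> 1"
    and h_0: "\<And>t. t \<le> 0 \<Longrightarrow> h t = 0" and h_1: "\<And>t. t \<ge> 1 \<Longrightarrow> h t = t - k0"
    and h_nonneg: "\<And>t. 0 \<le> h t" and h_ge: "\<And>t. t - k0 \<le> h t"
    and ms: "\<And>n. 0 < ms n" "\<And>n s. s \<le> Bs n \<Longrightarrow> ms n * (\<bar>s\<bar> + Bs n) \<le> D (ps n) s"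
    and kap: "\<And>n. 0 < kap n" "\<And>n. 10 * kap n \<le> eps n"
    and kap_small: "\<And>n. 8 * kap n * ((E (Bs n) (ps (Suc n)) - E (Bs n) (ps n)) / (Bs n - cs n)
                      + w' (ps (Suc n)) - w' (ps n)) * K \<le> eps n * min (ms n) 1"
    and N: "\<And>n. 32 \<le> real (N n) * kap n"
begin

text \<open>
  For strips of level \<open>n\<close>: the height \<open>ls\<close>, the cut-off height \<open>ts\<close>, the half-width \<open>rs\<close> of the core, and the
  height \<open>us\<close> of the slot reserved for a child.
\<close>
primrec ls :: "nat \<Rightarrow> real" where
  "ls 0 = 1" | "ls (Suc n) = ls n / (real (N n) * (1 + 5 * eps (Suc n)))"
definition ts where "ts n = eps n * ls n"
definition rs where "rs n = kap n * ls n"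
definition us where "us n = ls n / real (N n)"

lemma N_pos: "0 < N n" using N[of n] kap(1)[of n] by (cases "N n") auto

lemma ls_pos: "0 < ls n"
proof (induction n)
  case (Suc n)
  then show ?case using N_pos[of n] eps_facts(1)[of "Suc n"] by simp
qed simp

lemmas ls_Suc = ls.simps(2)
declare ls_Suc [simp del]

lemma ts_pos: "0 < ts n" using ls_pos eps_facts by (simp add: ts_def)
lemma rs_pos: "0 < rs n" using ls_pos kap by (simp add: rs_def)
lemma us_pos: "0 < us n" using ls_pos N_pos by (simp add: us_def)

lemma rs_le_ts: "10 * rs n \<le> ts n"
  using mult_right_mono[OF kap(2)[of n] less_imp_le[OF ls_pos[of n]]] by (simp add: rs_def ts_def)
lemma ts_le_ls: "10 * ts n \<le> ls n"
  using mult_right_mono[OF eps_facts(2)[of n] less_imp_le[OF ls_pos[of n]]] by (simp add: ts_def)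
lemma us_eq: "us n = ls (Suc n) + 5 * ts (Suc n)"
proof -
  have "1 + 5 * eps (Suc n) \<noteq> 0" using eps_facts(1)[of "Suc n"] by simp
  then have "ls (Suc n) * (1 + 5 * eps (Suc n)) = us n" by (simp add: ls_Suc us_def)
  then show ?thesis by (simp add: ts_def algebra_simps)
qed
lemma N_us: "real (N n) * us n = ls n" using N_pos by (simp add: us_def)
lemma us_le_rs: "32 * us n \<le> rs n"
proof -
  have "32 * us n \<le> real (N n) * kap n * us n" using N us_pos by (intro mult_right_mono) (auto simp: less_imp_le)
  also have "\<dots> = kap n * ls n" using N_us[of n] by (simp add: algebra_simps)
  finally show ?thesis by (simp add: rs_def)
qed

lemma ls_Suc_le: "320 * ls (Suc n) \<le> ls n"
  using us_eq[of n] us_le_rs[of n] rs_le_ts[of n] ts_le_ls[of n] ts_pos[of "Suc n"] ls_pos[of "Suc n"] ls_pos[of n] by linarith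

lemma ls_tendsto_0: "ls \<longlonglongrightarrow> 0"
proof (rule tendsto_sandwich[OF _ _ tendsto_const LIMSEQ_power_zero[of "1/320 :: real"]])
  have "ls n \<le> (1/320) ^ n" for n
  proof (induction n)
    case (Suc n)
    then show ?case using ls_Suc_le[of n] by simp
  qed simp
  then show "\<forall>\<^sub>F n in sequentially. ls n \<le> (1/320) ^ n" by simp
qed (auto simp: less_imp_le ls_pos)

lemma rs_Suc_le: "rs (Suc n) \<le> rs n"
  using rs_le_ts[of "Suc n"] us_eq[of n] us_le_rs[of n] ls_pos[of "Suc n"] rs_pos[of n] rs_pos[of "Suc n"] ts_pos[of "Suc n"]
  by linarith

definition hs where "hs n s = h (s - cs n + k0)"

sublocale lev: level S S' K w w' "hs n" "Bs n" "cs n" "ps n" "ps (Suc n)" "ls n" "ts n" "rs n" "ms n" for n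
proof
  have B4: "4 \<le> Bs n" by (rule Bs_facts)
  show "0 \<le> hs n s" for s by (simp add: hs_def h_nonneg)
  show "s - cs n \<le> hs n s" for s using h_ge[of "s - cs n + k0"] by (simp add: hs_def)
  show "hs n s = s - cs n" if "cs n + 1 \<le> s" for s using h_1[of "s - cs n + k0"] that k0 by (simp add: hs_def)
  show "0 < Bs n" "2 * cs n \<le> Bs n" "0 \<le> cs n" "2 * Bs n \<le> ps n" "cs n + 1 \<le> ps n" "ps n \<le> ps (Suc n)"
    using B4 Bs_facts(2)[of n] by (auto simp: cs_def ps_def)
  show "0 < ls n" "0 < ts n" "0 < rs n" "10 * rs n \<le> ts n" by (fact ls_pos ts_pos rs_pos rs_le_ts)+
  show "0 < ms n" "\<And>s. s \<le> Bs n \<Longrightarrow> ms n * (\<bar>s\<bar> + Bs n) \<le> D (ps n) s" by (fact ms)+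
  have "8 * kap n * ((E (Bs n) (ps (Suc n)) - E (Bs n) (ps n)) / (Bs n - cs n) + w' (ps (Suc n)) - w' (ps n)) * K * ls n
      \<le> eps n * min (ms n) 1 * ls n"
    using kap_small ls_pos by (intro mult_right_mono) (auto simp: less_imp_le)
  then show "8 * rs n * ((E (Bs n) (ps (Suc n)) - E (Bs n) (ps n)) / (Bs n - cs n) + w' (ps (Suc n)) - w' (ps n)) * K
      \<le> ts n * min (ms n) 1"
    by (simp add: rs_def ts_def mult.assoc mult.left_commute mult.commute)
qed

text \<open>
  A strip is located by its anchor, the lower end of its segment.  The children are lined up along the
  segment of the parent, and each starts a cut-off height above the lower end of its slot, so that the
  supports of different strips of a level have disjoint ranges of \<open>y\<close>.
\<close>
definition child where "child n a i = (fst a + real i * us n / Bs n, snd a + real i * us n + ts (Suc n))"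

primrec anchors :: "nat \<Rightarrow> (real \<times> real) set" where
  "anchors 0 = {(0, 0)}"
| "anchors (Suc n) = (\<Union>a\<in>anchors n. child n a ` {..<N n})"

text \<open>
  The strip at anchor \<open>a\<close>: height above the segment, complement of the support, core, and the part of the
  core next to the segment itself.
\<close>
definition Yr where "Yr n a x y = (y - snd a) - Bs n * (x - fst a)"
definition out where "out n a x y \<longleftrightarrow> lev.outside n (x - fst a) (y - snd a)"
definition inn where "inn n a x y \<longleftrightarrow> 0 \<le> y - snd a \<and> y - snd a \<le> ls n + ts n \<and> \<bar>Yr n a x y\<bar> \<le> rs n"
definition cell where "cell n a = {z. 0 \<le> snd z - snd a \<and> snd z - snd a \<le> ls n \<and> \<bar>Yr n a (fst z) (snd z)\<bar> \<le> rs n}"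
definition cells where "cells n = (\<Union>a\<in>anchors n. cell n a)"
definition Sing where "Sing = (\<Inter>n. cells n)"

lemma finite_anchors: "finite (anchors n)" by (induction n) auto

lemma not_outD:
  assumes "\<not> out n a x y"
  shows "- ts n < y - snd a" "y - snd a < ls n + 4 * ts n" "Yr n a x y < 3 * rs n" "- 2 * rs n - 2 * ts n < Yr n a x y"
  using assms by (auto simp: out_def lev.outside_def Yr_def)

lemma inn_not_out: "inn n a x y \<Longrightarrow> \<not> out n a x y"
  using ts_pos[of n] rs_pos[of n] by (auto simp: inn_def out_def lev.outside_def Yr_def)

lemma cell_inn: "(x, y) \<in> cell n a \<Longrightarrow> inn n a x y"
  using ts_pos[of n] by (auto simp: cell_def inn_def)

lemma child_range:
  assumes "i < N n"
  shows "snd a + ts (Suc n) \<le> snd (child n a i)" "snd (child n a i) - ts (Suc n) + us n \<le> snd a + ls n"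
proof -
  have "(real i + 1) * us n \<le> real (N n) * us n" using assms us_pos[of n] by (intro mult_right_mono) auto
  then show "snd (child n a i) - ts (Suc n) + us n \<le> snd a + ls n"
    unfolding N_us by (simp add: child_def algebra_simps)
qed (use us_pos[of n] in \<open>simp add: child_def\<close>)

lemma anchors_separated:
  assumes "a \<in> anchors n" "a' \<in> anchors n" "a \<noteq> a'"
  shows "snd a + ls n + 4 * ts n \<le> snd a' - ts n \<or> snd a' + ls n + 4 * ts n \<le> snd a - ts n"
  using assms
proof (induction n arbitrary: a a')
  case (Suc n)
  obtain b i where b: "b \<in> anchors n" "i < N n" "a = child n b i" using Suc.prems by auto
  obtain b' i' where b': "b' \<in> anchors n" "i' < N n" "a' = child n b' i'" using Suc.prems by auto
  show ?case
  proof (cases "b = b'")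
    case True
    then have "i \<noteq> i'" using Suc.prems b b' by auto
    then consider "i + 1 \<le> i'" | "i' + 1 \<le> i" by linarith
    then show ?thesis
    proof cases
      case 1
      then have "(real i + 1) * us n \<le> real i' * us n" using us_pos[of n] by (intro mult_right_mono) auto
      then show ?thesis using b b' True us_eq[of n] by (simp add: child_def algebra_simps)
    next
      case 2
      then have "(real i' + 1) * us n \<le> real i * us n" using us_pos[of n] by (intro mult_right_mono) auto
      then show ?thesis using b b' True us_eq[of n] by (simp add: child_def algebra_simps)
    qed
  next
    case False
    then have "snd b + ls n + 4 * ts n \<le> snd b' - ts n \<or> snd b' + ls n + 4 * ts n \<le> snd b - ts n"
      using Suc.IH b b' by blast
    then show ?thesis
      using child_range[OF b(2), of b] child_range[OF b'(2), of b'] us_eq[of n] ts_pos[of n] ts_pos[of "Suc n"] ls_pos[of n] b(3) b'(3)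
      by (auto simp del: child_def)
  qed
qed simp

lemma anchors_unique:
  assumes "a \<in> anchors n" "a' \<in> anchors n"
    "- ts n < y - snd a" "y - snd a < ls n + 4 * ts n" "- ts n < y - snd a'" "y - snd a' < ls n + 4 * ts n"
  shows "a = a'"
  using anchors_separated[OF assms(1,2)] assms(3-) by (cases "a = a'") auto

text \<open>
  The whole support of a child lies deep inside the core of its parent, where the contributions of all
  coarser levels are translation invariant.  This decouples the levels.
\<close>
lemma child_support:
  assumes "i < N n" "\<not> out (Suc n) (child n a i) x y"
  shows "0 \<le> y - snd a" "y - snd a \<le> ls n" "\<bar>Yr n a x y\<bar> \<le> rs n / 16"
proof -
  let ?a = "child n a i"
  note d = not_outD[OF assms(2)]
  show 1: "0 \<le> y - snd a" "y - snd a \<le> ls n"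
    using d(1,2) child_range[OF assms(1), of a] us_eq[of n] by auto
  define y' where "y' = y - snd ?a"
  define x' where "x' = x - fst ?a"
  have B: "Bs (Suc n) = 4 * Bs n" "Bs n > 0" using Bs_facts(1)[of n] Bs_facts(2)[of n] by auto
  have Y': "Yr (Suc n) ?a x y = y' - 4 * (Bs n * x')" unfolding Yr_def x'_def y'_def B by simp
  have y'b: "- ts (Suc n) < y'" "y' < us n - ts (Suc n)" using d(1,2) us_eq[of n] by (auto simp: y'_def)
  have "Yr n a x y = ts (Suc n) + y' - Bs n * x'"
    unfolding Yr_def x'_def y'_def child_def using B by (simp add: algebra_simps)
  moreover have "4 * (Bs n * x') \<le> us n - ts (Suc n) + 2 * rs (Suc n) + 2 * ts (Suc n)"
    "- ts (Suc n) - 3 * rs (Suc n) \<le> 4 * (Bs n * x')"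
    using d(3,4) Y' y'b by auto
  ultimately show "\<bar>Yr n a x y\<bar> \<le> rs n / 16"
    using y'b us_le_rs[of n] us_eq[of n] rs_le_ts[of "Suc n"] ts_le_ls[of "Suc n"] ts_pos[of "Suc n"] rs_pos[of "Suc n"]
    unfolding abs_le_iff by (intro conjI; linarith)
qed

lemma cells_Suc_subset: "cells (Suc n) \<subseteq> cells n"
proof
  fix z assume "z \<in> cells (Suc n)"
  then obtain a i where a: "a \<in> anchors n" "i < N n" "z \<in> cell (Suc n) (child n a i)" by (auto simp: cells_def)
  have "\<not> out (Suc n) (child n a i) (fst z) (snd z)" using a(3) by (intro inn_not_out cell_inn) simp
  from child_support[OF a(2) this] show "z \<in> cells n" using a(1) rs_pos[of n]
    by (auto simp: cells_def cell_def intro!: bexI[of _ a])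
qed

lemma closed_cell: "closed (cell n a)"
  unfolding cell_def Yr_def
  by (intro closed_Collect_conj closed_Collect_le continuous_intros)

lemma compact_cell: "compact (cell n a)"
proof -
  have B: "Bs n > 0" using Bs_facts(1)[of n] by simp
  have "cell n a \<subseteq> {fst a - rs n / Bs n..fst a + (ls n + rs n) / Bs n} \<times> {snd a..snd a + ls n}"
  proof
    fix z assume z: "z \<in> cell n a"
    then have "Bs n * (fst z - fst a) \<le> ls n + rs n" "- rs n \<le> Bs n * (fst z - fst a)"
      unfolding cell_def Yr_def by auto
    then have "fst z - fst a \<le> (ls n + rs n) / Bs n" "- rs n / Bs n \<le> fst z - fst a"
      using B by (auto simp: field_simps)
    then show "z \<in> {fst a - rs n / Bs n..fst a + (ls n + rs n) / Bs n} \<times> {snd a..snd a + ls n}"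
      using z by (auto simp: cell_def mem_Times_iff)
  qed
  moreover have "bounded ({fst a - rs n / Bs n..fst a + (ls n + rs n) / Bs n} \<times> {snd a..snd a + ls n})"
    by (intro bounded_Times) auto
  ultimately show ?thesis using closed_cell bounded_subset by (auto simp: compact_eq_bounded_closed)
qed

lemma compact_cells: "compact (cells n)"
  unfolding cells_def by (intro compact_UN finite_anchors) (rule compact_cell)

lemma compact_Sing: "compact Sing"
proof -
  have "Sing = cells 0 \<inter> Sing" unfolding Sing_def by blast
  moreover have "closed Sing" unfolding Sing_def
    by (intro closed_INT ballI compact_imp_closed compact_cells)
  ultimately show ?thesis using compact_Int_closed[OF compact_cells] by metis
qed

text \<open>
  At every level the anchor of a cell containing the point is unique, so these anchors form a
  descending branch.
\<close>
lemma branch_exists: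
  assumes "(x, y) \<in> Sing"
  obtains a where "\<And>n. a n \<in> anchors n" "\<And>n. (x, y) \<in> cell n (a n)"
    "\<And>n. \<exists>i<N n. a (Suc n) = child n (a n) i" "\<And>n. \<bar>Yr n (a n) x y\<bar> \<le> rs n / 16"
proof -
  have "\<forall>n. \<exists>a. a \<in> anchors n \<and> (x, y) \<in> cell n a" using assms unfolding Sing_def cells_def by blast
  then obtain a where a: "\<And>n. a n \<in> anchors n" "\<And>n. (x, y) \<in> cell n (a n)" by metis
  have ch: "\<exists>i<N n. a (Suc n) = child n (a n) i \<and> \<bar>Yr n (a n) x y\<bar> \<le> rs n / 16" for n
  proof -
    obtain b i where b: "b \<in> anchors n" "i < N n" "a (Suc n) = child n b i" using a(1)[of "Suc n"] by auto
    have "\<not> out (Suc n) (child n b i) x y" using a(2)[of "Suc n"] b(3) by (intro inn_not_out cell_inn) simp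
    note cs = child_support[OF b(2) this]
    have "b = a n"
      using cs(1,2) a(2)[of n] ts_pos[of n] by (intro anchors_unique[OF b(1) a(1), of y]) (auto simp: cell_def)
    then show ?thesis using b cs(3) by blast
  qed
  show ?thesis by (rule that[of a]) (use a ch in blast)+
qed

end

section \<open>Rectifiability and length of the staircase\<close>

text \<open>
  Projecting a cover to the second coordinate does not increase diameters.
\<close>
lemma linear_measure_ge_projection:
  fixes S :: "(real \<times> real) set"
  assumes T: "T \<in> sets lborel" "T \<subseteq> snd ` S"
  shows "emeasure lborel T \<le> linear_measure S"
proof -
  have "emeasure lborel T \<le> linear_premeasure 1 S"
    unfolding linear_premeasure_def
  proof (rule INF_greatest)
    fix A assume "A \<in> {A :: nat \<Rightarrow> (real \<times> real) set. S \<subseteq> (\<Union>i. A i) \<and> (\<forall>i. bounded (A i) \<and> diameter (A i) \<le> 1)}"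
    then have A: "S \<subseteq> (\<Union>i. A i)" "\<And>i. bounded (A i)" by auto
    have J: "\<exists>a b. snd ` A i \<subseteq> {a..b} \<and> a \<le> b \<and> b - a \<le> diameter (A i)" for i
    proof (cases "A i = {}")
      case True
      then show ?thesis by (intro exI[of _ 0]) (simp add: diameter_def)
    next
      case False
      have d: "x \<le> y + diameter (A i)" if "x \<in> snd ` A i" "y \<in> snd ` A i" for x y
      proof -
        obtain z z' where z: "z \<in> A i" "z' \<in> A i" "x = snd z" "y = snd z'" using \<open>x \<in> _\<close> \<open>y \<in> _\<close> by auto
        have "dist x y \<le> dist z z'" unfolding z by (rule dist_snd_le)
        also have "\<dots> \<le> diameter (A i)" by (rule diameter_bounded_bound[OF A(2) z(1,2)])
        finally show ?thesis by (simp add: dist_real_def)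
      qed
      have bd: "bdd_below (snd ` A i)" "bdd_above (snd ` A i)"
        using bounded_snd[OF A(2)[of i]] by (auto intro: bounded_imp_bdd_below bounded_imp_bdd_above)
      have ne: "snd ` A i \<noteq> {}" using False by simp
      have "Sup (snd ` A i) \<le> y + diameter (A i)" if "y \<in> snd ` A i" for y
        by (rule cSup_least[OF ne]) (rule d[OF _ that])
      then have "Sup (snd ` A i) - diameter (A i) \<le> Inf (snd ` A i)"
        by (intro cInf_greatest[OF ne]) (simp add: le_diff_eq diff_le_eq)
      moreover have "snd ` A i \<subseteq> {Inf (snd ` A i)..Sup (snd ` A i)}"
        by (intro subsetI) (simp add: cInf_lower[OF _ bd(1)] cSup_upper[OF _ bd(2)])
      moreover have "Inf (snd ` A i) \<le> Sup (snd ` A i)" using cInf_le_cSup[OF ne bd(2,1)] .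
      ultimately show ?thesis by (intro exI[of _ "Inf (snd ` A i)"] exI[of _ "Sup (snd ` A i)"]) auto
    qed
    then obtain a b where ab: "\<And>i. snd ` A i \<subseteq> {a i..b i}" "\<And>i. a i \<le> b i" "\<And>i. b i - a i \<le> diameter (A i)"
      by metis
    have "T \<subseteq> (\<Union>i. {a i..b i})"
    proof
      fix y assume "y \<in> T"
      then obtain z where z: "z \<in> S" "y = snd z" using T(2) by auto
      then obtain i where "z \<in> A i" using A(1) by auto
      then have "y \<in> {a i..b i}" using ab(1)[of i] z(2) by auto
      then show "y \<in> (\<Union>i. {a i..b i})" by blast
    qed
    then have "emeasure lborel T \<le> emeasure lborel (\<Union>i. {a i..b i})" by (intro emeasure_mono) auto
    also have "\<dots> \<le> (\<Sum>i. emeasure lborel {a i..b i})" by (intro emeasure_subadditive_countably) auto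
    also have "\<dots> \<le> (\<Sum>i. ennreal (diameter (A i)))"
      using ab by (intro suminf_le) (auto simp: ennreal_leI)
    finally show "emeasure lborel T \<le> (\<Sum>i. ennreal (diameter (A i)))" .
  qed
  also have "\<dots> \<le> linear_measure S" unfolding linear_measure_def by (rule SUP_upper) simp
  finally show ?thesis .
qed

lemma linear_measure_empty: "linear_measure ({} :: 'a::metric_space set) = 0"
proof -
  have "linear_premeasure d ({} :: 'a set) = 0" if "d > 0" for d
  proof -
    have "linear_premeasure d ({} :: 'a set) \<le> (\<Sum>i::nat. ennreal (diameter ({} :: 'a set)))"
      unfolding linear_premeasure_def
      by (rule INF_lower2[of "\<lambda>i. {}"]) (use that in \<open>auto simp: diameter_def\<close>)
    then show ?thesis by (simp add: diameter_def)
  qed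
  then show ?thesis unfolding linear_measure_def by (simp add: SUP_eq_const[of _ _ 0])
qed

text \<open>
  McShane's extension formula, applied to \<open>g\<close> as a function of \<open>t\<close>.
\<close>
lemma lipschitz_extension_along:
  fixes g t :: "'a \<Rightarrow> real"
  assumes S: "S \<noteq> {}" and l: "\<And>z z'. z \<in> S \<Longrightarrow> z' \<in> S \<Longrightarrow> \<bar>g z - g z'\<bar> \<le> \<bar>t z - t z'\<bar>"
  obtains G where "\<And>x y. \<bar>G x - G y\<bar> \<le> \<bar>x - y :: real\<bar>" "\<And>z. z \<in> S \<Longrightarrow> G (t z) = g z"
proof -
  define G where "G = (\<lambda>x. INF z\<in>S. g z + \<bar>x - t z\<bar>)"
  have bd: "bdd_below ((\<lambda>z. g z + \<bar>x - t z\<bar>) ` S)" for x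
  proof -
    obtain z0 where z0: "z0 \<in> S" using S by blast
    show ?thesis
    proof (rule bdd_belowI2[of _ "g z0 - \<bar>x - t z0\<bar>"])
      fix z assume "z \<in> S"
      then show "g z0 - \<bar>x - t z0\<bar> \<le> g z + \<bar>x - t z\<bar>" using l[OF z0, of z] by linarith
    qed
  qed
  have le: "G x \<le> G y + \<bar>x - y\<bar>" for x y
  proof -
    have "G x - \<bar>x - y\<bar> \<le> g z + \<bar>y - t z\<bar>" if "z \<in> S" for z
    proof -
      have "G x \<le> g z + \<bar>x - t z\<bar>" unfolding G_def by (rule cINF_lower[OF bd that])
      then show ?thesis by linarith
    qed
    then have "G x - \<bar>x - y\<bar> \<le> G y" unfolding G_def by (intro cINF_greatest[OF S])
    then show ?thesis by linarith
  qed
  show ?thesis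
  proof (rule that[of G])
    show "\<bar>G x - G y\<bar> \<le> \<bar>x - y\<bar>" for x y using le[of x y] le[of y x] by linarith
    fix z assume z: "z \<in> S"
    have "G (t z) \<le> g z" using cINF_lower[OF bd[of "t z"] z] unfolding G_def by simp
    moreover have "g z \<le> G (t z)" unfolding G_def
      by (rule cINF_greatest[OF S]) (use l[OF z] in force)
    ultimately show "G (t z) = g z" by simp
  qed
qed

text \<open>
  On a monotone set both coordinates are 1-Lipschitz functions of their sum.
\<close>
lemma monotone_set_rectifiable:
  fixes S :: "(real \<times> real) set"
  assumes mono: "\<And>z z'. z \<in> S \<Longrightarrow> z' \<in> S \<Longrightarrow> snd z \<le> snd z' \<Longrightarrow> fst z \<le> fst z'"
  shows "rectifiable S"
proof (cases "S = {}")
  case True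
  have "\<exists>C. C-lipschitz_on UNIV (\<lambda>x::real. (0::real, 0::real))"
    by (rule exI[of _ 0]) (auto intro!: lipschitz_onI)
  then show ?thesis unfolding rectifiable_def True
    by (intro exI[of _ "\<lambda>i x. (0, 0)"]) (auto simp: linear_measure_empty)
next
  case False
  let ?t = "\<lambda>z :: real \<times> real. fst z + snd z"
  have l: "\<bar>fst z - fst z'\<bar> \<le> \<bar>?t z - ?t z'\<bar>" "\<bar>snd z - snd z'\<bar> \<le> \<bar>?t z - ?t z'\<bar>"
    if "z \<in> S" "z' \<in> S" for z z'
    using mono[OF that] mono[OF that(2,1)] by (cases "snd z \<le> snd z'"; linarith)+
  obtain X where X: "\<And>x y. \<bar>X x - X y\<bar> \<le> \<bar>x - y :: real\<bar>" "\<And>z. z \<in> S \<Longrightarrow> X (?t z) = fst z"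
    using lipschitz_extension_along[of S fst ?t, OF False l(1)] by metis
  obtain Y where Y: "\<And>x y. \<bar>Y x - Y y\<bar> \<le> \<bar>x - y :: real\<bar>" "\<And>z. z \<in> S \<Longrightarrow> Y (?t z) = snd z"
    using lipschitz_extension_along[of S snd ?t, OF False l(2)] by metis
  define g where "g = (\<lambda>x. (X x, Y x))"
  have "2-lipschitz_on UNIV g"
  proof (rule lipschitz_onI)
    fix x y :: real
    have "dist (g x) (g y) \<le> dist (X x) (X y) + dist (Y x) (Y y)"
      unfolding g_def dist_prod_def using sqrt_sum_squares_le_sum[of "dist (X x) (X y)" "dist (Y x) (Y y)"] by simp
    then show "dist (g x) (g y) \<le> 2 * dist x y" using X(1)[of x y] Y(1)[of x y] by (simp add: dist_real_def)
  qed simp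
  moreover have "S - range g = {}"
  proof -
    have "S \<subseteq> range g"
    proof
      fix z assume "z \<in> S"
      then have "z = g (?t z)" using X(2) Y(2) by (simp add: g_def)
      then show "z \<in> range g" by blast
    qed
    then show ?thesis by blast
  qed
  then have "linear_measure (S - (\<Union>i::nat. range g)) = 0"
    by (metis SUP_const UNIV_not_empty linear_measure_empty)
  ultimately show ?thesis unfolding rectifiable_def by (intro exI[of _ "\<lambda>i. g"]) blast
qed

context construction begin

lemma cell_width:
  assumes "(x, y) \<in> cell n a"
  shows "Bs n * (x - fst a) \<le> ls n + rs n" "- rs n \<le> Bs n * (x - fst a)"
  using assms unfolding cell_def Yr_def by auto

text \<open>
  Siblings are ordered in both coordinates: their horizontal spacing \<open>us n / Bs n\<close> exceeds the width of a
  child because the slope of the children is four times larger.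
\<close>
lemma Sing_monotone:
  assumes "z \<in> Sing" "z' \<in> Sing" "snd z \<le> snd z'"
  shows "fst z \<le> fst z'"
proof -
  obtain x y x' y' where z: "z = (x, y)" "z' = (x', y')" by (metis prod.exhaust)
  obtain a where a: "\<And>n. a n \<in> anchors n" "\<And>n. (x, y) \<in> cell n (a n)"
    "\<And>n. \<exists>i<N n. a (Suc n) = child n (a n) i"
    using branch_exists assms(1) unfolding z by metis
  obtain a' where a': "\<And>n. a' n \<in> anchors n" "\<And>n. (x', y') \<in> cell n (a' n)"
    "\<And>n. \<exists>i<N n. a' (Suc n) = child n (a' n) i"
    using branch_exists assms(2) unfolding z by metis
  show ?thesis
  proof (cases "\<forall>n. a n = a' n")
    case True
    have "x - x' \<le> 3 * ls n" for n
    proof -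
      have "Bs n * (x - x') \<le> ls n + 2 * rs n"
        using cell_width(1)[OF a(2)[of n]] cell_width(2)[OF a'(2)[of n]] True by (simp add: algebra_simps)
      also have "\<dots> \<le> Bs n * (3 * ls n)"
        using rs_le_ts[of n] ts_le_ls[of n] ls_pos[of n] rs_pos[of n] Bs_facts(1)[of n]
          mult_right_mono[of 1 "Bs n" "3 * ls n"] by linarith
      finally show ?thesis using Bs_facts(1)[of n] by simp
    qed
    moreover have "(\<lambda>n. 3 * ls n) \<longlonglongrightarrow> 3 * 0" by (intro tendsto_intros ls_tendsto_0)
    ultimately have "x - x' \<le> 0" using LIMSEQ_le_const[of "\<lambda>n. 3 * ls n"] by fastforce
    then show ?thesis by (simp add: z)
  next
    case False
    define m where "m = (LEAST n. a n \<noteq> a' n)"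
    have m: "a m \<noteq> a' m" "\<And>k. k < m \<Longrightarrow> a k = a' k"
      using False LeastI_ex[of "\<lambda>n. a n \<noteq> a' n"] not_less_Least[of _ "\<lambda>n. a n \<noteq> a' n"] unfolding m_def by blast+
    have "m \<noteq> 0" using m(1) a(1)[of 0] a'(1)[of 0] by (metis anchors.simps(1) singletonD)
    then obtain n where n: "m = Suc n" by (cases m) auto
    obtain i i' where i: "i < N n" "a m = child n (a n) i" "i' < N n" "a' m = child n (a n) i'"
      using a(3)[of n] a'(3)[of n] m(2)[of n] n by auto
    have "i \<noteq> i'" using i m(1) by auto
    have y: "snd (a m) \<le> y" "y' \<le> snd (a' m) + ls m" using a(2)[of m] a'(2)[of m] by (auto simp: cell_def)
    have "i < i'"
    proof (rule ccontr)
      assume "\<not> i < i'"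
      then have "i' + 1 \<le> i" using \<open>i \<noteq> i'\<close> by simp
      then have "(real i' + 1) * us n \<le> real i * us n" using us_pos[of n] by (intro mult_right_mono) auto
      then have "snd (a' m) + us n \<le> snd (a m)" using i by (simp add: child_def algebra_simps)
      then show False using y us_eq[of n] ts_pos[of "Suc n"] assms(3) by (simp add: z n)
    qed
    then have "(real i + 1) * us n \<le> real i' * us n" using us_pos[of n] by (intro mult_right_mono) auto
    then have "(real i * us n + us n) / Bs n \<le> real i' * us n / Bs n"
      using Bs_facts(1)[of n] by (intro divide_right_mono) (auto simp: algebra_simps)
    then have "fst (a m) + us n / Bs n \<le> fst (a' m)" using i by (simp add: child_def add_divide_distrib)
    then have "Bs m * (fst (a m) + us n / Bs n) \<le> Bs m * fst (a' m)"
      using Bs_facts(1)[of m] by (intro mult_left_mono) auto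
    moreover have "Bs m * (fst (a m) + us n / Bs n) = Bs m * fst (a m) + 4 * us n"
      using Bs_facts[of n] unfolding n by (simp add: algebra_simps)
    moreover have "Bs m * (x - fst (a m)) \<le> ls m + rs m" "- rs m \<le> Bs m * (x' - fst (a' m))"
      using cell_width a(2) a'(2) by blast+
    ultimately have "Bs m * x \<le> Bs m * x'"
      using us_eq[of n] rs_le_ts[of m] ts_pos[of m] ls_pos[of m] unfolding n by (simp add: right_diff_distrib)
    then show ?thesis using Bs_facts(1)[of m] by (simp add: z)
  qed
qed

lemma rectifiable_Sing: "rectifiable Sing"
  by (rule monotone_set_rectifiable) (rule Sing_monotone)

definition shadow where "shadow n = (\<Union>a\<in>anchors n. {snd a..snd a + ls n})"

lemma shadow_decreasing: "decseq shadow"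
proof (rule decseq_SucI)
  fix n
  show "shadow (Suc n) \<subseteq> shadow n"
  proof
    fix y assume "y \<in> shadow (Suc n)"
    then obtain a i where a: "a \<in> anchors n" "i < N n" "y \<in> {snd (child n a i)..snd (child n a i) + ls (Suc n)}"
      by (auto simp: shadow_def)
    then have "y \<in> {snd a..snd a + ls n}"
      using child_range[OF a(2), of a] us_eq[of n] ts_pos[of "Suc n"] by auto
    then show "y \<in> shadow n" using a(1) by (auto simp: shadow_def)
  qed
qed

lemma shadow_subset: "(\<Inter>n. shadow n) \<subseteq> snd ` Sing"
proof
  fix y assume y: "y \<in> (\<Inter>n. shadow n)"
  define C where "C = (\<lambda>n. cells n \<inter> (UNIV \<times> {y}))"
  have "\<Inter>(range C) \<noteq> {}"
  proof (rule compact_nest)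
    fix n
    show "compact (C n)" unfolding C_def by (intro compact_Int_closed compact_cells closed_Times) auto
    obtain a where a: "a \<in> anchors n" "y \<in> {snd a..snd a + ls n}" using y unfolding shadow_def by blast
    have "(fst a + (y - snd a) / Bs n, y) \<in> cell n a"
      using a Bs_facts(1)[of n] rs_pos[of n] by (auto simp: cell_def Yr_def)
    then show "C n \<noteq> {}" using a(1) by (auto simp: C_def cells_def)
  next
    fix m n :: nat assume "m \<le> n"
    then show "C n \<subseteq> C m" unfolding C_def
      using lift_Suc_antimono_le[of cells m n, OF cells_Suc_subset] by blast
  qed
  then show "y \<in> snd ` Sing" unfolding C_def Sing_def by force
qed

lemma card_anchors_Suc: "card (anchors (Suc n)) = card (anchors n) * N n"
proof -
  have inj: "inj_on (child n a) {..<N n}" for a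
    using us_pos[of n] by (auto simp: inj_on_def child_def)
  have dj: "child n a ` {..<N n} \<inter> child n b ` {..<N n} = {}"
    if "a \<in> anchors n" "b \<in> anchors n" "a \<noteq> b" for a b
  proof -
    have "child n a i \<noteq> child n b j" if "i < N n" "j < N n" for i j
    proof
      assume eq: "child n a i = child n b j"
      have "a = b"
        by (rule anchors_unique[OF \<open>a \<in> _\<close> \<open>b \<in> _\<close>, of "snd (child n a i)"])
          (use child_range[OF that(1), of a] child_range[OF that(2), of b] eq us_pos[of n] us_eq[of n] ls_pos[of "Suc n"] ts_pos[of n] ts_pos[of "Suc n"] in auto)
      then show False using \<open>a \<noteq> b\<close> by simp
    qed
    then show ?thesis by blast
  qed
  have "card (anchors (Suc n)) = (\<Sum>a\<in>anchors n. card (child n a ` {..<N n}))"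
    unfolding anchors.simps using dj by (intro card_UN_disjoint) (auto simp: finite_anchors)
  also have "\<dots> = card (anchors n) * N n" using card_image[OF inj] by simp
  finally show ?thesis .
qed

text \<open>
  Passing from level \<open>n\<close> to level \<open>n + 1\<close> divides the total height by \<open>1 + 5 * eps (n + 1)\<close>.
\<close>
lemma total_length: "1 / 2 + 1 / 2 ^ (n + 1) \<le> real (card (anchors n)) * ls n"
proof (induction n)
  case (Suc n)
  define q :: real where "q = 1 / 2 ^ (n + 2)"
  have q: "0 < q" "q \<le> 1 / 4" using one_le_power[of "2::real" n] by (auto simp: q_def field_simps)
  have e: "5 * eps (Suc n) = q" by (simp add: eps_def q_def)
  have "q * q \<le> q * (1 / 4)" using q by (intro mult_left_mono) auto
  moreover have "(1 / 2 + q) * (1 + q) = 1 / 2 + q / 2 + q + q * q" by (simp add: field_simps)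
  ultimately have "(1 / 2 + q) * (1 + q) \<le> 1 / 2 + 2 * q" using q by linarith
  also have "\<dots> \<le> real (card (anchors n)) * ls n" using Suc.IH by (simp add: q_def)
  finally have "1 / 2 + q \<le> real (card (anchors n)) * ls n / (1 + q)" using q by (simp add: pos_le_divide_eq)
  also have "\<dots> = real (card (anchors (Suc n))) * ls (Suc n)"
    unfolding card_anchors_Suc ls_Suc e using N_pos[of n] by simp
  finally show ?case by (simp add: q_def)
qed simp

lemma emeasure_shadow: "ennreal (1 / 2) \<le> emeasure lborel (shadow n)"
proof -
  have "emeasure lborel (shadow n) = (\<Sum>a\<in>anchors n. emeasure lborel {snd a..snd a + ls n})"
    unfolding shadow_def
  proof (rule sum_emeasure[symmetric])
    show "disjoint_family_on (\<lambda>a. {snd a..snd a + ls n}) (anchors n)"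
      unfolding disjoint_family_on_def
    proof (intro ballI impI)
      fix a b assume "a \<in> anchors n" "b \<in> anchors n" "a \<noteq> b"
      then show "{snd a..snd a + ls n} \<inter> {snd b..snd b + ls n} = {}"
        using anchors_separated[of a n b] ts_pos[of n] by auto
    qed
  qed (auto simp: finite_anchors)
  also have "\<dots> = ennreal (real (card (anchors n)) * ls n)"
    using ls_pos[of n] by (simp add: ennreal_mult' ennreal_of_nat_eq_real_of_nat)
  finally have eq: "emeasure lborel (shadow n) = ennreal (real (card (anchors n)) * ls n)" .
  have "(0::real) < 1 / 2 ^ (n + 1)" by simp
  then have "1 / 2 \<le> real (card (anchors n)) * ls n" using total_length[of n] by linarith
  then show ?thesis unfolding eq by (rule ennreal_leI)
qed

lemma linear_measure_Sing: "0 < linear_measure Sing"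
proof -
  have meas: "shadow n \<in> sets lborel" for n
    unfolding shadow_def using finite_anchors by (intro sets.finite_UN) auto
  have fin: "emeasure lborel (shadow n) \<noteq> \<infinity>" for n
  proof -
    have "bounded (shadow n)" unfolding shadow_def by (intro bounded_UN finite_anchors ballI) simp
    then show ?thesis using emeasure_bounded_finite[of "shadow n"] by simp
  qed
  have "ennreal (1 / 2) \<le> (INF n. emeasure lborel (shadow n))" by (intro INF_greatest emeasure_shadow)
  also have "\<dots> = emeasure lborel (\<Inter>n. shadow n)"
    by (rule INF_emeasure_decseq[OF _ shadow_decreasing fin]) (use meas in auto)
  also have "\<dots> \<le> linear_measure Sing"
    by (rule linear_measure_ge_projection[OF _ shadow_subset]) (use meas in \<open>auto intro!: sets.countable_INT\<close>)
  finally have le: "ennreal (1 / 2) \<le> linear_measure Sing" .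
  have "0 < ennreal (1 / 2)" unfolding ennreal_less_zero_iff by simp
  then show ?thesis using le by (rule less_le_trans)
qed

section \<open>The calibration inequality\<close>

text \<open>
  The contributions of all strips of level \<open>n\<close>; at each point at most one of them is nonzero.  The sum
  \<open>excess M\<close> is the Lagrangian minus the differential of the potential, both restricted to levels below \<open>M\<close>.
\<close>
definition Psum where "Psum n x y = (\<Sum>a\<in>anchors n. lev.psi n (x - fst a) (y - snd a))"
definition Gsum where "Gsum n x y s = (\<Sum>a\<in>anchors n. lev.grad n (x - fst a) (y - snd a) s)"
definition Ksum where "Ksum n x y s = Psum n x y * hs n s - Gsum n x y s"
definition excess where "excess M x y s = D (ps 0) s + (\<Sum>n<M. Ksum n x y s)"

lemma sum_single:
  assumes "finite I" "\<And>b. b \<in> I \<Longrightarrow> b \<noteq> a \<Longrightarrow> f b = 0" "a \<in> I"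
  shows "sum f I = (f a :: real)"
  using sum.remove[OF assms(1,3), of f] sum.neutral[of "I - {a}" f] assms(2) by simp

lemma Ksum_single:
  assumes a: "a \<in> anchors n" and o: "\<And>b. b \<in> anchors n \<Longrightarrow> b \<noteq> a \<Longrightarrow> out n b x y"
  shows "Gsum n x y s = lev.grad n (x - fst a) (y - snd a) s"
    "Ksum n x y s = lev.gain n (x - fst a) (y - snd a) s"
proof -
  have "Psum n x y = lev.psi n (x - fst a) (y - snd a)" unfolding Psum_def
    by (rule sum_single[OF finite_anchors _ a]) (rule lev.outside_zero(1), use o in \<open>auto simp: out_def\<close>)
  moreover show "Gsum n x y s = lev.grad n (x - fst a) (y - snd a) s" unfolding Gsum_def
    by (rule sum_single[OF finite_anchors _ a]) (rule lev.outside_zero(2), use o in \<open>auto simp: out_def\<close>)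
  ultimately show "Ksum n x y s = lev.gain n (x - fst a) (y - snd a) s"
    unfolding Ksum_def lev.gain_def by simp
qed

lemma Ksum_outside:
  assumes "\<And>b. b \<in> anchors n \<Longrightarrow> out n b x y"
  shows "Ksum n x y s = 0" "Gsum n x y s = 0"
  using assms lev.outside_zero(1,2) unfolding Ksum_def Psum_def Gsum_def out_def
  by (auto intro!: sum.neutral)

lemma not_out_unique:
  assumes "a \<in> anchors n" "b \<in> anchors n" "\<not> out n a x y" "b \<noteq> a"
  shows "out n b x y"
proof (rule ccontr)
  assume "\<not> out n b x y"
  then show False using anchors_unique[OF assms(1,2), of y] not_outD[OF assms(3)] not_outD[of n b x y] assms(4) by blast
qed

lemma child_inn:
  assumes "i < N n" "\<not> out (Suc n) (child n a i) x y" shows "inn n a x y"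
  using child_support[OF assms] ts_pos[of n] rs_pos[of n] by (auto simp: inn_def)

lemma inn_gain:
  assumes "inn n a x y"
  shows "D (ps (Suc n)) s \<le> D (ps n) s + lev.gain n (x - fst a) (y - snd a) s"
    "cs n + 1 \<le> s \<Longrightarrow> D (ps n) s + lev.gain n (x - fst a) (y - snd a) s = D (ps (Suc n)) s"
  using lev.inner_gain[of "y - snd a" n "x - fst a" s] assms by (auto simp: inn_def Yr_def)

text \<open>
  Induction over the levels.  Where a strip of level \<open>M\<close> acts, the point lies in a core of level \<open>M - 1\<close>, so the
  previous levels leave at least the Bregman distance at \<open>ps M\<close>, and that is what \<open>gain_nonneg\<close> needs.
\<close>
lemma excess_bounds:
  "0 \<le> excess M x y s \<and> (\<forall>a\<in>anchors M. \<not> out M a x y \<longrightarrow> D (ps M) s \<le> excess M x y s)"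
proof (induction M)
  case 0
  then show ?case by (simp add: excess_def D_nonneg)
next
  case (Suc M)
  have e: "excess (Suc M) x y s = excess M x y s + Ksum M x y s" by (simp add: excess_def)
  show ?case
  proof (cases "\<exists>a\<in>anchors M. \<not> out M a x y")
    case True
    then obtain a where a: "a \<in> anchors M" "\<not> out M a x y" by blast
    have K: "Ksum M x y s = lev.gain M (x - fst a) (y - snd a) s"
      by (rule Ksum_single(2)[OF a(1)]) (rule not_out_unique[OF a(1) _ a(2)])
    have ge: "D (ps M) s \<le> excess M x y s" using Suc a by blast
    then have "0 \<le> excess (Suc M) x y s"
      using lev.gain_nonneg[where n = M and s = s and x = "x - fst a" and y = "y - snd a"] unfolding e K by linarith
    moreover have "D (ps (Suc M)) s \<le> excess (Suc M) x y s"
      if "a' \<in> anchors (Suc M)" "\<not> out (Suc M) a' x y" for a'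
    proof -
      obtain b i where b: "b \<in> anchors M" "i < N M" "a' = child M b i" using \<open>a' \<in> _\<close> by auto
      have i: "inn M b x y" using child_inn b that by blast
      have "b = a" using not_out_unique[OF a(1) b(1) a(2)] inn_not_out[OF i] by blast
      with i have "inn M a x y" by simp
      from inn_gain(1)[OF this, of s] show ?thesis using ge unfolding e K by linarith
    qed
    ultimately show ?thesis by blast
  next
    case False
    then have "Ksum M x y s = 0" by (intro Ksum_outside) blast
    moreover have "out (Suc M) a' x y" if a': "a' \<in> anchors (Suc M)" for a'
    proof -
      obtain b i where b: "b \<in> anchors M" "i < N M" "a' = child M b i" using a' by auto
      then show ?thesis using child_inn[OF b(2), of b x y] inn_not_out[of M b x y] False by blast
    qed
    ultimately show ?thesis using Suc e by auto
  qed
qed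

lemma excess_on_branch:
  assumes "\<And>k. k < M \<Longrightarrow> a k \<in> anchors k \<and> inn k (a k) x y" "ps M \<le> s"
  shows "excess M x y s = D (ps M) s"
  using assms
proof (induction M)
  case 0
  then show ?case by (simp add: excess_def)
next
  case (Suc M)
  have le: "cs M + 1 \<le> ps M" "ps M \<le> ps (Suc M)"
    using Bs_facts[of M] by (auto simp: cs_def ps_def)
  have a: "a M \<in> anchors M" "inn M (a M) x y" using Suc.prems by auto
  have "excess M x y s = D (ps M) s" using Suc.prems le by (intro Suc.IH) auto
  moreover have "Ksum M x y s = lev.gain M (x - fst (a M)) (y - snd (a M)) s"
    by (rule Ksum_single(2)[OF a(1)]) (rule not_out_unique[OF a(1) _ inn_not_out[OF a(2)]])
  ultimately show ?case using inn_gain(2)[OF a(2), of s] le Suc.prems(2) by (simp add: excess_def)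
qed

end

section \<open>Peano's existence theorem\<close>

lemma indefinite_integral_lipschitz:
  fixes g :: "real \<Rightarrow> real"
  assumes c: "continuous_on UNIV g" and b: "\<And>s. 0 \<le> g s" "\<And>s. g s \<le> M"
  shows "y \<le> y' \<Longrightarrow> 0 \<le> integral {a..y'} g - integral {a..y} g"
    "y \<le> y' \<Longrightarrow> integral {a..y'} g - integral {a..y} g \<le> M * (y' - y)"
proof -
  have i: "g integrable_on {p..q}" for p q
    by (intro integrable_continuous_interval continuous_on_subset[OF c]) auto
  have M: "0 \<le> M" using b[of 0] by linarith
  have bd: "0 \<le> integral {p..q} g \<and> integral {p..q} g \<le> M * (q - p)" if "p \<le> q" for p q
  proof
    show "0 \<le> integral {p..q} g" by (intro integral_nonneg i) (auto simp: b)
    have "integral {p..q} g \<le> integral {p..q} (\<lambda>s. M)" by (intro integral_le i) (auto simp: b)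
    then show "integral {p..q} g \<le> M * (q - p)" using that by (simp add: mult.commute)
  qed
  have *: "0 \<le> integral {a..y'} g - integral {a..y} g \<and> integral {a..y'} g - integral {a..y} g \<le> M * (y' - y)"
    if "y \<le> y'"
  proof -
    consider "y' < a" | "y < a" "a \<le> y'" | "a \<le> y" by linarith
    then show ?thesis
    proof cases
      case 1
      then show ?thesis using that M by simp
    next
      case 2
      then have "M * (y' - a) \<le> M * (y' - y)" using M by (intro mult_left_mono) auto
      then show ?thesis using 2 bd[of a y'] by simp
    next
      case 3
      have "integral {a..y} g + integral {y..y'} g = integral {a..y'} g"
        by (rule Henstock_Kurzweil_Integration.integral_combine[OF 3 that i])
      then show ?thesis using bd[OF that] by linarith
    qed
  qed
  show "y \<le> y' \<Longrightarrow> 0 \<le> integral {a..y'} g - integral {a..y} g"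
    "y \<le> y' \<Longrightarrow> integral {a..y'} g - integral {a..y} g \<le> M * (y' - y)" using * by auto
qed

text \<open>
  Tonelli's approximations: the right-hand side is evaluated at the solution delayed by \<open>d\<close>, so that
  the \<open>n\<close>-th iterate is a fixed point up to \<open>a + n * d\<close>.
\<close>
primrec delayed :: "(real \<Rightarrow> real \<Rightarrow> real) \<Rightarrow> real \<Rightarrow> real \<Rightarrow> real \<Rightarrow> nat \<Rightarrow> real \<Rightarrow> real" where
  "delayed f a x0 d 0 = (\<lambda>y. x0)"
| "delayed f a x0 d (Suc n) = (\<lambda>y. x0 + integral {a..y} (\<lambda>s. f (delayed f a x0 d n (s - d)) s))"

lemma delayed_lipschitz:
  assumes c: "continuous_on UNIV (\<lambda>z. f (fst z) (snd z))" and b: "\<And>x s. 0 \<le> f x s" "\<And>x s. f x s \<le> M"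
  shows "continuous_on UNIV (delayed f a x0 d n) \<and>
    (\<forall>y y'. y \<le> y' \<longrightarrow> 0 \<le> delayed f a x0 d n y' - delayed f a x0 d n y \<and>
       delayed f a x0 d n y' - delayed f a x0 d n y \<le> M * (y' - y))"
proof (induction n)
  case 0
  have "0 \<le> M" using b[of 0 0] by linarith
  then show ?case by simp
next
  case (Suc n)
  let ?g = "\<lambda>s. f (delayed f a x0 d n (s - d)) s"
  have "continuous_on UNIV (\<lambda>s. delayed f a x0 d n (s - d))"
    by (rule continuous_on_compose2[OF conjunct1[OF Suc.IH]]) (auto intro!: continuous_intros)
  then have "continuous_on UNIV (\<lambda>s. (delayed f a x0 d n (s - d), s))" by (intro continuous_intros)
  from continuous_on_compose2[OF c this] have cg: "continuous_on UNIV ?g" by simp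
  have l: "\<forall>y y'. y \<le> y' \<longrightarrow> 0 \<le> delayed f a x0 d (Suc n) y' - delayed f a x0 d (Suc n) y \<and>
       delayed f a x0 d (Suc n) y' - delayed f a x0 d (Suc n) y \<le> M * (y' - y)"
    using indefinite_integral_lipschitz[OF cg b] by simp
  have M: "0 \<le> M" using b[of 0 0] by linarith
  have "M-lipschitz_on UNIV (delayed f a x0 d (Suc n))"
  proof (rule lipschitz_onI[OF _ M])
    fix y y'
    show "dist (delayed f a x0 d (Suc n) y) (delayed f a x0 d (Suc n) y') \<le> M * dist y y'"
      using l[rule_format, of y y'] l[rule_format, of y' y]
      by (cases "y \<le> y'") (auto simp: dist_real_def abs_minus_commute simp del: delayed.simps)
  qed
  then show ?case using l lipschitz_on_continuous_on by blast
qed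

lemma delayed_stable:
  assumes "d > 0" "y \<le> a + real n * d"
  shows "delayed f a x0 d (Suc n) y = delayed f a x0 d n y"
  using assms(2)
proof (induction n arbitrary: y)
  case 0
  then have "{a..y} \<subseteq> {a}" by auto
  then have "integral {a..y} (\<lambda>s. f x0 s) = 0"
    by (metis integral_empty integral_singleton subset_singletonD)
  then show ?case by simp
next
  case (Suc n)
  have "integral {a..y} (\<lambda>s. f (delayed f a x0 d (Suc n) (s - d)) s) = integral {a..y} (\<lambda>s. f (delayed f a x0 d n (s - d)) s)"
  proof (rule integral_cong)
    fix s assume "s \<in> {a..y}"
    then have "s - d \<le> a + real n * d" using Suc.prems by (simp add: algebra_simps)
    from Suc.IH[OF this] show "f (delayed f a x0 d (Suc n) (s - d)) s = f (delayed f a x0 d n (s - d)) s" by simp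
  qed
  then show ?case by simp
qed

text \<open>
  The delayed solutions are uniformly Lipschitz, and every uniform limit of them satisfies the integral
  equation.
\<close>
theorem Peano_existence:
  fixes f :: "real \<Rightarrow> real \<Rightarrow> real"
  assumes c: "continuous_on UNIV (\<lambda>z. f (fst z) (snd z))" and b: "\<And>x s. 0 \<le> f x s" "\<And>x s. f x s \<le> M"
    and ab: "a < b"
  obtains X where "X a = x0" "\<And>y. y \<in> {a..b} \<Longrightarrow> (X has_real_derivative f (X y) y) (at y within {a..b})"
proof -
  have M: "0 \<le> M" using b[of 0 0] by linarith
  (* With this delay, Suc m iterations reach b. *)
  define d where "d = (\<lambda>m::nat. (b - a) / real (Suc m))"
  have d: "d m > 0" "a + real (Suc m) * d m = b" for m using ab by (auto simp: d_def)
  have d0: "d \<longlonglongrightarrow> 0" unfolding d_def by real_asymp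
  define X where "X = (\<lambda>m. delayed f a x0 (d m) (Suc m))"
  have Xc: "continuous_on UNIV (X m)" and Xl: "y \<le> y' \<Longrightarrow> 0 \<le> X m y' - X m y \<and> X m y' - X m y \<le> M * (y' - y)" for m y y'
    using delayed_lipschitz[OF c b, of a x0 "d m" "Suc m"] unfolding X_def by blast+
  have Xl': "\<bar>X m y' - X m y\<bar> \<le> M * \<bar>y' - y\<bar>" for m y y'
    using Xl[of y y' m] Xl[of y' y m] by (cases "y \<le> y'") auto
  have Xa: "X m a = x0" for m by (simp add: X_def)
  have Xeq: "X m y = x0 + integral {a..y} (\<lambda>s. f (X m (s - d m)) s)" if "y \<le> b" for m y
  proof -
    have "X m y = delayed f a x0 (d m) (Suc (Suc m)) y"
      unfolding X_def by (rule delayed_stable[symmetric]) (use d that in auto)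
    then show ?thesis by (simp add: X_def)
  qed
  obtain g k where g: "continuous_on {a..b} g" "strict_mono (k :: nat \<Rightarrow> nat)"
    "\<And>e. 0 < e \<Longrightarrow> \<exists>N. \<forall>n x. n \<ge> N \<and> x \<in> {a..b} \<longrightarrow> norm (X (k n) x - g x) < e"
  proof (rule Arzela_Ascoli[of "{a..b}" X "\<bar>x0\<bar> + M * (b - a)"])
    show "norm (X n x) \<le> \<bar>x0\<bar> + M * (b - a)" if "x \<in> {a..b}" for n x
    proof -
      have "M * (x - a) \<le> M * (b - a)" using M that by (intro mult_left_mono) auto
      then show ?thesis using Xl[of a x n] that Xa[of n] by auto
    qed
    show "\<exists>d>0. \<forall>n y. y \<in> {a..b} \<and> norm (x - y) < d \<longrightarrow> norm (X n x - X n y) < e" if "0 < e" for x e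
    proof (intro exI[of _ "e / (M + 1)"] conjI allI impI)
      fix n y assume "y \<in> {a..b} \<and> norm (x - y) < e / (M + 1)"
      then have "(M + 1) * \<bar>x - y\<bar> < e" using M by (simp add: field_simps)
      then show "norm (X n x - X n y) < e" using Xl'[of n x y] M by (simp add: algebra_simps)
    qed (use that M in auto)
  qed (use that in auto)
  have gl: "(\<lambda>n. X (k n) y) \<longlonglongrightarrow> g y" if "y \<in> {a..b}" for y
    unfolding LIMSEQ_iff using g(3) that by blast
  have dk: "(\<lambda>n. d (k n)) \<longlonglongrightarrow> 0" using LIMSEQ_subseq_LIMSEQ[OF d0 g(2)] by (simp add: o_def)
  have shift: "(\<lambda>n. X (k n) (y - d (k n))) \<longlonglongrightarrow> g y" if "y \<in> {a..b}" for y
  proof -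
    have "(\<lambda>n. X (k n) (y - d (k n)) - X (k n) y) \<longlonglongrightarrow> 0"
    proof (rule Lim_null_comparison)
      have "(\<lambda>n. M * \<bar>d (k n)\<bar>) \<longlonglongrightarrow> M * \<bar>0\<bar>" by (intro tendsto_intros dk)
      then show "(\<lambda>n. M * \<bar>d (k n)\<bar>) \<longlonglongrightarrow> 0" by simp
      show "\<forall>\<^sub>F n in sequentially. norm (X (k n) (y - d (k n)) - X (k n) y) \<le> M * \<bar>d (k n)\<bar>"
        using Xl' by (intro always_eventually) (metis abs_minus_commute add_diff_cancel_left' diff_add_cancel real_norm_def)
    qed
    from tendsto_add[OF this gl[OF that]] show ?thesis by simp
  qed
  have fl: "(\<lambda>n. f (X (k n) (y - d (k n))) y) \<longlonglongrightarrow> f (g y) y" if "y \<in> {a..b}" for y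
  proof -
    have "isCont (\<lambda>z. f (fst z) (snd z)) (g y, y)" using c by (simp add: continuous_on_eq_continuous_at)
    moreover have "(\<lambda>n. (X (k n) (y - d (k n)), y)) \<longlonglongrightarrow> (g y, y)" by (intro tendsto_intros shift that)
    ultimately show ?thesis using isCont_tendsto_compose by force
  qed
  have cont: "continuous_on {a..b} (\<lambda>s. f (X m (s - e)) s)" for m e
  proof -
    have "continuous_on {a..b} (\<lambda>s. X m (s - e))"
      by (rule continuous_on_compose2[OF Xc]) (auto intro!: continuous_intros)
    then have "continuous_on {a..b} (\<lambda>s. (X m (s - e), s))" by (intro continuous_intros)
    from continuous_on_compose2[OF c this] show ?thesis by simp
  qed
  have geq: "g y = x0 + integral {a..y} (\<lambda>s. f (g s) s)" if y: "y \<in> {a..b}" for y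
  proof -
    have "(\<lambda>n. integral {a..y} (\<lambda>s. f (X (k n) (s - d (k n))) s)) \<longlonglongrightarrow> integral {a..y} (\<lambda>s. f (g s) s)"
    proof (rule dominated_convergence(2))
      show "(\<lambda>s. f (X (k n) (s - d (k n))) s) integrable_on {a..y}" for n
        using y by (intro integrable_continuous_interval continuous_on_subset[OF cont]) auto
      show "(\<lambda>s. M) integrable_on {a..y}" by (intro integrable_continuous_interval continuous_on_const)
      show "norm (f (X (k n) (s - d (k n))) s) \<le> M" if "s \<in> {a..y}" for n s using b by simp
      show "(\<lambda>n. f (X (k n) (s - d (k n))) s) \<longlonglongrightarrow> f (g s) s" if "s \<in> {a..y}" for s using fl that y by auto
    qed
    then have "(\<lambda>n. x0 + integral {a..y} (\<lambda>s. f (X (k n) (s - d (k n))) s)) \<longlonglongrightarrow> x0 + integral {a..y} (\<lambda>s. f (g s) s)"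
      by (intro tendsto_intros)
    then have "(\<lambda>n. X (k n) y) \<longlonglongrightarrow> x0 + integral {a..y} (\<lambda>s. f (g s) s)" using Xeq y by simp
    then show ?thesis using gl[OF y] LIMSEQ_unique by blast
  qed
  have "continuous_on {a..b} (\<lambda>s. (g s, s))" by (intro continuous_intros g(1))
  from continuous_on_compose2[OF c this] have cf: "continuous_on {a..b} (\<lambda>s. f (g s) s)" by simp
  show ?thesis
  proof (rule that[of g])
    show "g a = x0" using geq[of a] ab by simp
    fix y assume y: "y \<in> {a..b}"
    have "((\<lambda>y. x0 + integral {a..y} (\<lambda>s. f (g s) s)) has_real_derivative f (g y) y) (at y within {a..b})"
      using DERIV_add[OF DERIV_const integral_has_real_derivative[OF cf y]] by simp
    then show "(g has_real_derivative f (g y) y) (at y within {a..b})"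
      by (rule has_field_derivative_transform_within[OF _ zero_less_one y]) (use geq in auto)
  qed
qed

lemma sum_disjoint_intervals_le:
  fixes s t :: "'i \<Rightarrow> real"
  assumes fin: "finite I" and st: "\<And>i. i \<in> I \<Longrightarrow> p \<le> s i \<and> s i \<le> t i \<and> t i \<le> q"
    and dj: "\<And>i j. i \<in> I \<Longrightarrow> j \<in> I \<Longrightarrow> i \<noteq> j \<Longrightarrow> {s i<..<t i} \<inter> {s j<..<t j} = {}" and pq: "p \<le> q"
  shows "(\<Sum>i\<in>I. t i - s i) \<le> q - p"
proof -
  have "(\<Sum>i\<in>I. t i - s i) = (\<Sum>i\<in>I. measure lebesgue {s i<..<t i})"
    using st by (intro sum.cong) auto
  also have "\<dots> = measure lebesgue (\<Union>i\<in>I. {s i<..<t i})"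
    using fin dj by (intro measure_UNION'[symmetric]) (auto simp: disjnt_def pairwise_def)
  also have "\<dots> \<le> measure lebesgue {p..q}"
  proof (rule measure_mono_fmeasurable)
    show "(\<Union>i\<in>I. {s i<..<t i}) \<subseteq> {p..q}" using st by fastforce
    show "(\<Union>i\<in>I. {s i<..<t i}) \<in> sets lebesgue" using fin by (intro sets.finite_UN) auto
  qed auto
  finally show ?thesis using pq by simp
qed

text \<open>
  Near \<open>a\<close> the sum of increments is at most the total increment, which is small by continuity; away from
  \<open>a\<close> the function is Lipschitz.
\<close>
lemma AC_monotone_locally_lipschitz:
  assumes ab: "a < b" and mono: "\<And>x y. a \<le> x \<Longrightarrow> x \<le> y \<Longrightarrow> y \<le> b \<Longrightarrow> u x \<le> u y"
    and c: "\<And>e. e > 0 \<Longrightarrow> \<exists>x1. a < x1 \<and> x1 \<le> b \<and> u x1 - u a < e"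
    and lip: "\<And>x1. a < x1 \<Longrightarrow> x1 \<le> b \<Longrightarrow> \<exists>C\<ge>0. \<forall>x y. x1 \<le> x \<longrightarrow> x \<le> y \<longrightarrow> y \<le> b \<longrightarrow> u y - u x \<le> C * (y - x)"
  shows "u \<in> AC a b"
  unfolding AC_iff
proof (intro allI impI)
  fix e :: real assume e: "e > 0"
  obtain x1 where x1: "a < x1" "x1 \<le> b" "u x1 - u a < e / 2" using c[of "e/2"] e by auto
  obtain C where C: "C \<ge> 0" "\<And>x y. x1 \<le> x \<Longrightarrow> x \<le> y \<Longrightarrow> y \<le> b \<Longrightarrow> u y - u x \<le> C * (y - x)"
    using lip[OF x1(1,2)] by blast
  have "AC_modulus a b u e (e / (2 * (C + 1)))"
  proof (rule AC_modulusI)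
    fix n :: nat and s t :: "nat \<Rightarrow> real"
    assume st: "\<forall>i<n. a \<le> s i \<and> s i \<le> t i \<and> t i \<le> b"
      and dj: "disjoint_family_on (\<lambda>i. {s i<..<t i}) {..<n}" and l: "(\<Sum>i<n. t i - s i) < e / (2 * (C + 1))"
    define s1 t1 s2 t2 where "s1 = (\<lambda>i. min (s i) x1)" and "t1 = (\<lambda>i. min (t i) x1)"
      and "s2 = (\<lambda>i. max (s i) x1)" and "t2 = (\<lambda>i. max (t i) x1)"
    have split: "\<bar>u (t i) - u (s i)\<bar> \<le> (u (t1 i) - u (s1 i)) + C * (t i - s i)" if i: "i < n" for i
    proof -
      have "a \<le> s i" "s i \<le> t i" "t i \<le> b" using st i by auto
      then have "u (s i) \<le> u (t i)" by (intro mono)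
      moreover have "u (t i) - u (s i) = (u (t1 i) - u (s1 i)) + (u (t2 i) - u (s2 i))"
        using \<open>s i \<le> t i\<close> by (auto simp: s1_def t1_def s2_def t2_def min_def max_def)
      moreover have "u (t2 i) - u (s2 i) \<le> C * (t2 i - s2 i)"
        using \<open>s i \<le> t i\<close> \<open>t i \<le> b\<close> x1 by (intro C) (auto simp: s2_def t2_def)
      moreover have "C * (t2 i - s2 i) \<le> C * (t i - s i)"
        using C(1) \<open>s i \<le> t i\<close> by (intro mult_left_mono) (auto simp: s2_def t2_def)
      ultimately show ?thesis by linarith
    qed
    have "(\<Sum>i<n. u (t1 i) - u (s1 i)) \<le> u x1 - u a"
    proof (rule sum_disjoint_intervals_le)
      show "u a \<le> u (s1 i) \<and> u (s1 i) \<le> u (t1 i) \<and> u (t1 i) \<le> u x1" if "i \<in> {..<n}" for i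
        using st[rule_format, of i] that x1 by (auto simp: s1_def t1_def intro!: mono)
      show "u a \<le> u x1" using x1 by (intro mono) auto
      fix i j assume ij: "i \<in> {..<n}" "j \<in> {..<n}" "i \<noteq> j"
      then have d: "{s i<..<t i} \<inter> {s j<..<t j} = {}" using dj by (auto simp: disjoint_family_on_def)
      have "\<not> max (s i) (s j) < min (t i) (t j)"
      proof
        assume "max (s i) (s j) < min (t i) (t j)"
        then obtain z where "max (s i) (s j) < z" "z < min (t i) (t j)" using dense by blast
        then show False using d by auto
      qed
      then consider "t i \<le> s j" | "t j \<le> s i" | "t i = s i" | "t j = s j"
        using st[rule_format, of i] st[rule_format, of j] ij by (auto simp: max_def min_def split: if_splits)
      then show "{u (s1 i)<..<u (t1 i)} \<inter> {u (s1 j)<..<u (t1 j)} = {}"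
      proof cases
        case 1
        then have "u (t1 i) \<le> u (s1 j)" using st[rule_format, of i] st[rule_format, of j] ij x1
          by (intro mono) (auto simp: s1_def t1_def)
        then show ?thesis by auto
      next
        case 2
        then have "u (t1 j) \<le> u (s1 i)" using st[rule_format, of i] st[rule_format, of j] ij x1
          by (intro mono) (auto simp: s1_def t1_def)
        then show ?thesis by auto
      qed (auto simp: s1_def t1_def)
    qed auto
    moreover have "(\<Sum>i<n. \<bar>u (t i) - u (s i)\<bar>) \<le> (\<Sum>i<n. (u (t1 i) - u (s1 i)) + C * (t i - s i))"
      using split by (intro sum_mono) auto
    moreover have "\<dots> = (\<Sum>i<n. u (t1 i) - u (s1 i)) + C * (\<Sum>i<n. t i - s i)"
      by (simp add: sum.distrib sum_distrib_left)
    moreover have "C * (\<Sum>i<n. t i - s i) \<le> C * (e / (2 * (C + 1)))" using l C by (intro mult_left_mono) auto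
    moreover have "C * (e / (2 * (C + 1))) \<le> e / 2" using C e by (simp add: field_simps)
    ultimately show "(\<Sum>i<n. \<bar>u (t i) - u (s i)\<bar>) < e" using x1(3) by linarith
  qed
  moreover have "e / (2 * (C + 1)) > 0" using e C by simp
  ultimately show "\<exists>d>0. AC_modulus a b u e d" by blast
qed

section \<open>Tracks leaving the staircase\<close>

context construction begin

lemma ps_facts: "8 \<le> ps n" "ps (Suc n) = 4 * ps n" "ps n = 2 * Bs n" "cs n + 1 \<le> ps n"
  using Bs_facts[of n] by (auto simp: ps_def cs_def)

lemma ps_mono: "m \<le> n \<Longrightarrow> ps m \<le> ps n"
proof (rule lift_Suc_mono_le[of ps m n])
  fix n show "ps n \<le> ps (Suc n)" using ps_facts(1,2)[of n] by linarith
qed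

lemma ls_decreasing: "m \<le> n \<Longrightarrow> ls n \<le> ls m"
proof (rule lift_Suc_antimono_le[of ls m n])
  fix n show "ls (Suc n) \<le> ls n" using ls_Suc_le[of n] ls_pos[of "Suc n"] by linarith
qed

text \<open>
  Scales along a track: up to height \<open>reach n\<close> above its origin it is in the cores of all levels below \<open>n\<close>.  The value at
  \<open>0\<close> is the height of the whole track.
\<close>
definition reach :: "nat \<Rightarrow> real" where "reach n = (if n = 0 then 1 else rs (n - 1) / 2)"

lemma reach_Suc: "reach (Suc n) = rs n / 2" by (simp add: reach_def)

lemma reach_pos: "0 < reach n" using rs_pos by (simp add: reach_def)

lemma reach_decreasing: "m \<le> n \<Longrightarrow> reach n \<le> reach m"
proof (rule lift_Suc_antimono_le[of reach m n])
  fix n show "reach (Suc n) \<le> reach n"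
  proof (cases n)
    case 0
    then show ?thesis using rs_le_ts[of 0] ts_le_ls[of 0] rs_pos[of 0] by (simp add: reach_def)
  next
    case (Suc m)
    then show ?thesis using rs_Suc_le[of m] by (simp add: reach_def)
  qed
qed

lemma reach_tendsto_0: "reach \<longlonglongrightarrow> 0"
proof (rule LIMSEQ_imp_Suc, rule tendsto_sandwich[OF _ _ tendsto_const ls_tendsto_0])
  show "\<forall>\<^sub>F n in sequentially. 0 \<le> reach (Suc n)" using reach_pos by (simp add: less_imp_le)
  show "\<forall>\<^sub>F n in sequentially. reach (Suc n) \<le> ls n"
  proof (rule always_eventually, rule allI)
    fix n show "reach (Suc n) \<le> ls n"
      using rs_le_ts[of n] ts_le_ls[of n] rs_pos[of n] ls_pos[of n] by (simp add: reach_Suc)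
  qed
qed

lemma phase_exists:
  assumes "0 < d" "d \<le> 1"
  obtains n where "reach (Suc n) < d" "d \<le> reach n"
proof -
  have "\<exists>n. reach n < d" using reach_tendsto_0 assms(1)
    by (metis (no_types, lifting) eventually_sequentially order_refl order_tendstoD(2))
  then have L: "reach (LEAST n. reach n < d) < d" by (rule LeastI_ex)
  have "(LEAST n. reach n < d) \<noteq> 0"
  proof
    assume "(LEAST n. reach n < d) = 0"
    with L have "reach 0 < d" by simp
    then show False using assms(2) by (simp add: reach_def)
  qed
  then obtain n where n: "(LEAST n. reach n < d) = Suc n" using not0_implies_Suc by blast
  have "\<not> reach n < d" using not_less_Least[of n "\<lambda>n. reach n < d"] n by simp
  then show ?thesis using that[of n] L n by simp
qed

lemma not_out_ancestor:
  assumes "b \<in> anchors m" "\<not> out m b x y" "n \<le> m"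
  shows "\<exists>b'\<in>anchors n. \<not> out n b' x y"
  using assms(3,1,2)
proof (induction m arbitrary: b rule: dec_induct)
  case (step m)
  then obtain b' i where b': "b' \<in> anchors m" "i < N m" "b = child m b' i" by auto
  have "\<not> out m b' x y" using child_inn[OF b'(2)] step.prems b'(3) inn_not_out by blast
  then show ?case using step.IH[OF b'(1)] by blast
qed blast

end

text \<open>
  A point of the staircase together with its branch of anchors.
\<close>
locale singular_point = construction +
  fixes x0 y0 :: real and a :: "nat \<Rightarrow> real \<times> real"
  assumes anchor: "\<And>n. a n \<in> anchors n" and in_cell: "\<And>n. (x0, y0) \<in> cell n (a n)"
    and branch: "\<And>n. \<exists>i<N n. a (Suc n) = child n (a n) i"
    and central: "\<And>n. \<bar>Yr n (a n) x0 y0\<bar> \<le> rs n / 16"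
begin

text \<open>
  Tracks are described as graphs over \<open>y\<close>, where the infinite slope at the origin becomes the value \<open>0\<close> of the
  reciprocal slope \<open>rate\<close>.  Only the strips on the branch enter.  Each lowers the rate by at most
  \<open>1 / ps n - 1 / ps (n + 1)\<close>, so the sum converges uniformly and the rate is continuous everywhere, also at the
  origin, where it is not Lipschitz.
\<close>
definition bend where
  "bend n x y = (1 / ps n - 1 / lev.slope n (Yr n (a n) x y)) * lev.Z n (y - snd (a n))"
definition rate where "rate x y = 1 / ps 0 - (\<Sum>n. bend n x y)"

lemma slope_range: "ps n \<le> lev.slope n Y" "lev.slope n Y \<le> ps (Suc n)" "0 < lev.slope n Y"
  using lev.slope_bounds[of n Y] ps_facts(1)[of n] by auto

lemma bend_bounds: "0 \<le> bend n x y" "bend n x y \<le> 1 / ps n - 1 / ps (Suc n)"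
proof -
  have p: "0 < ps n" using ps_facts(1)[of n] by simp
  have s: "0 \<le> 1 / ps n - 1 / lev.slope n (Yr n (a n) x y)"
    "1 / ps n - 1 / lev.slope n (Yr n (a n) x y) \<le> 1 / ps n - 1 / ps (Suc n)"
    using slope_range[of n "Yr n (a n) x y"] p by (auto intro!: divide_left_mono mult_pos_pos)
  show "0 \<le> bend n x y" unfolding bend_def using s lev.Z_facts(1) by (intro mult_nonneg_nonneg) auto
  have "bend n x y \<le> (1 / ps n - 1 / ps (Suc n)) * 1"
    unfolding bend_def using s lev.Z_facts(1,2) by (intro mult_mono) auto
  then show "bend n x y \<le> 1 / ps n - 1 / ps (Suc n)" by simp
qed

lemma telescope: "(\<Sum>k<n. 1 / ps k - 1 / ps (Suc k)) = 1 / ps 0 - 1 / ps n"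
  by (induction n) auto

lemma summable_bend_bound: "summable (\<lambda>n. 1 / ps n - 1 / ps (Suc n))"
proof -
  have eq: "1 / ps n - 1 / ps (Suc n) = 3 / 32 * (1 / 4) ^ n" for n
    by (simp add: ps_def Bs_def power_divide field_simps)
  show ?thesis unfolding eq by (intro summable_mult summable_geometric) simp
qed

lemma summable_bend: "summable (\<lambda>n. bend n x y)"
  by (rule summable_comparison_test'[OF summable_bend_bound, of 0]) (use bend_bounds in auto)

lemma rate_bounds: "0 \<le> rate x y" "rate x y \<le> 1 / ps 0"
proof -
  have "(\<Sum>n. bend n x y) \<le> 1 / ps 0"
  proof (rule suminf_le_const[OF summable_bend])
    fix n
    have "(\<Sum>k<n. bend k x y) \<le> (\<Sum>k<n. 1 / ps k - 1 / ps (Suc k))" by (intro sum_mono bend_bounds)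
    then show "(\<Sum>k<n. bend k x y) \<le> 1 / ps 0" using telescope[of n] ps_facts(1)[of n] by (simp add: order.trans)
  qed
  then show "0 \<le> rate x y" by (simp add: rate_def)
  have "0 \<le> (\<Sum>n. bend n x y)" by (intro suminf_nonneg summable_bend bend_bounds)
  then show "rate x y \<le> 1 / ps 0" by (simp add: rate_def)
qed

lemma rate_continuous: "continuous_on UNIV (\<lambda>z. rate (fst z) (snd z))"
proof -
  have ul: "uniform_limit UNIV (\<lambda>m z. \<Sum>n<m. bend n (fst z) (snd z)) (\<lambda>z. \<Sum>n. bend n (fst z) (snd z)) sequentially"
    by (rule Weierstrass_m_test[OF _ summable_bend_bound]) (use bend_bounds in auto)
  have cs: "continuous_on UNIV (\<lambda>z. \<Sum>n<m. bend n (fst z) (snd z))" for m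
  proof (rule continuous_on_sum)
    fix n
    have Zc: "continuous_on UNIV (lev.Z n)" using DERIV_isCont[OF lev.Z_deriv] by (simp add: continuous_at_imp_continuous_on)
    have sc: "continuous_on UNIV (lev.slope n)" by (rule smooth_continuous[OF lev.smooth_slope])
    have "continuous_on UNIV (\<lambda>z :: real \<times> real. lev.slope n (Yr n (a n) (fst z) (snd z)))"
      unfolding Yr_def by (rule continuous_on_compose2[OF sc]) (auto intro!: continuous_intros)
    moreover have "continuous_on UNIV (\<lambda>z :: real \<times> real. lev.Z n (snd z - snd (a n)))"
      by (rule continuous_on_compose2[OF Zc]) (auto intro!: continuous_intros)
    ultimately show "continuous_on UNIV (\<lambda>z. bend n (fst z) (snd z))" unfolding bend_def
      using slope_range(3) by (intro continuous_intros) (auto simp: less_imp_neq[symmetric])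
  qed
  have "continuous_on UNIV (\<lambda>z. \<Sum>n. bend n (fst z) (snd z))"
    by (rule uniform_limit_theorem[OF _ ul]) (use cs in auto)
  then show ?thesis unfolding rate_def by (intro continuous_intros)
qed

lemma inn_bend:
  assumes "inn n (a n) x y" shows "bend n x y = 1 / ps n - 1 / ps (Suc n)"
  using assms lev.on_bump(1)[of "Yr n (a n) x y" n] lev.Z_facts(4)[of "y - snd (a n)" n] ts_pos[of n]
  by (simp add: bend_def inn_def)

lemma rate_inn:
  assumes "\<And>k. k < n \<Longrightarrow> inn k (a k) x y" shows "rate x y \<le> 1 / ps n"
proof -
  have "(\<Sum>k<n. bend k x y) = (\<Sum>k<n. 1 / ps k - 1 / ps (Suc k))"
    by (rule sum.cong) (simp_all add: inn_bend assms)
  then have "1 / ps 0 - 1 / ps n = (\<Sum>k<n. bend k x y)" by (simp add: telescope)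
  also have "\<dots> \<le> (\<Sum>k. bend k x y)" by (intro sum_le_suminf summable_bend) (auto simp: bend_bounds)
  finally show ?thesis by (simp add: rate_def)
qed

lemma rate_phase:
  assumes "\<And>k. k < n \<Longrightarrow> inn k (a k) x y" "\<And>k. n < k \<Longrightarrow> bend k x y = 0"
  shows "rate x y = 1 / ps n - bend n x y"
proof -
  have "(\<Sum>k. bend k x y) = (\<Sum>k\<in>{..<Suc n}. bend k x y)"
    by (rule suminf_finite) (use assms(2) in auto)
  also have "\<dots> = (\<Sum>k<n. 1 / ps k - 1 / ps (Suc k)) + bend n x y"
  proof -
    have "(\<Sum>k<n. bend k x y) = (\<Sum>k<n. 1 / ps k - 1 / ps (Suc k))"
      by (rule sum.cong) (simp_all add: inn_bend assms(1))
    then show ?thesis by simp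
  qed
  finally show ?thesis by (simp add: rate_def telescope)
qed

lemma track_exists:
  obtains X where "X y0 = x0"
    "\<And>y. y \<in> {y0..y0 + 1} \<Longrightarrow> (X has_real_derivative rate (X y) y) (at y within {y0..y0 + 1})"
  using Peano_existence[OF rate_continuous rate_bounds, of y0 "y0 + 1" x0] by auto

lemma start_range: "0 \<le> y0 - snd (a n)" "y0 - snd (a n) \<le> ls n"
  using in_cell[of n] by (auto simp: cell_def)

end

locale track = singular_point +
  fixes X :: "real \<Rightarrow> real"
  assumes X0: "X y0 = x0"
    and X_deriv: "\<And>y. y \<in> {y0..y0 + 1} \<Longrightarrow> (X has_real_derivative rate (X y) y) (at y within {y0..y0 + 1})"
begin

lemma X_increment:
  assumes "y0 \<le> y" "y < y'" "y' \<le> y0 + 1"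
  obtains z where "y < z" "z < y'" "X y' - X y = (y' - y) * rate (X z) z"
proof -
  have "continuous_on {y..y'} X"
    by (rule continuous_on_subset[OF DERIV_continuous_on[OF X_deriv]]) (use assms in auto)
  moreover have "(X has_real_derivative rate (X z) z) (at z)" if "y < z" "z < y'" for z
    using X_deriv[of z] that assms by (metis at_within_Icc_at atLeastAtMost_iff less_imp_le le_less_trans less_le_trans)
  ultimately obtain z where "y < z" "z < y'" "X y' - X y = (y' - y) * rate (X z) z"
    using mvt[of y y' X "\<lambda>z d. rate (X z) z * d"] assms
    by (metis has_field_derivative_def mult.commute)
  then show ?thesis using that by blast
qed

lemma X_increment_le:
  assumes "y0 \<le> y" "y \<le> y'" "y' \<le> y0 + 1" "\<And>z. y < z \<Longrightarrow> z < y' \<Longrightarrow> rate (X z) z \<le> c"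
  shows "X y' - X y \<le> c * (y' - y)"
proof (cases "y = y'")
  case False
  then obtain z where z: "y < z" "z < y'" "X y' - X y = (y' - y) * rate (X z) z"
    using X_increment[of y y'] assms by auto
  then have "(y' - y) * rate (X z) z \<le> (y' - y) * c" using assms(4)[of z] by (intro mult_left_mono) auto
  then show ?thesis using z by (simp add: mult.commute)
qed simp

lemma X_increment_ge:
  assumes "y0 \<le> y" "y \<le> y'" "y' \<le> y0 + 1" "\<And>z. y < z \<Longrightarrow> z < y' \<Longrightarrow> c \<le> rate (X z) z"
  shows "c * (y' - y) \<le> X y' - X y"
proof (cases "y = y'")
  case False
  then obtain z where z: "y < z" "z < y'" "X y' - X y = (y' - y) * rate (X z) z"
    using X_increment[of y y'] assms by auto
  then have "(y' - y) * c \<le> (y' - y) * rate (X z) z" using assms(4)[of z] by (intro mult_left_mono) auto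
  then show ?thesis using z by (simp add: mult.commute)
qed simp

lemma X_mono: "y0 \<le> y \<Longrightarrow> y \<le> y' \<Longrightarrow> y' \<le> y0 + 1 \<Longrightarrow> X y \<le> X y'"
  using X_increment_ge[of y y' 0] rate_bounds(1) by simp

lemma Yr_along: "Yr n b (X y) y = Yr n b x0 y0 + (y - y0) - Bs n * (X y - x0)"
  by (simp add: Yr_def algebra_simps)

text \<open>
  In the cores of all levels below \<open>n\<close> the rate is at most \<open>1 / ps n\<close>, half of \<open>1 / Bs n\<close>.  So the track climbs
  away from the segment of level \<open>n\<close>, but too slowly to leave the core of level \<open>n - 1\<close>, which is much wider.
\<close>
lemma track_inner:
  assumes "y0 \<le> y" "y - y0 \<le> reach n"
  shows "\<forall>k<n. inn k (a k) (X y) y" "X y - x0 \<le> (y - y0) / ps n"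
    "- (rs n / 16) + (y - y0) / 2 \<le> Yr n (a n) (X y) y"
proof -
  have "(\<forall>k<n. inn k (a k) (X y) y) \<and> X y - x0 \<le> (y - y0) / ps n \<and>
    - (rs n / 16) + (y - y0) / 2 \<le> Yr n (a n) (X y) y"
    using assms
  proof (induction n arbitrary: y rule: less_induct)
    case (less n)
    have y1: "y \<le> y0 + 1" using less.prems reach_decreasing[of 0 n] by (simp add: reach_def)
    have inn: "inn k (a k) (X z) z" if z: "y0 \<le> z" "z \<le> y" and k: "k < n" for k z
    proof -
      have zn: "z - y0 \<le> reach (Suc k)" using z less.prems(2) reach_decreasing[of "Suc k" n] k by simp
      then have "z - y0 \<le> reach k" using reach_decreasing[of k "Suc k"] by simp
      then have lo: "- (rs k / 16) + (z - y0) / 2 \<le> Yr k (a k) (X z) z" using less.IH[OF k z(1)] by blast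
      have "0 \<le> Bs k * (X z - x0)" using X_mono[of y0 z] z y1 X0 Bs_facts(1)[of k] by simp
      then have "Yr k (a k) (X z) z \<le> rs k / 16 + (z - y0)"
        using abs_le_D1[OF central[of k]] unfolding Yr_along by argo
      then have "\<bar>Yr k (a k) (X z) z\<bar> \<le> rs k"
        using lo zn z(1) rs_pos[of k] unfolding reach_Suc abs_le_iff by argo
      moreover have "0 \<le> z - snd (a k)" "z - snd (a k) \<le> ls k + ts k"
        using start_range[of k] zn z rs_le_ts[of k] rs_pos[of k] unfolding reach_Suc by auto
      ultimately show ?thesis by (simp add: inn_def)
    qed
    have "X y - X y0 \<le> 1 / ps n * (y - y0)"
      by (rule X_increment_le) (use less.prems y1 inn in \<open>auto intro!: rate_inn\<close>)
    then have le: "X y - x0 \<le> (y - y0) / ps n" by (simp add: X0)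
    have "Bs n * (X y - x0) \<le> Bs n * ((y - y0) / ps n)" using le Bs_facts(1)[of n] by (intro mult_left_mono) auto
    also have "\<dots> = (y - y0) / 2" using Bs_facts(1)[of n] by (simp add: ps_def)
    finally have "- (rs n / 16) + (y - y0) / 2 \<le> Yr n (a n) (X y) y"
      using abs_le_D2[OF central[of n]] unfolding Yr_along by argo
    then show ?case using le inn less.prems by blast
  qed
  then show "\<forall>k<n. inn k (a k) (X y) y" "X y - x0 \<le> (y - y0) / ps n"
    "- (rs n / 16) + (y - y0) / 2 \<le> Yr n (a n) (X y) y" by auto
qed

text \<open>
  Above the slot of its own strip the track is steeper than the line along which the siblings are placed, and hence passes them
  on their upper left side.
\<close>
lemma siblings_out:
  assumes y: "y0 \<le> y" "y - y0 \<le> reach n" and b: "b \<in> anchors n" "b \<noteq> a n"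
  shows "out n b (X y) y"
proof (rule ccontr)
  assume no: "\<not> out n b (X y) y"
  show False
  proof (cases n)
    case 0
    then show False using b anchor[of 0] by simp
  next
    case (Suc k)
    obtain c i' where c: "c \<in> anchors k" "i' < N k" "b = child k c i'" using b(1) Suc by auto
    have "inn k c (X y) y" using child_inn[OF c(2)] no c(3) Suc by blast
    moreover have "inn k (a k) (X y) y" using track_inner(1)[OF y] Suc by simp
    ultimately have ck: "c = a k" using not_out_unique[OF anchor c(1)] inn_not_out by metis
    obtain i where i: "i < N k" "a n = child k (a k) i" using branch[of k] Suc by auto
    note d = not_outD[OF no]
    have u: "us k = ls n + 5 * ts n" using us_eq[of k] Suc by simp
    have "i \<noteq> i'" using i c ck b(2) by auto
    have sb: "snd b - snd (a n) = (real i' - real i) * us k" using c(3) i(2) ck by (simp add: child_def algebra_simps)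
    have "i < i'"
    proof (rule ccontr)
      assume "\<not> i < i'"
      then have "1 \<le> real i - real i'" using \<open>i \<noteq> i'\<close> by simp
      then have "1 * us k \<le> (real i - real i') * us k" using us_pos[of k] by (intro mult_right_mono) auto
      then have "snd b + us k \<le> snd (a n)" using sb by (simp add: algebra_simps)
      then show False using d(2) y start_range(1)[of n] u ts_pos[of n] by linarith
    qed
    then have i1: "1 \<le> real i' - real i" by simp
    define e where "e = (real i' - real i) * us k"
    have ue: "us k \<le> e" unfolding e_def using mult_right_mono[OF i1, of "us k"] us_pos[of k] by simp
    have B: "Bs n = 4 * Bs k" "Bs k > 0" using Bs_facts[of k] Suc by auto
    have "fst b - fst (a n) = e / Bs k" using c(3) i(2) ck B by (simp add: child_def e_def field_simps)
    then have fb: "Bs n * (fst b - fst (a n)) = 4 * e" using B by simp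
    have "Bs n * (X y - x0) \<le> Bs n * ((y - y0) / ps n)"
      using track_inner(2)[OF y] Bs_facts(1)[of n] by (intro mult_left_mono) auto
    also have "\<dots> = (y - y0) / 2" using Bs_facts(1)[of n] by (simp add: ps_def)
    finally have X1: "Bs n * (X y - x0) \<le> (y - y0) / 2" .
    have x1: "Bs n * (x0 - fst (a n)) \<le> ls n + rs n" using cell_width(1)[OF in_cell[of n]] .
    have "Yr n b (X y) y = (y - snd b) - Bs n * (X y - x0) - Bs n * (x0 - fst (a n)) + Bs n * (fst b - fst (a n))"
      by (simp add: Yr_def algebra_simps)
    then have "Yr n b (X y) y \<ge> - ts n - (y - y0) / 2 - (ls n + rs n) + 4 * e"
      using X1 x1 fb d(1) by linarith
    moreover have "y - y0 \<le> ls n + 4 * ts n + e" using d(2) sb start_range(1)[of n] unfolding e_def by linarith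
    ultimately show False using d(3) ue u rs_le_ts[of n] ts_le_ls[of n] ts_pos[of n] rs_pos[of n] by argo
  qed
qed

text \<open>
  By now the track has climbed further above the segment of level \<open>n\<close> than any strip inside this core.
\<close>
lemma deeper_out:
  assumes y: "reach (Suc n) < y - y0" "y - y0 \<le> reach n" and m: "n < m" and b: "b \<in> anchors m"
  shows "out m b (X y) y"
proof (rule ccontr)
  assume "\<not> out m b (X y) y"
  then obtain b' where b': "b' \<in> anchors (Suc n)" "\<not> out (Suc n) b' (X y) y"
    using not_out_ancestor[OF b] m by (metis Suc_leI)
  then obtain c i where c: "c \<in> anchors n" "i < N n" "b' = child n c i" by auto
  have y0: "y0 \<le> y" using y(1) reach_pos[of "Suc n"] by simp
  have no: "\<not> out n c (X y) y" using child_inn[OF c(2)] b'(2) c(3) inn_not_out by blast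
  then have "c = a n" using siblings_out[OF y0 y(2) c(1)] by blast
  then have "\<bar>Yr n (a n) (X y) y\<bar> \<le> rs n / 16" using child_support(3)[OF c(2)] b'(2) c(3) by blast
  then have "Yr n (a n) (X y) y \<le> rs n / 16" by (rule abs_le_D1)
  then show False using track_inner(3)[OF y0 y(2)] y(1) rs_pos[of n] unfolding reach_Suc by argo
qed

text \<open>
  Between \<open>reach (n + 1)\<close> and \<open>reach n\<close> only the strip of level \<open>n\<close> bends the track.  Either it is still within
  the full height of this strip, and \<open>transition_gain\<close> applies, or it has left the strip with slope \<open>ps n\<close>.
\<close>
lemma phase_facts:
  assumes y: "reach (Suc n) < y - y0" "y - y0 \<le> reach n"
  shows "1 / ps (Suc n) \<le> rate (X y) y"
    "\<And>m. n < m \<Longrightarrow> excess m (X y) y (1 / rate (X y) y) = 0"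
    "\<And>m. n < m \<Longrightarrow> Psum m (X y) y = 0"
proof -
  let ?s = "1 / rate (X y) y"
  have y0: "y0 \<le> y" using y(1) reach_pos[of "Suc n"] by simp
  note inner = track_inner[OF y0 y(2)]
  have p: "0 < ps n" using ps_facts(1)[of n] by simp
  have Z0: "bend k (X y) y = 0" if "n < k" for k
  proof -
    have "rs n \<le> 2 * (y - y0)" using y(1) unfolding reach_Suc by simp
    moreover have "32 * us n \<le> rs n" by (rule us_le_rs)
    moreover have "ls k + 3 * ts k \<le> 2 * us n"
      using ls_decreasing[of "Suc n" k] that ts_le_ls[of k] us_eq[of n] ts_pos[of "Suc n"] ls_pos[of "Suc n"] by linarith
    ultimately have "ls k + 3 * ts k \<le> y - snd (a k)"
      using start_range(1)[of k] us_pos[of n] by argo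
    then show ?thesis unfolding bend_def using lev.Z_facts(6)[of "y - snd (a k)" k] by simp
  qed
  have r: "rate (X y) y = 1 / ps n - bend n (X y) y" by (rule rate_phase) (use inner(1) Z0 in auto)
  show r1: "1 / ps (Suc n) \<le> rate (X y) y" using bend_bounds(2)[of n "X y" y] r by linarith
  show P0: "Psum m (X y) y = 0" if "n < m" for m
    unfolding Psum_def using deeper_out[OF y that] lev.outside_zero(1) by (intro sum.neutral) (auto simp: out_def)
  have K0: "Ksum m (X y) y s = 0" if "n < m" for m s
    using Ksum_outside(1)[of m] deeper_out[OF y that] by blast
  have rpos: "0 < rate (X y) y" using r1 ps_facts(1)[of "Suc n"] by (smt (verit) divide_pos_pos)
  have "rate (X y) y \<le> 1 / ps n" using rate_inn inner(1) by blast
  then have s: "ps n \<le> ?s" using rpos p by (simp add: field_simps)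
  have ex: "excess n (X y) y ?s = D (ps n) ?s"
    by (rule excess_on_branch[of n a]) (use inner(1) anchor s in auto)
  have "excess (Suc n) (X y) y ?s = 0"
  proof (cases "y - snd (a n) \<le> ls n + 3 * ts n / 2")
    case True
    have y1: "0 \<le> y - snd (a n)" using start_range(1)[of n] y0 by linarith
    have "lev.Z n (y - snd (a n)) = 1" using True y1 ts_pos[of n] by (intro lev.Z_facts(4)) auto
    then have "rate (X y) y = 1 / lev.slope n (Yr n (a n) (X y) y)" using r by (simp add: bend_def)
    then have seq: "?s = lev.slope n ((y - snd (a n)) - Bs n * (X y - fst (a n)))" by (simp add: Yr_def)
    have "- rs n \<le> (y - snd (a n)) - Bs n * (X y - fst (a n))"
      using inner(3) y0 rs_pos[of n] unfolding Yr_def by argo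
    from lev.transition_gain[OF y1 True this seq]
    have "D (ps n) ?s + lev.gain n (X y - fst (a n)) (y - snd (a n)) ?s = 0" .
    moreover have "Ksum n (X y) y ?s = lev.gain n (X y - fst (a n)) (y - snd (a n)) ?s"
      by (rule Ksum_single(2)[OF anchor siblings_out[OF y0 y(2)]])
    ultimately show ?thesis using ex by (simp add: excess_def)
  next
    case False
    then have "3 * ts n / 2 < y - y0" using start_range(2)[of n] by linarith
    then have Y3: "3 * rs n \<le> Yr n (a n) (X y) y" using inner(3) rs_le_ts[of n] rs_pos[of n] by argo
    then have o: "out n (a n) (X y) y" by (simp add: out_def lev.outside_def Yr_def)
    have "lev.slope n (Yr n (a n) (X y) y) = ps n" using Y3 rs_pos[of n] by (intro lev.off_bump(1)) auto
    then have "rate (X y) y = 1 / ps n" using r by (simp add: bend_def)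
    then have "?s = ps n" by simp
    moreover have "Ksum n (X y) y ?s = 0"
      by (rule Ksum_outside(1)) (use o siblings_out[OF y0 y(2)] in blast)
    ultimately show ?thesis using ex D_self by (simp add: excess_def)
  qed
  then show "excess m (X y) y ?s = 0" if "n < m" for m
    using that
  proof (induction m)
    case (Suc m)
    then show ?case using K0[of m] by (cases "n = m") (auto simp: excess_def less_Suc_eq)
  qed simp
qed

end

section \<open>The Lagrangian and its minimizers\<close>

context construction begin

text \<open>
  For every slope \<open>s\<close> the series is finite, because \<open>hs n s = 0\<close> for \<open>n \<ge> s\<close>.
\<close>
definition F where "F = (\<lambda>(x, y, s). \<Sum>n. Psum n x y * hs n s)"
definition L where "L = (\<lambda>(x, y, s). w s + F (x, y, s))"

lemma hs_0: "s \<le> real n \<Longrightarrow> hs n s = 0"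
proof -
  have "real n + 1 \<le> cs n"
  proof (induction n)
    case (Suc n)
    then show ?case by (simp add: cs_def Bs_def)
  qed (simp add: cs_def Bs_def)
  then show "s \<le> real n \<Longrightarrow> hs n s = 0" unfolding hs_def using k0 by (intro h_0) auto
qed

lemma F_finite:
  assumes "s \<le> real M" shows "F (x, y, s) = (\<Sum>n<M. Psum n x y * hs n s)"
  unfolding F_def prod.case
  by (rule suminf_finite) (use hs_0 assms in auto)

lemma Psum_nonneg: "0 \<le> Psum n x y"
  unfolding Psum_def by (intro sum_nonneg lev.psi_nonneg)

lemma F_nonneg: "0 \<le> F (x, y, s)"
proof -
  obtain M :: nat where "s \<le> real M" using real_arch_simple by blast
  then show ?thesis using Psum_nonneg lev.h_nonneg by (auto simp: F_finite intro!: sum_nonneg)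
qed

lemma F_0: "F (x, y, 0) = 0" using F_finite[of 0 0 x y] by simp

lemma hs_convex: "convex_on UNIV (hs n)"
proof (rule convex_onI)
  fix t x y :: real assume t: "0 < t" "t < 1"
  have eq: "(1 - t) *\<^sub>R x + t *\<^sub>R y - cs n + k0 = (1 - t) *\<^sub>R (x - cs n + k0) + t *\<^sub>R (y - cs n + k0)"
    by (simp add: algebra_simps)
  show "hs n ((1 - t) *\<^sub>R x + t *\<^sub>R y) \<le> (1 - t) * hs n x + t * hs n y"
    unfolding hs_def eq by (rule convex_onD[OF h_convex]) (use t in auto)
qed simp

lemma F_convex: "convex_on UNIV (\<lambda>s. F (x, y, s))"
proof (rule convex_onI)
  fix t s s' :: real assume t: "0 < t" "t < 1"
  let ?z = "(1 - t) *\<^sub>R s + t *\<^sub>R s'"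
  obtain M :: nat where "max ?z (max s s') \<le> real M" using real_arch_simple by blast
  then have M: "?z \<le> real M" "s \<le> real M" "s' \<le> real M" by auto
  have "(\<Sum>n<M. Psum n x y * hs n ?z) \<le> (\<Sum>n<M. Psum n x y * ((1 - t) * hs n s + t * hs n s'))"
    using t by (intro sum_mono mult_left_mono Psum_nonneg convex_onD[OF hs_convex]) auto
  also have "\<dots> = (1 - t) * (\<Sum>n<M. Psum n x y * hs n s) + t * (\<Sum>n<M. Psum n x y * hs n s')"
    by (simp add: sum_distrib_left sum.distrib[symmetric] algebra_simps)
  finally show "F (x, y, ?z) \<le> (1 - t) * F (x, y, s) + t * F (x, y, s')"
    unfolding F_finite[OF M(1)] F_finite[OF M(2)] F_finite[OF M(3)] .
qed simp

lemma F_smooth: "smooth F"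
proof (rule smooth_local)
  fix z :: "real \<times> real \<times> real"
  obtain M :: nat where M: "snd (snd z) < real M" using reals_Archimedean2 by blast
  have c: "smooth (\<lambda>z :: real \<times> real \<times> real. fst z)" "smooth (\<lambda>z :: real \<times> real \<times> real. fst (snd z))"
    "smooth (\<lambda>z :: real \<times> real \<times> real. snd (snd z))"
    by (intro smooth_bounded_linear bounded_linear_fst bounded_linear_compose[OF bounded_linear_fst bounded_linear_snd]
        bounded_linear_compose[OF bounded_linear_snd bounded_linear_snd])+
  have "smooth (\<lambda>z :: real \<times> real \<times> real. \<Sum>n<M. Psum n (fst z) (fst (snd z)) * hs n (snd (snd z)))"
    unfolding Psum_def hs_def
    by (intro smooth_sum smooth_mult lev.smooth_psi smooth_diff smooth_const c smooth_compose[OF h_smooth]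
        smooth_add finite_anchors finite_lessThan)
  moreover have "open {z :: real \<times> real \<times> real. snd (snd z) < real M}"
    by (intro open_Collect_less continuous_intros)
  moreover have "F z' = (\<Sum>n<M. Psum n (fst z') (fst (snd z')) * hs n (snd (snd z')))"
    if "snd (snd z') < real M" for z'
    using F_finite[of "snd (snd z')" M "fst z'" "fst (snd z')"] that by simp
  ultimately show "\<exists>U g. open U \<and> z \<in> U \<and> smooth g \<and> (\<forall>z'\<in>U. F z' = g z')"
    using M by (intro exI[of _ "{z. snd (snd z) < real M}"] exI conjI) auto
qed

lemma L_continuous: "continuous_on UNIV L"
proof -
  have "continuous_on UNIV (\<lambda>z. w (snd (snd z)) + F z)"
    by (intro continuous_intros smooth_continuous[OF F_smooth] continuous_on_compose2[OF smooth_continuous[OF w_smooth]]) auto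
  moreover have "L = (\<lambda>z. w (snd (snd z)) + F z)" by (auto simp: L_def fun_eq_iff)
  ultimately show ?thesis by simp
qed

lemma L_nonneg: "0 \<le> L z"
  using F_nonneg w_nonneg by (cases z) (auto simp: L_def)

lemma lagrangian_L:
  assumes "superlinear w" shows "lagrangian L"
  unfolding lagrangian_def
proof (intro conjI allI)
  show "L \<in> borel_measurable borel" using L_continuous by (rule borel_measurable_continuous_onI)
  show "bdd_below (range L)" using L_nonneg by (intro bdd_belowI2[of _ 0]) auto
  show "\<exists>U. open U \<and> z \<in> U \<and> bdd_above (L ` U)" for z
  proof (intro exI[of _ "{z'. L z' < L z + 1}"] conjI)
    show "open {z'. L z' < L z + 1}" by (intro open_Collect_less L_continuous continuous_intros)
    show "bdd_above (L ` {z'. L z' < L z + 1})" by (rule bdd_aboveI[of _ "L z + 1"]) auto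
  qed auto
  show "\<exists>\<omega>. superlinear \<omega> \<and> (\<forall>x y p. \<omega> p \<le> L (x, y, p))"
    using assms F_nonneg by (intro exI[of _ w]) (auto simp: L_def)
qed

text \<open>
  The potential of the calibration, truncated to levels below \<open>M\<close>, and its derivative in direction \<open>(1, s)\<close>.
\<close>
definition H0 where "H0 = ps 0 * w' (ps 0) - w (ps 0)"
definition pot where "pot M x y = w' (ps 0) * y - H0 * x +
   (\<Sum>n<M. \<Sum>a\<in>anchors n. lev.delta n (x - fst a) (y - snd a))"
definition dpot where "dpot M x y s = w' (ps 0) * s - H0 + (\<Sum>n<M. Gsum n x y s)"

lemma pot_along:
  assumes "(v has_real_derivative s) (at x)"
  shows "((\<lambda>x. pot M x (v x)) has_real_derivative dpot M x (v x) s) (at x)"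
  unfolding pot_def dpot_def Gsum_def
  by (intro DERIV_add DERIV_sum lev.delta_along assms DERIV_cong[OF DERIV_diff[OF DERIV_cmult[OF assms] DERIV_cmult_Id]]) auto

lemma pot_AC:
  assumes "v \<in> AC a b" shows "(\<lambda>x. pot M x (v x)) \<in> AC a b"
proof -
  have "(\<lambda>x. w' (ps 0) * v x + (- H0) * x + (\<Sum>n<M. \<Sum>a\<in>anchors n. lev.delta n (x - fst a) (v x - snd a))) \<in> AC a b"
    by (intro AC_add AC_cmult AC_ident AC_sum lev.delta_AC assms finite_anchors finite_lessThan)
  then show ?thesis by (simp add: pot_def)
qed

lemma excess_eq: "w s + (\<Sum>n<M. Psum n x y * hs n s) - dpot M x y s = excess M x y s"
  unfolding excess_def dpot_def H0_def Ksum_def bregman_def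
  by (simp add: sum_subtractf algebra_simps)

lemma L_ge_truncated: "w s + (\<Sum>n<M. Psum n x y * hs n s) \<le> L (x, y, s)"
proof -
  obtain k :: nat where "s \<le> real k" using real_arch_simple by blast
  then have k: "s \<le> real (max k M)" by auto
  have "(\<Sum>n<M. Psum n x y * hs n s) \<le> (\<Sum>n<max k M. Psum n x y * hs n s)"
    by (intro sum_mono2 mult_nonneg_nonneg Psum_nonneg lev.h_nonneg) auto
  then show ?thesis by (simp add: L_def F_finite[OF k])
qed

lemma L_ge_dpot: "dpot M x y s \<le> L (x, y, s)"
  using L_ge_truncated[where M = M and s = s and x = x and y = y]
    excess_eq[where M = M and s = s and x = x and y = y] excess_bounds[of M x y s] by linarith

lemma action_eq: "action L v a b = enn2ereal (\<integral>\<^sup>+x\<in>{a..b}. ennreal (L (x, v x, deriv v x)) \<partial>lborel)"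
proof -
  have "ennreal (- L z) = 0" for z using L_nonneg[of z] by (simp add: ennreal_neg)
  then show ?thesis unfolding action_def by (simp add: zero_ennreal.rep_eq)
qed

text \<open>
  The calibration inequality, integrated along an arbitrary competitor.  It holds for every truncation
  \<open>M\<close>, so competitors may run into the staircase, where the untruncated potential would not be differentiable.
\<close>
lemma pot_lower_bound:
  assumes v: "v \<in> AC a b" and ab: "a < b"
  shows "ennreal (pot M b (v b) - pot M a (v a)) \<le> (\<integral>\<^sup>+x\<in>{a..b}. ennreal (L (x, v x, deriv v x)) \<partial>lborel)"
proof -
  obtain Nl where Nl: "negligible Nl" "\<And>x. a < x \<Longrightarrow> x < b \<Longrightarrow> x \<notin> Nl \<Longrightarrow> v differentiable (at x)"
    using AC_differentiable_ae[OF v] by blast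
  show ?thesis
  proof (rule AC_increment_le_nn_integral[OF pot_AC[OF v] ab Nl(1)])
    fix x assume "a < x" "x < b" "x \<notin> Nl"
    then have "v field_differentiable (at x)" using Nl(2) by (simp add: field_differentiable_def real_differentiable_def)
    then have "(v has_real_derivative deriv v x) (at x)" by (simp add: DERIV_deriv_iff_field_differentiable)
    from pot_along[OF this] show "((\<lambda>x. pot M x (v x)) has_real_derivative dpot M x (v x) (deriv v x)) (at x) \<and>
      dpot M x (v x) (deriv v x) \<le> L (x, v x, deriv v x)" using L_ge_dpot by blast
  qed
qed

end

context track begin

definition b where "b = X (y0 + 1)"
definition u where "u = inv_into {y0..y0 + 1} X"

lemma rate_pos: "y0 < y \<Longrightarrow> y \<le> y0 + 1 \<Longrightarrow> 0 < rate (X y) y"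
proof -
  assume "y0 < y" "y \<le> y0 + 1"
  then obtain n where "reach (Suc n) < y - y0" "y - y0 \<le> reach n" using phase_exists[of "y - y0"] by auto
  from phase_facts(1)[OF this] show "0 < rate (X y) y"
    using ps_facts(1)[of "Suc n"] by (smt (verit) divide_pos_pos)
qed

lemma rate_ge:
  assumes "reach (Suc n) < y - y0" "y \<le> y0 + 1"
  shows "1 / ps (Suc n) \<le> rate (X y) y"
proof -
  have "0 < y - y0" using assms(1) reach_pos[of "Suc n"] by linarith
  then obtain m where m: "reach (Suc m) < y - y0" "y - y0 \<le> reach m" using phase_exists[of "y - y0"] assms(2) by auto
  have "m \<le> n"
  proof (rule ccontr)
    assume "\<not> m \<le> n"
    then have "reach m \<le> reach (Suc n)" by (intro reach_decreasing) simp
    then show False using m(2) assms(1) by linarith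
  qed
  then have "1 / ps (Suc n) \<le> 1 / ps (Suc m)"
    using ps_mono[of "Suc m" "Suc n"] ps_facts(1)[of "Suc m"] by (intro divide_left_mono) auto
  then show ?thesis using phase_facts(1)[OF m] by linarith
qed

lemma X_strict: "y0 \<le> y \<Longrightarrow> y < y' \<Longrightarrow> y' \<le> y0 + 1 \<Longrightarrow> X y < X y'"
proof -
  assume y: "y0 \<le> y" "y < y'" "y' \<le> y0 + 1"
  then obtain z where "y < z" "z < y'" "X y' - X y = (y' - y) * rate (X z) z" using X_increment by blast
  then show "X y < X y'" using rate_pos[of z] y by (smt (verit) mult_pos_pos)
qed

lemma X_inj: "inj_on X {y0..y0 + 1}"
  by (rule linorder_inj_onI) (use X_strict in \<open>auto simp: less_imp_neq\<close>)

lemma X_cont: "continuous_on {y0..y0 + 1} X" by (rule DERIV_continuous_on[OF X_deriv])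

lemma X_image: "X ` {y0..y0 + 1} = {x0..b}"
proof
  show "X ` {y0..y0 + 1} \<subseteq> {x0..b}" using X_mono[of y0] X_mono[of _ "y0 + 1"] by (auto simp: b_def X0)
  show "{x0..b} \<subseteq> X ` {y0..y0 + 1}"
  proof
    fix x assume x: "x \<in> {x0..b}"
    then have "\<exists>y\<ge>y0. y \<le> y0 + 1 \<and> X y = x" using X_cont by (intro IVT') (auto simp: X0 b_def)
    then show "x \<in> X ` {y0..y0 + 1}" by auto
  qed
qed

lemma x0_b: "x0 < b" using X_strict[of y0 "y0 + 1"] by (simp add: X0 b_def)

lemma u_X: "y0 \<le> y \<Longrightarrow> y \<le> y0 + 1 \<Longrightarrow> u (X y) = y"
  unfolding u_def by (rule inv_into_f_f[OF X_inj]) simp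

lemma X_u: "x \<in> {x0..b} \<Longrightarrow> X (u x) = x"
  unfolding u_def by (rule f_inv_into_f) (simp add: X_image)

lemma u_range: "x \<in> {x0..b} \<Longrightarrow> y0 \<le> u x \<and> u x \<le> y0 + 1"
  using inv_into_into[of x X "{y0..y0 + 1}"] X_image unfolding u_def by auto

lemma u_ends: "u x0 = y0" "u b = y0 + 1" using u_X[of y0] u_X[of "y0 + 1"] by (auto simp: X0 b_def)

lemma u_strict: "x0 \<le> x \<Longrightarrow> x < x' \<Longrightarrow> x' \<le> b \<Longrightarrow> u x < u x'"
proof -
  assume x: "x0 \<le> x" "x < x'" "x' \<le> b"
  show "u x < u x'"
  proof (rule ccontr)
    assume "\<not> u x < u x'"
    then have "X (u x') \<le> X (u x)" using u_range[of x] u_range[of x'] x by (intro X_mono) auto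
    then show False using X_u[of x] X_u[of x'] x by auto
  qed
qed

lemma u_mono: "x0 \<le> x \<Longrightarrow> x \<le> x' \<Longrightarrow> x' \<le> b \<Longrightarrow> u x \<le> u x'"
  using u_strict[of x x'] by (cases "x = x'") auto

lemma u_cont: "continuous_on {x0..b} u"
  using continuous_on_inv[OF X_cont, of u] u_X X_image by auto

lemma u_deriv:
  assumes "x0 < x" "x < b" shows "(u has_real_derivative 1 / rate x (u x)) (at x)"
proof -
  have ur: "y0 < u x" "u x < y0 + 1" using u_strict[of x0 x] u_strict[of x b] assms u_ends by auto
  have "(X has_real_derivative rate (X (u x)) (u x)) (at (u x))"
    using X_deriv[of "u x"] ur by (metis at_within_Icc_at atLeastAtMost_iff less_imp_le)
  then have d: "(X has_real_derivative rate x (u x)) (at (u x))" using X_u[of x] assms by auto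
  have "rate x (u x) \<noteq> 0" using rate_pos[of "u x"] ur X_u[of x] assms by auto
  moreover have "isCont u x" using u_cont assms by (intro continuous_on_interior[of "{x0..b}"]) auto
  ultimately have "(u has_real_derivative inverse (rate x (u x))) (at x)"
    by (intro DERIV_inverse_function[where f = X and a = x0 and b = b]) (use d X_u assms in auto)
  then show ?thesis by (simp add: inverse_eq_divide)
qed

lemma u_AC: "u \<in> AC x0 b"
proof (rule AC_monotone_locally_lipschitz[OF x0_b u_mono])
  fix e :: real assume e: "e > 0"
  define d where "d = min 1 (e / 2)"
  have d: "0 < d" "d \<le> 1" "d < e" using e by (auto simp: d_def)
  show "\<exists>x1. x0 < x1 \<and> x1 \<le> b \<and> u x1 - u x0 < e"
    using d X_strict[of y0 "y0 + d"] X_mono[of "y0 + d" "y0 + 1"] u_X[of "y0 + d"] u_ends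
    by (intro exI[of _ "X (y0 + d)"]) (auto simp: X0 b_def)
next
  fix x1 assume x1: "x0 < x1" "x1 \<le> b"
  have "0 < u x1 - y0" using u_strict[of x0 x1] x1 u_ends by auto
  then obtain n where n: "reach (Suc n) < u x1 - y0" "u x1 - y0 \<le> reach n"
    using phase_exists[of "u x1 - y0"] u_range[of x1] x1 by auto
  have p: "0 < ps (Suc n)" using ps_facts(1)[of "Suc n"] by simp
  have "u y - u x \<le> ps (Suc n) * (y - x)" if "x1 \<le> x" "x \<le> y" "y \<le> b" for x y
  proof -
    have r: "y0 \<le> u x" "u x \<le> u y" "u y \<le> y0 + 1" "u x1 \<le> u x"
      using u_range[of x] u_range[of y] u_mono[of x y] u_mono[of x1 x] that x1 by auto
    have "1 / ps (Suc n) * (u y - u x) \<le> X (u y) - X (u x)"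
      by (rule X_increment_ge) (use r n in \<open>auto intro!: rate_ge\<close>)
    then have "1 / ps (Suc n) * (u y - u x) \<le> y - x" using X_u[of x] X_u[of y] that x1 by auto
    then show ?thesis using p by (simp add: field_simps)
  qed
  then show "\<exists>C\<ge>0. \<forall>x y. x1 \<le> x \<longrightarrow> x \<le> y \<longrightarrow> y \<le> b \<longrightarrow> u y - u x \<le> C * (y - x)"
    using p by (intro exI[of _ "ps (Suc n)"]) auto
qed

text \<open>
  By \<open>track_inner\<close> the mean slope up to height \<open>reach n\<close> is at least \<open>ps n\<close>.
\<close>
lemma u_infinite_derivative: "has_infinite_derivative x0 b u x0"
proof -
  have "filterlim (\<lambda>x. (u x - u x0) / (x - x0)) at_top (at x0 within {x0..b})"
    unfolding filterlim_at_top
  proof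
    fix c :: real
    obtain n :: nat where n: "c \<le> real n" using real_arch_simple by blast
    have nps: "real n \<le> ps n"
    proof (induction n)
      case (Suc n)
      then show ?case using ps_facts(1,2)[of n] by simp
    qed (use ps_facts(1)[of 0] in simp)
    define x1 where "x1 = X (y0 + reach n)"
    have rn: "0 < reach n" "reach n \<le> 1" using reach_pos reach_decreasing[of 0 n] by (auto simp: reach_def)
    have x1: "x0 < x1" "x1 \<le> b" "u x1 = y0 + reach n"
      using rn X_strict[of y0 "y0 + reach n"] X_mono[of "y0 + reach n" "y0 + 1"] u_X by (auto simp: x1_def X0 b_def)
    have "c \<le> (u x - u x0) / (x - x0)" if x: "x0 < x" "x < x1" for x
    proof -
      have "u x - y0 \<le> reach n" using u_mono[of x x1] x x1 by auto
      moreover have xr: "x \<in> {x0..b}" using x x1 by auto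
      ultimately have "X (u x) - x0 \<le> (u x - y0) / ps n" using track_inner(2)[of "u x" n] u_range[OF xr] by blast
      then have "(x - x0) * ps n \<le> u x - y0" using X_u[OF xr] ps_facts(1)[of n] by (simp add: field_simps)
      then have "ps n \<le> (u x - y0) / (x - x0)" using x by (simp add: field_simps)
      then show ?thesis using n nps unfolding u_ends(1) by linarith
    qed
    then show "\<forall>\<^sub>F x in at x0 within {x0..b}. c \<le> (u x - u x0) / (x - x0)"
      unfolding eventually_at using x1 by (intro exI[of _ "x1 - x0"]) (auto simp: dist_real_def)
  qed
  then show ?thesis by (simp add: has_infinite_derivative_def)
qed

text \<open>
  The only level that acts at this height is below \<open>M\<close>, and there the excess vanishes.
\<close>
lemma L_on_track:
  assumes y: "y0 + reach M < y" "y \<le> y0 + 1"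
  shows "L (X y, y, 1 / rate (X y) y) = dpot M (X y) y (1 / rate (X y) y)"
proof -
  let ?s = "1 / rate (X y) y"
  have "0 < y - y0" using y(1) reach_pos[of M] by linarith
  then obtain n where n: "reach (Suc n) < y - y0" "y - y0 \<le> reach n" using phase_exists[of "y - y0"] y(2) by auto
  have nM: "n < M"
  proof (rule ccontr)
    assume "\<not> n < M"
    then have "reach n \<le> reach M" by (intro reach_decreasing) simp
    then show False using n(2) y(1) by linarith
  qed
  obtain k :: nat where "?s \<le> real k" using real_arch_simple by blast
  then have k: "?s \<le> real (max k M)" by auto
  have "(\<Sum>n<max k M. Psum n (X y) y * hs n ?s) = (\<Sum>n<M. Psum n (X y) y * hs n ?s)"
    by (rule sum.mono_neutral_right) (use phase_facts(3)[OF n] nM in auto)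
  then have "L (X y, y, ?s) = w ?s + (\<Sum>n<M. Psum n (X y) y * hs n ?s)" by (simp add: L_def F_finite[OF k])
  then show ?thesis using excess_eq[where M = M and s = ?s and x = "X y" and y = y] phase_facts(2)[OF n nM] by linarith
qed

text \<open>
  On the initial piece, inside the cores of all levels below \<open>M\<close>, the truncated potential is affine, and the
  track is so steep there that the potential increases along it.
\<close>
lemma pot_initial:
  assumes "0 < M"
  shows "pot M x0 y0 \<le> pot M (X (y0 + reach M)) (y0 + reach M)"
proof -
  define y where "y = y0 + reach M"
  have y: "y0 \<le> y" "y - y0 \<le> reach M" "0 \<le> y - y0" using reach_pos[of M] by (auto simp: y_def)
  note t = track_inner[OF y(1,2)]
  have pM: "0 < ps M" using ps_facts(1)[of M] by simp
  have dX: "X y - x0 \<ge> 0" using X_mono[of y0 y] y reach_decreasing[of 0 M] by (simp add: X0 reach_def)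
  have key: "0 \<le> (y - y0) - c * (X y - x0)" if "c \<le> ps M" for c
  proof -
    have "c * (X y - x0) \<le> ps M * (X y - x0)" using dX that by (intro mult_right_mono) auto
    also have "\<dots> \<le> ps M * ((y - y0) / ps M)" using t(2) pM by (intro mult_left_mono) auto
    finally show ?thesis using pM by simp
  qed
  have dd: "(\<Sum>a\<in>anchors k. lev.delta k (x0 - fst a) (y0 - snd a)) \<le> (\<Sum>a\<in>anchors k. lev.delta k (X y - fst a) (y - snd a))"
    if k: "k < M" for k
  proof -
    have i1: "inn k (a k) (X y) y" using t(1) k by blast
    have i0: "inn k (a k) x0 y0" using cell_inn[OF in_cell] .
    have single: "(\<Sum>a\<in>anchors k. lev.delta k (x - fst a) (z - snd a)) = lev.delta k (x - fst (a k)) (z - snd (a k))"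
      if "inn k (a k) x z" for x z
    proof (rule sum_single[OF finite_anchors _ anchor])
      fix c assume "c \<in> anchors k" "c \<noteq> a k"
      then have "out k c x z" using not_out_unique[OF anchor _ inn_not_out[OF that]] by blast
      then show "lev.delta k (x - fst c) (z - snd c) = 0" using lev.outside_zero(4) by (simp add: out_def)
    qed
    have "lev.delta k (X y - fst (a k)) (y - snd (a k)) - lev.delta k (x0 - fst (a k)) (y0 - snd (a k)) =
      lev.Xi k * (((y - snd (a k)) - (y0 - snd (a k))) - Bs k * ((X y - fst (a k)) - (x0 - fst (a k))))"
      by (rule lev.inner_delta_increment) (use i0 i1 in \<open>auto simp: inn_def Yr_def\<close>)
    also have "\<dots> = lev.Xi k * ((y - y0) - Bs k * (X y - x0))" by simp
    also have "\<dots> \<ge> 0"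
    proof (intro mult_nonneg_nonneg lev.Xi_nonneg key)
      show "Bs k \<le> ps M" using ps_mono[of k M] k ps_facts(3)[of k] Bs_facts(1)[of k] by simp
    qed
    finally show ?thesis unfolding single[OF i1] single[OF i0] by linarith
  qed
  have "H0 * (X y - x0) \<le> ps 0 * w' (ps 0) * (X y - x0)"
    using w_nonneg[of "ps 0"] dX by (intro mult_right_mono) (auto simp: H0_def)
  moreover have "0 \<le> w' (ps 0) * ((y - y0) - ps 0 * (X y - x0))"
    using ps_facts(1)[of 0] by (intro mult_nonneg_nonneg w'_nonneg key ps_mono) auto
  ultimately have "w' (ps 0) * y0 - H0 * x0 \<le> w' (ps 0) * y - H0 * X y" by (simp add: algebra_simps)
  then show ?thesis unfolding pot_def y_def[symmetric] by (intro add_mono sum_mono dd) auto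
qed

definition energy_density where "energy_density x = L (x, u x, 1 / rate x (u x))"

lemma energy_density_cont:
  assumes x1: "x0 < x1" shows "continuous_on {x1..b} energy_density"
proof -
  have c: "continuous_on {x1..b} (\<lambda>x. (x, u x))"
    using x1 by (intro continuous_intros continuous_on_subset[OF u_cont]) auto
  have "continuous_on {x1..b} (\<lambda>x. rate x (u x))"
    using continuous_on_compose2[OF rate_continuous c] by auto
  moreover have "rate x (u x) \<noteq> 0" if "x \<in> {x1..b}" for x
    using rate_pos[of "u x"] u_strict[of x0 x] u_range[of x] X_u[of x] that x1 u_ends by auto
  ultimately have "continuous_on {x1..b} (\<lambda>x. (x, u x, 1 / rate x (u x)))"
    using x1 by (intro continuous_intros continuous_on_subset[OF u_cont]) auto
  from continuous_on_compose2[OF L_continuous this] show ?thesis by (simp add: energy_density_def[abs_def])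
qed

lemma energy_density_measurable:
  assumes x1: "x0 < x1"
  shows "(\<lambda>x. ennreal (energy_density x) * indicator {x1..b} x) \<in> borel_measurable lborel"
proof -
  have "(\<lambda>x. indicator {x1..b} x *\<^sub>R energy_density x) \<in> borel_measurable borel"
    by (rule borel_measurable_continuous_on_indicator[OF _ energy_density_cont[OF x1]]) simp
  then have "(\<lambda>x. ennreal (indicator {x1..b} x *\<^sub>R energy_density x)) \<in> borel_measurable lborel" by measurable
  moreover have "ennreal (indicator {x1..b} x *\<^sub>R energy_density x) = ennreal (energy_density x) * indicator {x1..b} x" for x
    by (simp add: indicator_def)
  ultimately show ?thesis by simp
qed

lemma u_action_eq:
  "(\<integral>\<^sup>+x\<in>{x0..b}. ennreal (L (x, u x, deriv u x)) \<partial>lborel) = (\<integral>\<^sup>+x\<in>{x0..b}. ennreal (energy_density x) \<partial>lborel)"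
proof (rule nn_integral_cong_AE)
  have "AE x in lborel. x \<noteq> x0 \<and> x \<noteq> b" using AE_lborel_singleton[of x0] AE_lborel_singleton[of b] by eventually_elim auto
  then show "AE x in lborel. ennreal (L (x, u x, deriv u x)) * indicator {x0..b} x = ennreal (energy_density x) * indicator {x0..b} x"
  proof eventually_elim
    case (elim x)
    show ?case
    proof (cases "x \<in> {x0..b}")
      case True
      then have "deriv u x = 1 / rate x (u x)" using u_deriv[of x] elim by (intro DERIV_imp_deriv) auto
      then show ?thesis by (simp add: energy_density_def)
    qed simp
  qed
qed

lemma u_action_tail:
  assumes x: "x1 = X (y0 + reach M)"
  shows "(\<integral>\<^sup>+x\<in>{x1..b}. ennreal (energy_density x) \<partial>lborel) = ennreal (pot M b (u b) - pot M x1 (u x1))"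
proof -
  have rM: "0 < reach M" "reach M \<le> 1" using reach_pos reach_decreasing[of 0 M] by (auto simp: reach_def)
  have x1: "x0 < x1" "x1 \<le> b" "u x1 = y0 + reach M"
    using rM X_strict[of y0 "y0 + reach M"] X_mono[of "y0 + reach M" "y0 + 1"] u_X by (auto simp: x X0 b_def)
  define g where "g = (\<lambda>x. pot M x (u x))"
  have gc: "continuous_on {x1..b} g"
    using AC_imp_continuous_on[OF pot_AC[OF u_AC, of M]] continuous_on_subset x1 unfolding g_def by fastforce
  have gd: "(g has_real_derivative energy_density x) (at x)" if "x1 < x" "x < b" for x
  proof -
    have xr: "x \<in> {x0..b}" using that x1 by auto
    have "(g has_real_derivative dpot M x (u x) (1 / rate x (u x))) (at x)"
      unfolding g_def by (rule pot_along[OF u_deriv]) (use that x1 in auto)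
    moreover have "dpot M x (u x) (1 / rate x (u x)) = energy_density x"
      using L_on_track[of M "u x"] u_strict[of x1 x] u_range[OF xr] X_u[OF xr] that x1 by (simp add: energy_density_def)
    ultimately show ?thesis by simp
  qed
  have "(energy_density has_integral (g b - g x1)) {x1..b}"
    by (rule fundamental_theorem_of_calculus_interior[OF x1(2) gc])
      (use gd in \<open>auto simp: has_real_derivative_iff_has_vector_derivative\<close>)
  then have "((\<lambda>x. if x \<in> {x1..b} then energy_density x else 0) has_integral (g b - g x1)) UNIV"
    by (simp only: has_integral_restrict_UNIV)
  moreover have "(\<lambda>x. if x \<in> {x1..b} then energy_density x else 0) = (\<lambda>x. indicator {x1..b} x *\<^sub>R energy_density x)"
    by (auto simp: fun_eq_iff)
  ultimately have "((\<lambda>x. indicator {x1..b} x *\<^sub>R energy_density x) has_integral (g b - g x1)) UNIV" by simp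
  then have "(\<integral>\<^sup>+x. ennreal (indicator {x1..b} x *\<^sub>R energy_density x) \<partial>lborel) = ennreal (g b - g x1)"
    by (intro nn_integral_has_integral_lborel borel_measurable_continuous_on_indicator energy_density_cont x1)
      (auto simp: energy_density_def L_nonneg)
  moreover have "ennreal (indicator {x1..b} x *\<^sub>R energy_density x) = ennreal (energy_density x) * indicator {x1..b} x" for x
    by (simp add: indicator_def)
  ultimately show ?thesis by (simp add: g_def)
qed

text \<open>
  Up to height \<open>reach M\<close> the track is left out; beyond it the action is a difference of potentials, which by
  \<open>pot_initial\<close> is at most the lower bound for the competitor.  Monotone convergence then takes \<open>M\<close> to infinity.
\<close>
lemma u_action_le:
  assumes v: "v \<in> AC x0 b" "v x0 = y0" "v b = u b"
  shows "action L u x0 b \<le> action L v x0 b"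
proof -
  let ?J = "\<lambda>v. (\<integral>\<^sup>+x\<in>{x0..b}. ennreal (L (x, v x, deriv v x)) \<partial>lborel)"
  let ?f = "\<lambda>x. ennreal (energy_density x)"
  define xs where "xs = (\<lambda>M. X (y0 + reach (Suc M)))"
  have tail: "(\<integral>\<^sup>+x\<in>{xs M..b}. ?f x \<partial>lborel) \<le> ?J v" for M
  proof -
    have ux: "u (xs M) = y0 + reach (Suc M)" unfolding xs_def
      using reach_pos[of "Suc M"] reach_decreasing[of 0 "Suc M"] by (intro u_X) (auto simp: reach_def)
    have "(\<integral>\<^sup>+x\<in>{xs M..b}. ?f x \<partial>lborel) = ennreal (pot (Suc M) b (u b) - pot (Suc M) (xs M) (u (xs M)))"
      by (rule u_action_tail) (simp add: xs_def)
    also have "\<dots> \<le> ennreal (pot (Suc M) b (v b) - pot (Suc M) x0 (v x0))"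
      using pot_initial[of "Suc M"] v unfolding ux by (intro ennreal_leI) (simp add: xs_def)
    also have "\<dots> \<le> ?J v" by (rule pot_lower_bound[OF v(1) x0_b])
    finally show ?thesis .
  qed
  have xs_lim: "xs \<longlonglongrightarrow> x0"
  proof -
    have "(\<lambda>M. y0 + reach (Suc M)) \<longlonglongrightarrow> y0 + 0" by (intro tendsto_intros LIMSEQ_Suc reach_tendsto_0)
    then have l: "(\<lambda>M. y0 + reach (Suc M)) \<longlonglongrightarrow> y0" by simp
    have "\<forall>\<^sub>F M in sequentially. y0 + reach (Suc M) \<in> {y0..y0 + 1}"
    proof (rule always_eventually, rule allI)
      fix M show "y0 + reach (Suc M) \<in> {y0..y0 + 1}"
        using reach_pos[of "Suc M"] reach_decreasing[of 0 "Suc M"] by (simp add: reach_def[of 0])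
    qed
    from continuous_on_tendsto_compose[OF X_cont l _ this]
    show ?thesis unfolding xs_def X0[symmetric] by simp
  qed
  have xs_dec: "xs (Suc M) \<le> xs M" "x0 < xs M" for M
    unfolding xs_def using reach_pos[of "Suc M"] reach_pos[of "Suc (Suc M)"] reach_decreasing[of 0 "Suc M"]
      reach_decreasing[of "Suc M" "Suc (Suc M)"] X_strict[of y0 "y0 + reach (Suc M)"]
    by (auto intro!: X_mono simp: reach_def[of 0] X0)
  have "?J u \<le> ?J v"
  proof -
    have "?J u = (\<integral>\<^sup>+x. (SUP M. ?f x * indicator {xs M..b} x) \<partial>lborel)"
      unfolding u_action_eq
    proof (rule nn_integral_cong_AE)
      have "AE x in lborel. x \<noteq> x0" by (rule AE_lborel_singleton)
      then show "AE x in lborel. ?f x * indicator {x0..b} x = (SUP M. ?f x * indicator {xs M..b} x)"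
      proof eventually_elim
        case (elim x)
        show ?case
        proof (cases "x0 < x \<and> x \<le> b")
          case True
          then obtain M where "xs M < x" using order_tendstoD(2)[OF xs_lim, of x]
            by (auto simp: eventually_sequentially)
          then have M: "?f x * indicator {xs M..b} x = ?f x" using True by simp
          show ?thesis
          proof (rule antisym)
            show "?f x * indicator {x0..b} x \<le> (SUP M. ?f x * indicator {xs M..b} x)"
              using SUP_upper[of M UNIV "\<lambda>M. ?f x * indicator {xs M..b} x"] M True by simp
            show "(SUP M. ?f x * indicator {xs M..b} x) \<le> ?f x * indicator {x0..b} x"
              using True by (intro SUP_least) (auto simp: indicator_def)
          qed
        next
          case False
          then have "x \<notin> {x0..b}" "x \<notin> {xs M..b}" for M using elim xs_dec(2)[of M] by auto
          then show ?thesis by simp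
        qed
      qed
    qed
    also have "\<dots> = (SUP M. \<integral>\<^sup>+x. ?f x * indicator {xs M..b} x \<partial>lborel)"
    proof (rule nn_integral_monotone_convergence_SUP)
      show "incseq (\<lambda>M x. ?f x * indicator {xs M..b} x)"
        by (intro incseq_SucI le_funI mult_left_mono) (use xs_dec(1) in \<open>auto simp: indicator_def intro: order.trans\<close>)
    next
      fix M
      show "(\<lambda>x. ?f x * indicator {xs M..b} x) \<in> borel_measurable lborel"
        by (rule energy_density_measurable) (rule xs_dec(2))
    qed
    also have "\<dots> \<le> ?J v" by (rule SUP_least) (rule tail)
    finally show ?thesis .
  qed
  then show ?thesis unfolding action_eq by (simp add: less_eq_ennreal.rep_eq)
qed

lemma u_minimizer: "minimizer L x0 b u"
  unfolding minimizer_def min_action_def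
proof (intro conjI u_AC antisym)
  show "action L u x0 b \<le> (INF v\<in>{v \<in> AC x0 b. v x0 = u x0 \<and> v b = u b}. action L v x0 b)"
    by (rule INF_greatest) (use u_action_le u_ends in auto)
  show "(INF v\<in>{v \<in> AC x0 b. v x0 = u x0 \<and> v b = u b}. action L v x0 b) \<le> action L u x0 b"
    by (rule INF_lower) (use u_AC in auto)
qed

lemma singular: "(x0, y0) \<in> universal_singular_set L"
  unfolding universal_singular_set_def
  using x0_b u_minimizer u_ends(1) u_infinite_derivative
  by (intro CollectI case_prodI exI[of _ x0] exI[of _ b] exI[of _ u]) simp

end

lemma (in construction) Sing_subset: "Sing \<subseteq> universal_singular_set L"
proof
  fix z assume z: "z \<in> Sing"
  obtain x0 y0 where xy: "z = (x0, y0)" by (cases z)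
  obtain a where a: "\<And>n. a n \<in> anchors n" "\<And>n. (x0, y0) \<in> cell n (a n)"
    "\<And>n. \<exists>i<N n. a (Suc n) = child n (a n) i" "\<And>n. \<bar>Yr n (a n) x0 y0\<bar> \<le> rs n / 16"
    using branch_exists[of x0 y0] z xy by metis
  interpret singular_point S S' K w w' h k0 ms kap N x0 y0 a
    by unfold_locales (use a in auto)
  obtain X where "X y0 = x0"
    "\<And>y. y \<in> {y0..y0 + 1} \<Longrightarrow> (X has_real_derivative rate (X y) y) (at y within {y0..y0 + 1})"
    using track_exists by blast
  then interpret track S S' K w w' h k0 ms kap N x0 y0 a X by unfold_locales
  show "z \<in> universal_singular_set L" using singular xy by simp
qed

section \<open>Choice of the parameters\<close>

text \<open>
  Compare the value at the midpoint with the two tangents.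
\<close>
lemma strictly_convex_derivative_strict_mono:
  assumes sc: "strictly_convex_on UNIV f" and d: "\<And>x. (f has_real_derivative f' x) (at x)" and qq: "q < q'"
  shows "f' q < f' q'"
proof -
  have strict: "f ((1 - t) *\<^sub>R x + t *\<^sub>R y) < (1 - t) * f x + t * f y" if "0 < t" "t < 1" "x \<noteq> y" for t x y
    using sc[unfolded strictly_convex_on_def, THEN conjunct2, rule_format, of t x y] that by simp
  have "convex_on UNIV f"
  proof (rule convex_onI)
    fix t x y :: real assume "0 < t" "t < 1"
    then show "f ((1 - t) *\<^sub>R x + t *\<^sub>R y) \<le> (1 - t) * f x + t * f y"
      using strict[of t x y] by (cases "x = y") (simp_all add: algebra_simps)
  qed simp
  then have tan: "f' x * (y - x) \<le> f y - f x" for x y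
    by (rule convex_on_imp_above_tangent[of UNIV]) (auto intro: d)
  have "f ((1 - 1/2) *\<^sub>R q + (1/2) *\<^sub>R q') < (1 - 1/2) * f q + 1/2 * f q'"
    by (rule strict) (use qq in simp_all)
  moreover have "(1 - 1/2) *\<^sub>R q + (1/2) *\<^sub>R q' = (q + q') / 2" by simp
  ultimately have m: "2 * f ((q + q') / 2) < f q + f q'" by (simp add: field_simps)
  have "f' q * ((q' - q) / 2) \<le> f ((q + q') / 2) - f q"
    using tan[of q "(q + q') / 2"] by (simp add: field_simps)
  moreover have "- (f' q' * ((q' - q) / 2)) \<le> f ((q + q') / 2) - f q'"
    using tan[of q' "(q + q') / 2"] by (simp add: field_simps)
  ultimately have "f' q * ((q' - q) / 2) < f' q' * ((q' - q) / 2)" using m by argo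
  then show ?thesis using qq by simp
qed

theorem theorem4p2:
  fixes \<omega> :: "real \<Rightarrow> real"
  assumes "smooth \<omega>"
    and "strictly_convex_on UNIV \<omega>"
    and "superlinear \<omega>"
    and "\<omega> 0 = 0"
    and "\<And>p. \<omega> p \<ge> \<omega> 0"
  shows "\<exists>S :: (real \<times> real) set.
    rectifiable S \<and> compact S \<and> linear_measure S > 0 \<and>
    (\<exists>(L :: real \<times> real \<times> real \<Rightarrow> real) (F :: real \<times> real \<times> real \<Rightarrow> real).
       lagrangian L \<and>
       (\<forall>x y p. L (x, y, p) = \<omega> p + F (x, y, p)) \<and>
       smooth F \<and>
       (\<forall>x y p. F (x, y, p) \<ge> 0) \<and>
       (\<forall>x y. F (x, y, 0) = 0) \<and>
       (\<forall>x y. convex_on UNIV (\<lambda>p. F (x, y, p))) \<and>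
       S \<subseteq> universal_singular_set L)"
proof -
  obtain \<omega>' where w': "smooth \<omega>'" "\<And>x. (\<omega> has_real_derivative \<omega>' x) (at x)"
    using smooth_real_derivative[OF assms(1)] by blast
  obtain S S' :: "real \<Rightarrow> real" and K where S: "smooth S" "\<And>t. (S has_real_derivative S' t) (at t)" "smooth S'"
    "\<And>t. 0 \<le> S' t" "\<And>t. S' t \<le> K" "\<And>t. t \<le> 0 \<Longrightarrow> S t = 0" "\<And>t. t \<ge> 1 \<Longrightarrow> S t = 1"
    "\<And>t. t \<le> 0 \<or> t \<ge> 1 \<Longrightarrow> S' t = 0"
    using smooth_step_exists by blast
  obtain h :: "real \<Rightarrow> real" and k0 where h: "smooth h" "convex_on UNIV h" "0 \<le> k0" "k0 \<le> 1"
    "\<And>t. t \<le> 0 \<Longrightarrow> h t = 0" "\<And>t. t \<ge> 1 \<Longrightarrow> h t = t - k0" "\<And>t. 0 \<le> h t" "\<And>t. t - k0 \<le> h t"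
    using smooth_ramp_exists by blast
  interpret smooth_step S S' K by unfold_locales (fact S)+
  interpret energy \<omega> \<omega>'
    by unfold_locales (use w' assms strictly_convex_derivative_strict_mono[OF assms(2) w'(2)] in auto)
  have "\<forall>n. \<exists>m>0. \<forall>s\<le>Bs n. m * (\<bar>s\<bar> + Bs n) \<le> D (ps n) s"
  proof
    fix n
    show "\<exists>m>0. \<forall>s\<le>Bs n. m * (\<bar>s\<bar> + Bs n) \<le> D (ps n) s"
      using Bs_facts(1)[of n] by (intro D_coercive) (auto simp: ps_def)
  qed
  then obtain ms where ms: "\<And>n. 0 < ms n" "\<And>n s. s \<le> Bs n \<Longrightarrow> ms n * (\<bar>s\<bar> + Bs n) \<le> D (ps n) s"
    by metis
  define c where "c = (\<lambda>n. ((E (Bs n) (ps (Suc n)) - E (Bs n) (ps n)) / (Bs n - cs n) + \<omega>' (ps (Suc n)) - \<omega>' (ps n)) * K)"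
  (* Adding 1 to the absolute value keeps the denominator positive. *)
  define kap where "kap = (\<lambda>n. min (eps n / 10) (eps n * min (ms n) 1 / (8 * (\<bar>c n\<bar> + 1))))"
  have kap: "0 < kap n" "10 * kap n \<le> eps n" "8 * kap n * (\<bar>c n\<bar> + 1) \<le> eps n * min (ms n) 1" for n
  proof -
    have p: "0 < 8 * (\<bar>c n\<bar> + 1)" by (simp add: add_nonneg_pos)
    show "0 < kap n" unfolding kap_def using eps_facts(1)[of n] ms(1)[of n] p by (simp add: zero_less_mult_iff)
    show "10 * kap n \<le> eps n" by (simp add: kap_def)
    have "kap n \<le> eps n * min (ms n) 1 / (8 * (\<bar>c n\<bar> + 1))" by (simp add: kap_def)
    then have "kap n * (8 * (\<bar>c n\<bar> + 1)) \<le> eps n * min (ms n) 1" using p by (simp only: pos_le_divide_eq)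
    then show "8 * kap n * (\<bar>c n\<bar> + 1) \<le> eps n * min (ms n) 1" by (simp only: mult.commute mult.left_commute mult.assoc)
  qed
  have kc: "8 * kap n * c n \<le> eps n * min (ms n) 1" for n
  proof -
    have "8 * kap n * c n \<le> 8 * kap n * (\<bar>c n\<bar> + 1)" using kap(1)[of n] by (intro mult_left_mono) auto
    then show ?thesis using kap(3)[of n] by linarith
  qed
  have "\<forall>n. \<exists>N::nat. 32 \<le> real N * kap n"
  proof
    fix n
    obtain N :: nat where "32 / kap n \<le> real N" using real_arch_simple by blast
    then show "\<exists>N::nat. 32 \<le> real N * kap n" using kap(1)[of n] by (auto simp: field_simps)
  qed
  then obtain N where N: "\<And>n. 32 \<le> real (N n) * kap n" by metis
  have kap_small: "8 * kap n * ((E (Bs n) (ps (Suc n)) - E (Bs n) (ps n)) / (Bs n - cs n)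
      + \<omega>' (ps (Suc n)) - \<omega>' (ps n)) * K \<le> eps n * min (ms n) 1" for n
    using kc[of n] unfolding c_def by (simp only: mult.assoc)
  have "construction S S' K \<omega> \<omega>' h k0 ms kap N"
  proof (intro construction.intro construction_axioms.intro smooth_step_axioms energy_axioms)
  qed (erule h ms kap(1,2) N | rule h ms kap(1,2) kap_small N)+
  then interpret construction S S' K \<omega> \<omega>' h k0 ms kap N .
  have "\<forall>x y p. L (x, y, p) = \<omega> p + F (x, y, p)" by (simp add: L_def)
  then show ?thesis
    using rectifiable_Sing compact_Sing linear_measure_Sing lagrangian_L[OF assms(3)] F_smooth F_nonneg F_0 F_convex Sing_subset
    by (intro exI[of _ Sing] exI[of _ L] exI[of _ F] conjI) simp_all
qed

end
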